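(* Let $d\in\{2,3\}$, let $V$ be the harmonic potential $V(\mathbf{x})=\frac12(\gamma_x^2x^2+\gamma_y^2y^2)$ if $d=2$ and $V(\mathbf{x})=\frac12(\gamma_x^2x^2+\gamma_y^2y^2+\gamma_z^2z^2)$ if $d=3$, with positive trapping frequencies $\gamma_x,\gamma_y$ (and $\gamma_z$ if $d=3$), and let $c_0,c_1,\Omega,\gamma\in\mathbb{R}$. Suppose that $|\Omega|<\min\{\gamma_x,\gamma_y\}$. Then there exists a ground state, i.e. there exists $\Phi_{\rm g}\in\mathcal{M}$ with $\mathcal{E}(\Phi_{\rm g})=\min_{\Phi\in\mathcal{M}}\mathcal{E}(\Phi)$, in each of the following situations: (1) $d=2$ and $c_0>-C_b$ and $c_0+c_1>-C_b$; (2) $d=3$ and either ($c_0\ge 0$ and $c_1\geq 0$) or ($c_1\leq 0$ and $c_0+c_1\geq 0$).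
   Context: Points of $\mathbb{R}^d$ are written $\mathbf{x}=(x,y)$ if $d=2$ and $\mathbf{x}=(x,y,z)$ if $d=3$. All wave functions are complex valued. Let $L^2_V(\mathbb{R}^d)=\{\phi : \int_{\mathbb{R}^d}V(\mathbf{x})|\phi(\mathbf{x})|^2\,d\mathbf{x}<\infty\}$. The admissible set is $$\mathcal{M}=\Big\{\Phi=(\phi_1,\phi_0,\phi_{-1})^\top : \phi_j\in H^1(\mathbb{R}^d)\cap L^2_V(\mathbb{R}^d),\ j=-1,0,1,\ \int_{\mathbb{R}^d}\sum_{j=-1}^1|\phi_j|^2\,d\mathbf{x}=1\Big\}.$$ The energy functional (rotating spin-orbit coupled spin-1 Bose-Einstein condensate) is $$\mathcal{E}(\Phi)=\int_{\mathbb{R}^d}\Big[\sum_{j=-1}^1\Big(\tfrac12|\nabla\phi_j|^2+V|\phi_j|^2-\Omega\,\bar\phi_jL_z\phi_j\Big)+\tfrac{c_0}{2}\rho^2+\tfrac{c_1}{2}|\mathbf{F}|^2-\gamma\,\Phi^\dagger\mathbf{S}\Phi\Big]\,d\mathbf{x},$$ where - $L_z=-i(x\partial_y-y\partial_x)$; - $\rho=|\phi_1|^2+|\phi_0|^2+|\phi_{-1}|^2$; - $\mathbf{F}=(F_x,F_y,F_z)$ is the real vector with $F_x=\frac{1}{\sqrt2}[\bar\phi_1\phi_0+\bar\phi_0(\phi_1+\phi_{-1})+\bar\phi_{-1}\phi_0]$, $F_y=\frac{i}{\sqrt2}[-\bar\phi_1\phi_0+\bar\phi_0(\phi_1-\phi_{-1})+\bar\phi_{-1}\phi_0]$,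 $F_z=|\phi_1|^2-|\phi_{-1}|^2$; - $\Phi^\dagger\mathbf{S}\Phi=\bar\phi_1L_0\phi_0+\bar\phi_0(L_0\phi_{-1}+L_1\phi_1)+\bar\phi_{-1}L_1\phi_0$ with $L_0=i\partial_x+\partial_y$ and $L_1=i\partial_x-\partial_y$. The energy is real because $L_z$ is symmetric and $L_0,L_1$ are formal adjoints of each other. The constant $C_b$ (used for $d=2$) is $$C_b=\inf_{0\neq\phi\in H^1(\mathbb{R}^2)}\frac{\|\nabla\phi\|_2^2\,\|\phi\|_2^2}{\|\phi\|_4^4}.$$ *)

theory Defs
  imports "HOL-Analysis.Analysis"
begin

section \<open>Sobolev functions\<close>

text \<open>
  Elements of $L^2$ and $H^1$ are represented by Borel functions, without passing to the quotient
  modulo null sets; the function spaces and the energy respect almost everywhere equality of Borel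
  functions.
\<close>

type_synonym 'n point = "real ^ 'n"

type_synonym 'n wavefun = "'n point \<Rightarrow> complex"

definition partial_deriv :: "'n::finite \<Rightarrow> ('n point \<Rightarrow> real) \<Rightarrow> 'n point \<Rightarrow> real" where
  "partial_deriv i f x = frechet_derivative f (at x) (axis i 1)"

fun Ck :: "nat \<Rightarrow> (('n::finite) point \<Rightarrow> real) \<Rightarrow> bool" where
  "Ck 0 f \<longleftrightarrow> continuous_on UNIV f"
| "Ck (Suc k) f \<longleftrightarrow> (\<forall>x. f differentiable (at x)) \<and> (\<forall>i. Ck k (partial_deriv i f))"

definition test_function :: "(('n::finite) point \<Rightarrow> real) \<Rightarrow> bool" where
  "test_function \<eta> \<longleftrightarrow> (\<forall>k. Ck k \<eta>) \<and> compact (closure {x. \<eta> x \<noteq> 0})"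

definition locally_integrable :: "('n::finite) wavefun \<Rightarrow> bool" where
  "locally_integrable f \<longleftrightarrow> (\<forall>K. compact K \<longrightarrow> set_integrable lborel K f)"

definition has_weak_partial :: "'n::finite \<Rightarrow> 'n wavefun \<Rightarrow> 'n wavefun \<Rightarrow> bool" where
  "has_weak_partial i f g \<longleftrightarrow> locally_integrable f \<and> locally_integrable g \<and>
     (\<forall>\<eta>. test_function \<eta> \<longrightarrow>
        (LINT x|lborel. partial_deriv i \<eta> x *\<^sub>R f x) = - (LINT x|lborel. \<eta> x *\<^sub>R g x))"

text \<open>Weak derivatives are unique only up to null sets, so a representative is chosen.\<close>

definition weak_partial :: "'n \<Rightarrow> ('n::finite) wavefun \<Rightarrow> 'n wavefun" where
  "weak_partial i f = (SOME g. has_weak_partial i f g)"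

definition L2 :: "('n::finite) wavefun set" where
  "L2 = {f \<in> borel_measurable lborel. integrable lborel (\<lambda>x. (cmod (f x))\<^sup>2)}"

definition L2_weighted :: "('n point \<Rightarrow> real) \<Rightarrow> ('n::finite) wavefun set" where
  "L2_weighted V = {f. integrable lborel (\<lambda>x. V x * (cmod (f x))\<^sup>2)}"

definition H1 :: "('n::finite) wavefun set" where
  "H1 = {f \<in> L2. \<forall>i. \<exists>g \<in> L2. has_weak_partial i f g}"

definition grad_sq :: "('n::finite) wavefun \<Rightarrow> 'n point \<Rightarrow> real" where
  "grad_sq f x = (\<Sum>i\<in>UNIV. (cmod (weak_partial i f x))\<^sup>2)"


section \<open>Spin-1 condensates\<close>

text \<open>The triple is $(\phi_1, \phi_0, \phi_{-1})$.\<close>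

type_synonym 'n spinor = "'n wavefun \<times> 'n wavefun \<times> 'n wavefun"

definition admissible :: "('n point \<Rightarrow> real) \<Rightarrow> ('n::finite) spinor set" where
  "admissible V = {(\<phi>\<^sub>1, \<phi>\<^sub>0, \<phi>\<^sub>m).
     \<phi>\<^sub>1 \<in> H1 \<inter> L2_weighted V \<and> \<phi>\<^sub>0 \<in> H1 \<inter> L2_weighted V \<and> \<phi>\<^sub>m \<in> H1 \<inter> L2_weighted V \<and>
     (LINT x|lborel. (cmod (\<phi>\<^sub>1 x))\<^sup>2 + (cmod (\<phi>\<^sub>0 x))\<^sup>2 + (cmod (\<phi>\<^sub>m x))\<^sup>2) = 1}"

text \<open>
  Coordinates 1 and 2 are $x$ and $y$; the operators below do not involve $z$ and are thus shared
  by both dimensions.  (The index type \<^typ>\<open>2\<close> satisfies $2 = 0 \neq 1$.)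
\<close>

definition angular_momentum :: "('n::{finite,numeral}) wavefun \<Rightarrow> 'n wavefun" where
  "angular_momentum f x =
     - \<i> * (of_real (x $ 1) * weak_partial 2 f x - of_real (x $ 2) * weak_partial 1 f x)"

definition L\<^sub>0 :: "('n::{finite,numeral}) wavefun \<Rightarrow> 'n wavefun" where
  "L\<^sub>0 f x = \<i> * weak_partial 1 f x + weak_partial 2 f x"

definition L\<^sub>1 :: "('n::{finite,numeral}) wavefun \<Rightarrow> 'n wavefun" where
  "L\<^sub>1 f x = \<i> * weak_partial 1 f x - weak_partial 2 f x"

fun spin_orbit :: "('n::{finite,numeral}) spinor \<Rightarrow> 'n point \<Rightarrow> complex" where
  "spin_orbit (\<phi>\<^sub>1, \<phi>\<^sub>0, \<phi>\<^sub>m) x =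
     cnj (\<phi>\<^sub>1 x) * L\<^sub>0 \<phi>\<^sub>0 x + cnj (\<phi>\<^sub>0 x) * (L\<^sub>0 \<phi>\<^sub>m x + L\<^sub>1 \<phi>\<^sub>1 x) + cnj (\<phi>\<^sub>m x) * L\<^sub>1 \<phi>\<^sub>0 x"

fun density :: "('n::finite) spinor \<Rightarrow> 'n point \<Rightarrow> real" where
  "density (\<phi>\<^sub>1, \<phi>\<^sub>0, \<phi>\<^sub>m) x = (cmod (\<phi>\<^sub>1 x))\<^sup>2 + (cmod (\<phi>\<^sub>0 x))\<^sup>2 + (cmod (\<phi>\<^sub>m x))\<^sup>2"

fun F\<^sub>x :: "('n::finite) spinor \<Rightarrow> 'n point \<Rightarrow> complex" where
  "F\<^sub>x (\<phi>\<^sub>1, \<phi>\<^sub>0, \<phi>\<^sub>m) x = 1 / of_real (sqrt 2) *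
     (cnj (\<phi>\<^sub>1 x) * \<phi>\<^sub>0 x + cnj (\<phi>\<^sub>0 x) * (\<phi>\<^sub>1 x + \<phi>\<^sub>m x) + cnj (\<phi>\<^sub>m x) * \<phi>\<^sub>0 x)"

fun F\<^sub>y :: "('n::finite) spinor \<Rightarrow> 'n point \<Rightarrow> complex" where
  "F\<^sub>y (\<phi>\<^sub>1, \<phi>\<^sub>0, \<phi>\<^sub>m) x = \<i> / of_real (sqrt 2) *
     (- cnj (\<phi>\<^sub>1 x) * \<phi>\<^sub>0 x + cnj (\<phi>\<^sub>0 x) * (\<phi>\<^sub>1 x - \<phi>\<^sub>m x) + cnj (\<phi>\<^sub>m x) * \<phi>\<^sub>0 x)"

fun F\<^sub>z :: "('n::finite) spinor \<Rightarrow> 'n point \<Rightarrow> complex" where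
  "F\<^sub>z (\<phi>\<^sub>1, \<phi>\<^sub>0, \<phi>\<^sub>m) x = of_real ((cmod (\<phi>\<^sub>1 x))\<^sup>2 - (cmod (\<phi>\<^sub>m x))\<^sup>2)"

lemma F_real: "F\<^sub>x \<Phi> x \<in> \<real>" "F\<^sub>y \<Phi> x \<in> \<real>" "F\<^sub>z \<Phi> x \<in> \<real>"
proof -
  obtain f g h where \<Phi>: "\<Phi> = (f, g, h)"
    by (cases \<Phi>)
  show "F\<^sub>x \<Phi> x \<in> \<real>" "F\<^sub>y \<Phi> x \<in> \<real>" "F\<^sub>z \<Phi> x \<in> \<real>"
    unfolding \<Phi> Reals_cnj_iff by (simp_all add: algebra_simps)
qed

definition spin_sq :: "('n::finite) spinor \<Rightarrow> 'n point \<Rightarrow> real" where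
  "spin_sq \<Phi> x = (cmod (F\<^sub>x \<Phi> x))\<^sup>2 + (cmod (F\<^sub>y \<Phi> x))\<^sup>2 + (cmod (F\<^sub>z \<Phi> x))\<^sup>2"

definition single_energy_density ::
  "('n point \<Rightarrow> real) \<Rightarrow> real \<Rightarrow> ('n::{finite,numeral}) wavefun \<Rightarrow> 'n point \<Rightarrow> complex" where
  "single_energy_density V \<Omega> f x =
     of_real (1/2 * grad_sq f x + V x * (cmod (f x))\<^sup>2) - of_real \<Omega> * cnj (f x) * angular_momentum f x"

fun energy_density ::
  "('n point \<Rightarrow> real) \<Rightarrow> real \<Rightarrow> real \<Rightarrow> real \<Rightarrow> real \<Rightarrow>
     ('n::{finite,numeral}) spinor \<Rightarrow> 'n point \<Rightarrow> complex" where
  "energy_density V c\<^sub>0 c\<^sub>1 \<Omega> \<gamma> (\<phi>\<^sub>1, \<phi>\<^sub>0, \<phi>\<^sub>m) x =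
     single_energy_density V \<Omega> \<phi>\<^sub>1 x + single_energy_density V \<Omega> \<phi>\<^sub>0 x
     + single_energy_density V \<Omega> \<phi>\<^sub>m x
     + of_real (c\<^sub>0 / 2 * (density (\<phi>\<^sub>1, \<phi>\<^sub>0, \<phi>\<^sub>m) x)\<^sup>2 + c\<^sub>1 / 2 * spin_sq (\<phi>\<^sub>1, \<phi>\<^sub>0, \<phi>\<^sub>m) x)
     - of_real \<gamma> * spin_orbit (\<phi>\<^sub>1, \<phi>\<^sub>0, \<phi>\<^sub>m) x"

text \<open>
  The density is pointwise complex, but its integral over an admissible state is real, so
  \<^const>\<open>Re\<close> only adjusts the type.
\<close>

definition energy ::
  "('n point \<Rightarrow> real) \<Rightarrow> real \<Rightarrow> real \<Rightarrow> real \<Rightarrow> real \<Rightarrow> ('n::{finite,numeral}) spinor \<Rightarrow> real" where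
  "energy V c\<^sub>0 c\<^sub>1 \<Omega> \<gamma> \<Phi> = Re (LINT x|lborel. energy_density V c\<^sub>0 c\<^sub>1 \<Omega> \<gamma> \<Phi> x)"

definition ground_state ::
  "('n point \<Rightarrow> real) \<Rightarrow> real \<Rightarrow> real \<Rightarrow> real \<Rightarrow> real \<Rightarrow> ('n::{finite,numeral}) spinor \<Rightarrow> bool" where
  "ground_state V c\<^sub>0 c\<^sub>1 \<Omega> \<gamma> \<Phi> \<longleftrightarrow> \<Phi> \<in> admissible V \<and>
     (\<forall>\<Psi> \<in> admissible V. energy V c\<^sub>0 c\<^sub>1 \<Omega> \<gamma> \<Phi> \<le> energy V c\<^sub>0 c\<^sub>1 \<Omega> \<gamma> \<Psi>)"

definition harmonic_2d :: "real \<Rightarrow> real \<Rightarrow> 2 point \<Rightarrow> real" where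
  "harmonic_2d \<gamma>\<^sub>x \<gamma>\<^sub>y x = 1/2 * (\<gamma>\<^sub>x\<^sup>2 * (x $ 1)\<^sup>2 + \<gamma>\<^sub>y\<^sup>2 * (x $ 2)\<^sup>2)"

definition harmonic_3d :: "real \<Rightarrow> real \<Rightarrow> real \<Rightarrow> 3 point \<Rightarrow> real" where
  "harmonic_3d \<gamma>\<^sub>x \<gamma>\<^sub>y \<gamma>\<^sub>z x = 1/2 * (\<gamma>\<^sub>x\<^sup>2 * (x $ 1)\<^sup>2 + \<gamma>\<^sub>y\<^sup>2 * (x $ 2)\<^sup>2 + \<gamma>\<^sub>z\<^sup>2 * (x $ 3)\<^sup>2)"

text \<open>
  The infimum is over a nonempty set of nonnegative reals, and nonzero means nonzero as an
  element of $L^2$.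
\<close>

definition C\<^sub>b :: real where
  "C\<^sub>b = (INF f \<in> {f \<in> H1 :: 2 wavefun set. \<not> (AE x in lborel. f x = 0)}.
     (LINT x|lborel. grad_sq f x) * (LINT x|lborel. (cmod (f x))\<^sup>2) / (LINT x|lborel. (cmod (f x))^4))"

end

theory Submission
  imports Defs "HOL-Real_Asymp.Real_Asymp" "HOL-Complex_Analysis.Great_Picard"
begin

text \<open>
  The direct method of the calculus of variations, with every Sobolev fact obtained from translates.
  If \<open>u\<close> has weak partial derivative \<open>g\<close> in direction \<open>i\<close>, then almost everywhere
  \<open>u (x + t e) - u x\<close> is the integral of \<open>g\<close> over the segment, so that the $L^2$ modulus of continuity
  of \<open>u\<close> is bounded by the gradient.  Averages over dyadic cubes then give both the embedding into
  $L^4$ (increments of the averages are small in $L^2$ and in $L^\infty$, and the resulting series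
  converges for $d < 4$) and compactness in $L^2$ in the presence of a trap.

  Conversely, an $L^2$ Lipschitz bound on translates produces a weak derivative.  Applied to the modulus
  of \<open>exp (- \<i> p) u\<close> this yields the diamagnetic inequality, which allows $C_b$ to be used with the
  magnetic gradient \<open>\<nabla> - \<i> A\<close>, where \<open>A = \<Omega> (-y, x)\<close>.  Completing the square turns the rotation
  term into \<open>A\<close> and leaves the potential \<open>V - \<Omega>\<^sup>2 (x\<^sup>2 + y\<^sup>2) / 2\<close>, which is still confining;
  the spin-orbit term is of lower order.

  Weak compactness is replaced by the parallelogram law: given the $L^2$ limit \<open>\<Phi>\<close> of a minimising
  sequence, near-minimisers of the quadratic part of the energy over shrinking $L^2$ neighbourhoods
  of \<open>\<Phi>\<close> are Cauchy in the energy norm.  This puts \<open>\<Phi>\<close> into the form domain and gives lower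
  semicontinuity of the quadratic part; the interaction is handled by Fatou's lemma and
  convergence in $L^4$.
\<close>

subsection \<open>Test functions and the fundamental lemma\<close>

text \<open>Why the thresholds involve \<open>c\<^sub>0\<close> and
  \<open>c\<^sub>0 + c\<^sub>1\<close>: since |F|^2 + |phi_0^2 - 2 phi_1 phi_{-1}|^2 = rho^2, the
  interaction density is one half of \<open>c\<^sub>0\<close> times one nonnegative weight plus
  \<open>c\<^sub>0 + c\<^sub>1\<close> times another, and the two weights add up to rho^2. If both
  numbers are at least -\<beta>, the interaction energy is at least -\<beta>/2 times the integral of
  rho^2. The spinor form of the Gagliardo-Nirenberg inequality, with the same constant C_b as in the
  scalar case, bounds this loss by \<beta>/(2 C_b) times the magnetic energy, which enters the total
  energy with factor 1/2. So \<beta> < C_b leaves a positive fraction for coercivity; in three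
  dimensions \<beta> = 0. The field A is not a gradient unless \<Omega> = 0, so no gauge removes it
  from all directions at once. The diamagnetic inequality is therefore proved for one direction at a
  time: each single component of A is a partial derivative of a multiple of xy, and different
  directions may use different gauges because all of them leave |u| unchanged.\<close>

lemma partial_deriv_eq: "(f has_derivative f') (at x) \<Longrightarrow> partial_deriv i f x = f' (axis i 1)"
  unfolding partial_deriv_def by (metis frechet_derivative_at)

section \<open>Calculus of k times continuously differentiable functions\<close>

lemma Ck_SucI:
  assumes "\<And>x. (f has_derivative D x) (at x)" and "\<And>i. Ck k (\<lambda>x. D x (axis i 1))"
  shows "Ck (Suc k) f"
proof -
  have "partial_deriv i f = (\<lambda>x. D x (axis i 1))" for i
    using partial_deriv_eq[OF assms(1)] by auto
  with assms show ?thesis by (auto simp: differentiable_def)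
qed

lemma Ck_Suc_has_derivative:
  "Ck (Suc k) f \<Longrightarrow> (f has_derivative frechet_derivative f (at x)) (at x)"
  by (simp add: frechet_derivative_works)

lemma Ck_Suc_imp: "Ck (Suc k) f \<Longrightarrow> Ck k f"
proof (induction k arbitrary: f)
  case 0
  then show ?case
    by (auto simp: continuous_on_eq_continuous_at intro: differentiable_imp_continuous_within)
next
  case (Suc k)
  then show ?case by (metis Ck.simps(2))
qed

lemma Ck_Suc_partial: "Ck (Suc k) f \<Longrightarrow> Ck k (\<lambda>x. frechet_derivative f (at x) (axis i 1))"
  by (simp add: partial_deriv_def[abs_def])

lemma Ck_const: "Ck k (\<lambda>x. c)"
proof (induction k arbitrary: c)
  case (Suc k)
  show ?case by (rule Ck_SucI[where D="\<lambda>_ _. 0"]) (auto intro: Suc)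
qed simp

lemma Ck_coord: "Ck k (\<lambda>x. x $ j)"
proof (cases k)
  case (Suc k)
  show ?thesis unfolding Suc
    by (rule Ck_SucI[where D="\<lambda>_ h. h $ j"])
      (auto intro: Ck_const bounded_linear_imp_has_derivative)
qed (auto intro: continuous_intros)

lemma Ck_add: "Ck k f \<Longrightarrow> Ck k g \<Longrightarrow> Ck k (\<lambda>x. f x + g x)"
proof (induction k arbitrary: f g)
  case (Suc k)
  show ?case
    by (rule Ck_SucI[OF has_derivative_add[OF Suc.prems[THEN Ck_Suc_has_derivative]]])
      (intro Suc.IH Suc.prems[THEN Ck_Suc_partial])
qed (auto intro: continuous_intros)

lemma Ck_mult: "Ck k f \<Longrightarrow> Ck k g \<Longrightarrow> Ck k (\<lambda>x. f x * g x)"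
proof (induction k arbitrary: f g)
  case (Suc k)
  show ?case
    by (rule Ck_SucI[OF has_derivative_mult[OF Suc.prems[THEN Ck_Suc_has_derivative]]])
      (intro Ck_add Suc.IH Suc.prems[THEN Ck_Suc_partial] Suc.prems[THEN Ck_Suc_imp])
qed (auto intro: continuous_intros)

lemma Ck_prod: "(\<And>i. i \<in> I \<Longrightarrow> Ck k (f i)) \<Longrightarrow> Ck k (\<lambda>x. \<Prod>i\<in>I. f i x)"
  by (induction I rule: infinite_finite_induct) (auto intro: Ck_const Ck_mult)

text \<open>The chain rule passes from \<open>h m\<close> to \<open>h (Suc m)\<close>, so the
  induction needs a whole sequence of outer functions, each the derivative of its predecessor, and
  an arbitrary \<open>m\<close>. The sequences used are the iterated \<open>flat_step\<close> and
  the phase-shifted cosines.\<close>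

lemma Ck_chain:
  assumes h: "\<And>m t. (h m has_real_derivative h (Suc m) t) (at t)" and p: "\<And>k. Ck k p"
  shows "Ck k (\<lambda>x. h m (p x))"
proof (induction k arbitrary: m)
  case 0
  have "continuous_on UNIV (h m)"
    using h by (auto intro: continuous_at_imp_continuous_on DERIV_isCont)
  then show ?case using p[of 0]
    by (auto intro: continuous_on_compose2)
next
  case (Suc k)
  show ?case
    by (rule Ck_SucI[OF DERIV_compose_FDERIV[OF h Ck_Suc_has_derivative[OF p]]])
      (intro Ck_mult Ck_Suc_partial p Suc)
qed

lemma partial_deriv_translate:
  assumes "f differentiable (at (x + a))"
  shows "partial_deriv i (\<lambda>x. f (x + a)) x = partial_deriv i f (x + a)"
    and "((\<lambda>x. f (x + a)) has_derivative frechet_derivative f (at (x + a))) (at x)"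
proof -
  have "(f has_derivative frechet_derivative f (at (x + a))) (at (x + a))"
    using assms by (simp add: frechet_derivative_works)
  then show *: "((\<lambda>x. f (x + a)) has_derivative frechet_derivative f (at (x + a))) (at x)"
    by (auto intro!: derivative_eq_intros has_derivative_compose[where f="\<lambda>x. x + a" and g=f and f'="\<lambda>x. x"])
  show "partial_deriv i (\<lambda>x. f (x + a)) x = partial_deriv i f (x + a)"
    using partial_deriv_eq[OF *] by (simp add: partial_deriv_def)
qed

lemma Ck_translate: "Ck k f \<Longrightarrow> Ck k (\<lambda>x. f (x + a))"
proof (induction k arbitrary: f)
  case (Suc k)
  show ?case
    by (rule Ck_SucI[OF partial_deriv_translate(2)])
      (use Suc in \<open>auto simp: partial_deriv_def[abs_def]\<close>)
next
  case (0 f)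
  then show ?case by (auto intro!: continuous_on_compose2[of UNIV f UNIV] continuous_intros)
qed

text \<open>
  The polynomial factor makes the family \<open>flat c\<close> closed under differentiation; letting \<open>c\<close> tend to 0
  at \<open>p = 1\<close> gives the indicator function of the positive half-line.
\<close>

definition flat :: "real \<Rightarrow> real poly \<Rightarrow> real \<Rightarrow> real" where
  "flat c p t = (if t \<le> 0 then 0 else poly p (1 / t) * exp (- c / t))"

text \<open>With s = 1/t one has ds/dt = -s^2, so p(s) exp(-c s) has t-derivative s^2 (c p - p')(s)
  exp(-c s).\<close>

definition flat_step :: "real \<Rightarrow> real poly \<Rightarrow> real poly" where
  "flat_step c p = monom 1 2 * (smult c p - pderiv p)"

text \<open>The free power \<open>s ^ k\<close> makes induction on the polynomial work: splitting
  off the constant coefficient leaves s times a shorter polynomial, which is the same claim at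
  \<open>Suc k\<close>.\<close>

lemma poly_exp_decay:
  fixes c :: real assumes "c > 0"
  shows "((\<lambda>s. s ^ k * poly p s * exp (- c * s)) \<longlongrightarrow> 0) at_top"
proof (induction p arbitrary: k)
  case (pCons a p)
  have "((\<lambda>s::real. s ^ k * exp (- c * s)) \<longlongrightarrow> 0) at_top"
    using assms by real_asymp
  from tendsto_add[OF tendsto_mult_right_zero[OF this, of a] pCons.IH[of "Suc k"]]
  show ?case by (simp add: algebra_simps)
qed simp

lemma flat_has_derivative:
  assumes "c > 0"
  shows "(flat c p has_real_derivative flat c (flat_step c p) t) (at t)"
proof -
  consider "t > 0" | "t < 0" | "t = 0" by linarith
  then show ?thesis
  proof cases
    case 1
    have "((\<lambda>t. poly p (1 / t) * exp (- c / t)) has_real_derivative flat c (flat_step c p) t) (at t)"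
      using 1 by (auto intro!: derivative_eq_intros DERIV_chain2[OF poly_DERIV]
          simp: flat_def flat_step_def poly_monom field_simps power2_eq_square)
    moreover have "eventually (\<lambda>t. flat c p t = poly p (1 / t) * exp (- c / t)) (nhds t)"
      using order_tendstoD(1)[OF tendsto_ident_at, of 0 t UNIV] 1
      by (auto simp: eventually_nhds_conv_at flat_def elim: eventually_mono)
    ultimately show ?thesis by (subst DERIV_cong_ev) auto
  next
    case 2
    have "eventually (\<lambda>t. flat c p t = 0) (nhds t)"
      using order_tendstoD(2)[OF tendsto_ident_at, of t 0 UNIV] 2
      by (auto simp: eventually_nhds_conv_at flat_def elim: eventually_mono)
    then have "(flat c p has_real_derivative 0) (at t)"
      by (subst DERIV_cong_ev) auto
    then show ?thesis using 2 by (simp add: flat_def)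
  next
    case 3
    have "((\<lambda>h. flat c p h / h) \<longlongrightarrow> 0) (at_left 0)"
      by (rule tendsto_eventually) (auto simp: flat_def eventually_at_filter)
    moreover have "((\<lambda>h. flat c p h / h) \<longlongrightarrow> 0) (at_right 0)"
    proof -
      \<comment> \<open>The difference quotient at 0 is \<open>flat c p h / h\<close>; with s = 1/h
        it is s p(s) exp(-c s), and h tending to 0 from the right means s tending to
        infinity.\<close>
      have "((\<lambda>h. (1 / h) ^ 1 * poly p (1 / h) * exp (- c * (1 / h))) \<longlongrightarrow> 0) (at_right (0::real))"
        by (rule filterlim_compose[OF poly_exp_decay[OF assms]]) real_asymp
      moreover have "eventually (\<lambda>h. (1 / h) ^ 1 * poly p (1 / h) * exp (- c * (1 / h)) = flat c p h / h) (at_right 0)"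
        by (auto simp: flat_def eventually_at_filter)
      ultimately show ?thesis by (rule Lim_transform_eventually)
    qed
    ultimately have "((\<lambda>h. flat c p h / h) \<longlongrightarrow> 0) (at 0)"
      by (simp add: filterlim_split_at)
    then show ?thesis using 3 by (simp add: has_field_derivative_iff flat_def)
  qed
qed

lemma Ck_flat: assumes "c > 0" "\<And>k. Ck k q" shows "Ck k (\<lambda>x. flat c p (q x))"
proof -
  have "Ck k (\<lambda>x. (\<lambda>m. flat c ((flat_step c ^^ m) p)) 0 (q x))"
    by (rule Ck_chain) (use flat_has_derivative assms in auto)
  then show ?thesis by simp
qed

text \<open>These functions stay between 0 and 1, vanish off the open box and converge to its
  indicator as \<open>n\<close> grows, so dominated convergence turns statements about test
  functions into statements about boxes.\<close>

definition box_bump :: "nat \<Rightarrow> 'n point \<Rightarrow> 'n point \<Rightarrow> ('n::finite) point \<Rightarrow> real" where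
  "box_bump n a b x = (\<Prod>i\<in>UNIV. flat (1 / Suc n) 1 (x $ i - a $ i) * flat (1 / Suc n) 1 (b $ i - x $ i))"

lemma box_bump_eq_0: "x \<notin> box a b \<Longrightarrow> box_bump n a b x = 0"
  by (force simp: box_bump_def flat_def mem_box_cart not_less)

lemma test_function_box_bump: "test_function (box_bump n a b)"
proof -
  have "Ck k (box_bump n a b)" for k
    unfolding box_bump_def[abs_def]
    by (intro Ck_prod Ck_mult Ck_flat Ck_add[where g="\<lambda>x. - c" for c, simplified]
        Ck_add[where f="\<lambda>x. c" and g="\<lambda>x. - 1 * x $ i" for c i, simplified] Ck_const Ck_coord)
      (auto intro: Ck_mult[where f="\<lambda>x. -1", simplified] Ck_const Ck_coord)
  moreover have "bounded {x. box_bump n a b x \<noteq> 0}"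
    by (rule bounded_subset[OF bounded_box[of a b]]) (use box_bump_eq_0 in blast)
  ultimately show ?thesis by (simp add: test_function_def)
qed

lemma box_bump_bounds: "0 \<le> box_bump n a b x" "box_bump n a b x \<le> 1"
proof -
  have f: "0 \<le> flat (1 / Suc n) 1 t" "flat (1 / Suc n) 1 t \<le> 1" for t
    by (auto simp: flat_def)
  show "0 \<le> box_bump n a b x" unfolding box_bump_def by (intro prod_nonneg) (auto simp del: of_nat_Suc intro!: mult_nonneg_nonneg f)
  show "box_bump n a b x \<le> 1" unfolding box_bump_def by (intro prod_le_1) (auto simp del: of_nat_Suc intro!: mult_le_one mult_nonneg_nonneg f)
qed

lemma box_bump_tendsto: "(\<lambda>n. box_bump n a b x) \<longlonglongrightarrow> indicator (box a b) x"
proof (cases "x \<in> box a b")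
  case True
  have f: "(\<lambda>n. flat (1 / Suc n) 1 t) \<longlonglongrightarrow> 1" if "t > 0" for t :: real
  proof -
    have "(\<lambda>n. exp (- (1 / real (Suc n)) / t)) \<longlonglongrightarrow> 1" using that by real_asymp
    then show ?thesis using that by (simp add: flat_def)
  qed
  have "(\<lambda>n. box_bump n a b x) \<longlonglongrightarrow> (\<Prod>i\<in>(UNIV::'a set). 1 * 1)"
    unfolding box_bump_def by (intro tendsto_prod tendsto_mult f) (use True in \<open>auto simp: mem_box_cart\<close>)
  then show ?thesis using True by simp
qed (simp add: box_bump_eq_0)

text \<open>Boxes form an intersection-stable generator of the Borel sets, and the sets on which
  \<open>w\<close> integrates to 0 form a Dynkin system. Closure under complements needs the
  integral over the whole space, which is no box; it is the limit of integrals over growing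
  boxes.\<close>

lemma AE_zero_if_box_integrals_zero:
  fixes w :: "('n::finite) wavefun"
  assumes w: "integrable lborel w" and z: "\<And>a b. (LINT x|lborel. indicator (box a b) x *\<^sub>R w x) = 0"
  shows "AE x in lborel. w x = 0"
proof (rule sigma_finite_measure.density_zero[OF sigma_finite_lborel w])
  fix A :: "'n point set" assume "A \<in> sets lborel"
  then have "A \<in> sigma_sets UNIV (range (\<lambda>(a, b). box a b))"
    by (simp add: borel_eq_box)
  note A = this
  have "Int_stable (range (\<lambda>(a, b). box a b :: 'n point set))"
    by (auto simp: Int_stable_def box_Int_box)
  moreover have "range (\<lambda>(a, b). box a b :: 'n point set) \<subseteq> Pow UNIV" by simp
  moreover note A
  ultimately have "A \<in> sets borel \<and> set_lebesgue_integral lborel A w = 0"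
  proof (induction rule: sigma_sets_induct_disjoint)
    case (basic A)
    then show ?case using z by (auto simp: set_lebesgue_integral_def)
  next
    case empty
    then show ?case by (simp add: set_lebesgue_integral_def)
  next
    case (compl A)
    have [measurable]: "A \<in> sets lborel" using compl by simp
    obtain B :: "nat \<Rightarrow> 'n point set" where B: "B = (\<lambda>n. box (- (\<chi> i. real n)) (\<chi> i. real n))" by simp
    have "(\<lambda>n. LINT x|lborel. indicator (B n) x *\<^sub>R w x) \<longlonglongrightarrow> (LINT x|lborel. w x)"
    proof (rule integral_dominated_convergence[where w="\<lambda>x. norm (w x)"])
      show "AE x in lborel. (\<lambda>n. indicator (B n) x *\<^sub>R w x) \<longlonglongrightarrow> w x"
      proof (intro AE_I2 tendsto_eventually)
        fix x :: "'n point"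
        obtain N where N: "norm x < real N" using reals_Archimedean2 by blast
        show "\<forall>\<^sub>F n in sequentially. indicator (B n) x *\<^sub>R w x = w x"
        proof (rule eventually_sequentiallyI[of N])
          fix n assume "n \<ge> N"
          have "\<bar>x $ i\<bar> < real n" for i
            using component_le_norm_cart[of x i] N \<open>n \<ge> N\<close> by linarith
          then show "indicator (B n) x *\<^sub>R w x = w x"
            by (auto simp: B mem_box_cart abs_less_iff indicator_def) (metis minus_less_iff)+
        qed
      qed
    qed (use w in \<open>auto simp: B indicator_def\<close>)
    then have "(LINT x|lborel. w x) = 0" using z
      by (simp add: B LIMSEQ_const_iff)
    moreover have iA: "integrable lborel (\<lambda>x. indicator A x *\<^sub>R w x)"
      by (rule integrable_mult_indicator[OF _ w]) (use compl in simp)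
    moreover have "set_lebesgue_integral lborel (UNIV - A) w = (LINT x|lborel. w x) - set_lebesgue_integral lborel A w"
      unfolding set_lebesgue_integral_def
      by (subst Bochner_Integration.integral_diff[OF w iA, symmetric])
        (auto intro!: Bochner_Integration.integral_cong simp: indicator_def)
    moreover have "UNIV - A \<in> sets borel" using compl by (intro borel_comp[unfolded Compl_eq_Diff_UNIV]) simp
    ultimately show ?case using compl by simp
  next
    case (union A)
    have "set_lebesgue_integral lborel (\<Union>i. A i) w = (\<Sum>i. set_lebesgue_integral lborel (A i) w)"
      by (rule lebesgue_integral_countable_add)
        (use union w in \<open>auto simp: disjoint_family_on_def set_integrable_def intro!: integrable_mult_indicator\<close>)
    then show ?case using union by auto
  qed
  then show "set_lebesgue_integral lborel A w = 0" by simp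
qed

lemma set_integrable_cbox: "locally_integrable w \<Longrightarrow> integrable lborel (\<lambda>x. indicator (cbox a b) x *\<^sub>R w x)"
  using compact_cbox unfolding locally_integrable_def set_integrable_def by blast

lemma locally_integrable_measurable [measurable_dest]:
  assumes "locally_integrable w" shows "w \<in> borel_measurable borel"
proof -
  have "(\<lambda>x. indicator (cbox (- (\<chi> i. real n)) (\<chi> i. real n)) x *\<^sub>R w x) \<in> borel_measurable borel" for n
    using set_integrable_cbox[OF assms, THEN borel_measurable_integrable] by simp
  then show ?thesis
  proof (rule borel_measurable_LIMSEQ_metric)
    fix x :: "'a point"
    obtain N where N: "norm x < real N" using reals_Archimedean2 by blast
    have "\<forall>\<^sub>F n in sequentially. indicator (cbox (- (\<chi> i. real n)) (\<chi> i. real n)) x *\<^sub>R w x = w x"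
    proof (rule eventually_sequentiallyI[of N])
      fix n assume "n \<ge> N"
      have "\<bar>x $ i\<bar> \<le> real n" for i
        using component_le_norm_cart[of x i] N \<open>n \<ge> N\<close> by linarith
      then show "indicator (cbox (- (\<chi> i. real n)) (\<chi> i. real n)) x *\<^sub>R w x = w x"
        by (auto simp: mem_box_cart abs_le_iff indicator_def) (metis minus_le_iff)+
    qed
    then show "(\<lambda>n. indicator (cbox (- (\<chi> i. real n)) (\<chi> i. real n)) x *\<^sub>R w x) \<longlonglongrightarrow> w x"
      by (rule tendsto_eventually)
  qed
qed

text \<open>Testing with \<open>box_bump\<close> and letting \<open>n\<close> tend to infinity gives
  vanishing integrals over all boxes; the bumps are supported in one compact box, on which
  \<open>w\<close> is integrable and serves as the dominating function.\<close>

lemma fundamental_lemma: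
  fixes w :: "('n::finite) wavefun"
  assumes w: "locally_integrable w"
    and z: "\<And>\<eta>. test_function \<eta> \<Longrightarrow> (LINT x|lborel. \<eta> x *\<^sub>R w x) = 0"
  shows "AE x in lborel. w x = 0"
proof -
  note [measurable] = locally_integrable_measurable[OF w]
  have box: "(LINT x|lborel. indicator (box a b) x *\<^sub>R w x) = 0" for a b
  proof -
    have "(\<lambda>n. LINT x|lborel. box_bump n a b x *\<^sub>R w x) \<longlonglongrightarrow> (LINT x|lborel. indicator (box a b) x *\<^sub>R w x)"
    proof (rule integral_dominated_convergence[where w="\<lambda>x. norm (indicator (cbox a b) x *\<^sub>R w x)"])
      show "(\<lambda>x. box_bump i a b x *\<^sub>R w x) \<in> borel_measurable lborel" for i
      proof -
        have "continuous_on UNIV (box_bump i a b)" using test_function_box_bump Ck.simps(1) test_function_def by blast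
        then have [measurable]: "box_bump i a b \<in> borel_measurable borel"
          by (rule borel_measurable_continuous_onI)
        show ?thesis by measurable
      qed
      show "AE x in lborel. (\<lambda>n. box_bump n a b x *\<^sub>R w x) \<longlonglongrightarrow> indicator (box a b) x *\<^sub>R w x"
        by (intro AE_I2 tendsto_scaleR box_bump_tendsto tendsto_const)
      show "AE x in lborel. norm (box_bump i a b x *\<^sub>R w x) \<le> norm (indicator (cbox a b) x *\<^sub>R w x)" for i
      proof (intro AE_I2)
        fix x show "norm (box_bump i a b x *\<^sub>R w x) \<le> norm (indicator (cbox a b) x *\<^sub>R w x)"
          using box_bump_bounds[of i a b x] box_bump_eq_0[of x a b i] box_subset_cbox[of a b]
          by (cases "x \<in> box a b") (auto simp: indicator_def intro!: mult_left_le_one_le)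
      qed
    qed (use integrable_norm[OF set_integrable_cbox[OF w, of a b]] in auto)
    then show ?thesis using z[OF test_function_box_bump] by (simp add: LIMSEQ_const_iff)
  qed
  \<comment> \<open>Globally \<open>w\<close> need not be integrable, so the box criterion is
    applied to its truncations. They keep vanishing box integrals because the intersection of two
    boxes is a box.\<close>
  define B :: "nat \<Rightarrow> 'n point set" where "B n = box (- (\<chi> i. real n)) (\<chi> i. real n)" for n
  have "AE x in lborel. indicator (B n) x *\<^sub>R w x = 0" for n
  proof (rule AE_zero_if_box_integrals_zero)
    show "integrable lborel (\<lambda>x. indicator (B n) x *\<^sub>R w x)"
      by (rule Bochner_Integration.integrable_bound[OF set_integrable_cbox[OF w, of "- (\<chi> i. real n)" "\<chi> i. real n"]])
        (auto simp: B_def indicator_def dest: box_subset_cbox[THEN subsetD])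
    show "(LINT x|lborel. indicator (box a b) x *\<^sub>R indicator (B n) x *\<^sub>R w x) = 0" for a b
    proof -
      obtain c d where "box a b \<inter> B n = box c d" unfolding B_def box_Int_box by blast
      then have "(\<lambda>x. indicator (box a b) x *\<^sub>R indicator (B n) x *\<^sub>R w x) = (\<lambda>x. indicator (box c d) x *\<^sub>R w x)"
        by (auto simp: indicator_def fun_eq_iff)
      then show ?thesis using box by metis
    qed
  qed
  then have "AE x in lborel. \<forall>n. indicator (B n) x *\<^sub>R w x = 0" unfolding AE_all_countable by blast
  then show ?thesis
  proof eventually_elim
    case (elim x)
    obtain N where N: "norm x < real N" using reals_Archimedean2 by blast
    have "\<bar>x $ i\<bar> < real N" for i
      using component_le_norm_cart[of x i] N by linarith
    then have "x \<in> B N" by (auto simp: B_def mem_box_cart abs_less_iff) (metis minus_less_iff)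
    then show ?case using elim[rule_format, of N] by simp
  qed
qed

section \<open>Closure properties of test functions\<close>

lemma test_functionD:
  assumes "test_function \<eta>"
  shows test_function_Ck: "Ck k \<eta>"
    and test_function_continuous: "continuous_on UNIV \<eta>"
    and test_function_bounded: "bounded {x. \<eta> x \<noteq> 0}"
    and test_function_differentiable: "\<eta> differentiable (at x)"
  using assms Ck.simps(1)[of \<eta>] Ck.simps(2)[of 0 \<eta>] compact_closure
  unfolding test_function_def by blast+

lemma test_function_measurable [measurable_dest]: "test_function \<eta> \<Longrightarrow> \<eta> \<in> borel_measurable borel"
  by (rule borel_measurable_continuous_onI[OF test_function_continuous])

lemma test_function_partial:
  assumes "test_function \<eta>" shows "test_function (partial_deriv i \<eta>)"
proof -
  have "Ck k (partial_deriv i \<eta>)" for k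
    using test_function_Ck[OF assms, of "Suc k"] by simp
  moreover have "{x. partial_deriv i \<eta> x \<noteq> 0} \<subseteq> closure {x. \<eta> x \<noteq> 0}"
  proof (rule subsetI, rule ccontr)
    fix x assume x: "x \<in> {x. partial_deriv i \<eta> x \<noteq> 0}" "x \<notin> closure {x. \<eta> x \<noteq> 0}"
    have "eventually (\<lambda>y. y \<in> - closure {x. \<eta> x \<noteq> 0}) (nhds x)"
      using x by (intro eventually_nhds_in_open) auto
    then have "eventually (\<lambda>y. \<eta> y = 0) (nhds x)"
      by eventually_elim (use closure_subset in force)
    then have "(\<eta> has_derivative (\<lambda>_. 0)) (at x)"
      by (subst has_derivative_transform_eventually[of "\<lambda>_. 0" _ x UNIV \<eta>])
        (auto simp: eventually_nhds_conv_at elim: eventually_mono)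
    then show False using partial_deriv_eq x by fastforce
  qed
  then have "bounded {x. partial_deriv i \<eta> x \<noteq> 0}"
    using bounded_subset bounded_closure[OF test_function_bounded[OF assms]] by blast
  ultimately show ?thesis by (simp add: test_function_def)
qed

lemma test_function_translate:
  assumes "test_function \<eta>" shows "test_function (\<lambda>x. \<eta> (x + a))"
proof -
  have "{x. \<eta> (x + a) \<noteq> 0} = (\<lambda>x. - a + x) ` {x. \<eta> x \<noteq> 0}"
    by (auto simp: image_iff) (metis add.commute add_diff_cancel_right' uminus_add_conv_diff)
  then show ?thesis
    using assms bounded_translation[OF test_function_bounded[OF assms], of "- a"]
    by (auto simp: test_function_def Ck_translate)
qed

lemma test_function_mult:
  assumes "test_function \<eta>" "\<And>k. Ck k m" shows "test_function (\<lambda>x. m x * \<eta> x)"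
proof -
  have "bounded {x. m x * \<eta> x \<noteq> 0}"
    by (rule bounded_subset[OF test_function_bounded[OF assms(1)]]) auto
  then show ?thesis using assms by (auto simp: test_function_def intro: Ck_mult)
qed

lemma partial_deriv_mult:
  assumes "f differentiable (at x)" "g differentiable (at x)"
  shows "partial_deriv i (\<lambda>x. f x * g x) x = f x * partial_deriv i g x + partial_deriv i f x * g x"
  using partial_deriv_eq[OF has_derivative_mult[OF assms[unfolded frechet_derivative_works]]]
  by (simp add: partial_deriv_def)

lemma bounded_test_function:
  assumes "test_function \<eta>" obtains M where "M > 0" "\<And>x. \<bar>\<eta> x\<bar> \<le> M"
proof -
  have "compact (closure {x. \<eta> x \<noteq> 0})" using assms by (simp add: test_function_def)
  moreover have "continuous_on (closure {x. \<eta> x \<noteq> 0}) \<eta>"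
    using test_function_continuous[OF assms] continuous_on_subset by blast
  ultimately have "bounded (\<eta> ` closure {x. \<eta> x \<noteq> 0})"
    using compact_continuous_image compact_imp_bounded by blast
  then obtain M where "M > 0" "\<And>x. x \<in> closure {x. \<eta> x \<noteq> 0} \<Longrightarrow> \<bar>\<eta> x\<bar> \<le> M"
    unfolding bounded_pos by auto
  then have "\<bar>\<eta> x\<bar> \<le> M" for x
    using closure_subset[of "{x. \<eta> x \<noteq> 0}"] by (cases "\<eta> x = 0") auto
  with \<open>M > 0\<close> show ?thesis using that by blast
qed

lemma DERIV_along_axis:
  assumes "f differentiable (at (x + t *\<^sub>R axis i 1))"
  shows "((\<lambda>s. f (x + s *\<^sub>R axis i 1)) has_real_derivative partial_deriv i f (x + t *\<^sub>R axis i 1)) (at t)"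
proof -
  have l: "((\<lambda>s. x + s *\<^sub>R axis i 1) has_derivative (\<lambda>h. h *\<^sub>R axis i 1)) (at t)"
    by (auto intro!: derivative_eq_intros)
  have f: "(f has_derivative frechet_derivative f (at (x + t *\<^sub>R axis i 1))) (at (x + t *\<^sub>R axis i 1))"
    using assms by (simp add: frechet_derivative_works)
  have "((\<lambda>s. f (x + s *\<^sub>R axis i 1)) has_derivative
      (\<lambda>h. frechet_derivative f (at (x + t *\<^sub>R axis i 1)) (h *\<^sub>R axis i 1))) (at t)"
    using has_derivative_compose[OF l f] by simp
  moreover have "frechet_derivative f (at (x + t *\<^sub>R axis i 1)) (h *\<^sub>R axis i 1)
      = partial_deriv i f (x + t *\<^sub>R axis i 1) * h" for h
    using linear_scale[OF linear_frechet_derivative[OF assms]] by (simp add: partial_deriv_def)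
  ultimately show ?thesis by (simp add: has_field_derivative_def)
qed

subsection \<open>Square integrable functions\<close>

text \<open>Fatou's lemma for Bochner integrals. Integrability of the limit is part of the
  conclusion, and a convergent sequence of upper bounds \<open>B\<close> stands in for the lower
  limit of the integrals.\<close>

lemma Fatou_bound:
  fixes u :: "nat \<Rightarrow> 'a \<Rightarrow> real"
  assumes u: "\<And>k. integrable M (u k)" and nn: "\<And>k. AE x in M. 0 \<le> u k x"
    and lim: "AE x in M. (\<lambda>k. u k x) \<longlonglongrightarrow> v x" and v [measurable]: "v \<in> borel_measurable M"
    and B: "\<And>k. (LINT x|M. u k x) \<le> B k" "B \<longlonglongrightarrow> L"
  shows "integrable M v" "(LINT x|M. v x) \<le> L"
proof -
  note [measurable] = borel_measurable_integrable[OF u]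
  have nnv: "AE x in M. 0 \<le> v x"
  proof -
    have "AE x in M. \<forall>k. 0 \<le> u k x" unfolding AE_all_countable using nn by blast
    with lim show ?thesis by eventually_elim (rule LIMSEQ_le_const, auto)
  qed
  have nnB: "0 \<le> B k" for k using B(1)[of k] integral_nonneg_AE[OF nn[of k]] by linarith
  have nnL: "0 \<le> L" using LIMSEQ_le_const[OF B(2)] nnB by blast
  have "(\<integral>\<^sup>+x. ennreal (v x) \<partial>M) = (\<integral>\<^sup>+x. liminf (\<lambda>k. ennreal (u k x)) \<partial>M)"
  proof (rule nn_integral_cong_AE)
    show "AE x in M. ennreal (v x) = liminf (\<lambda>k. ennreal (u k x))"
      using lim by eventually_elim (metis lim_imp_Liminf sequentially_bot tendsto_ennrealI)
  qed
  also have "\<dots> \<le> liminf (\<lambda>k. \<integral>\<^sup>+x. ennreal (u k x) \<partial>M)"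
    by (rule nn_integral_liminf) measurable
  also have "\<dots> \<le> liminf (\<lambda>k. ennreal (B k))"
    by (intro Liminf_mono always_eventually allI)
      (subst nn_integral_eq_integral[OF u nn], simp add: B ennreal_leI)
  also have "\<dots> = ennreal L"
    using lim_imp_Liminf[OF sequentially_bot tendsto_ennrealI[OF B(2)]] .
  finally have le: "(\<integral>\<^sup>+x. ennreal (v x) \<partial>M) \<le> ennreal L" .
  then show int: "integrable M v"
    by (intro integrableI_nonneg nnv) (auto simp: top.not_eq_extremum[symmetric] top_unique)
  show "(LINT x|M. v x) \<le> L"
    using le nnL by (subst (asm) nn_integral_eq_integral[OF int nnv]) (simp add: ennreal_le_iff)
qed

lemma Cauchy_Schwarz_integral:
  fixes f g :: "'a \<Rightarrow> real"
  assumes [measurable]: "f \<in> borel_measurable M" "g \<in> borel_measurable M"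
    and f: "integrable M (\<lambda>x. (f x)\<^sup>2)" and g: "integrable M (\<lambda>x. (g x)\<^sup>2)"
  shows "integrable M (\<lambda>x. f x * g x)"
    and "(LINT x|M. \<bar>f x * g x\<bar>)\<^sup>2 \<le> (LINT x|M. (f x)\<^sup>2) * (LINT x|M. (g x)\<^sup>2)"
    and "(LINT x|M. f x * g x)\<^sup>2 \<le> (LINT x|M. (f x)\<^sup>2) * (LINT x|M. (g x)\<^sup>2)"
proof -
  show int: "integrable M (\<lambda>x. f x * g x)"
  proof (rule Bochner_Integration.integrable_bound[OF Bochner_Integration.integrable_add[OF f g]])
    have "\<bar>a * b\<bar> \<le> a\<^sup>2 + b\<^sup>2" for a b :: real
      using sum_squares_bound[of "\<bar>a\<bar>" "\<bar>b\<bar>"] zero_le_power2[of a] zero_le_power2[of b]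
      unfolding abs_mult power2_abs by linarith
    then show "AE x in M. norm (f x * g x) \<le> norm ((f x)\<^sup>2 + (g x)\<^sup>2)" by simp
  qed simp
  have "(\<integral>\<^sup>+x. ennreal \<bar>f x * g x\<bar> \<partial>M)\<^sup>2 \<le> (\<integral>\<^sup>+x. ennreal ((f x)\<^sup>2) \<partial>M) * (\<integral>\<^sup>+x. ennreal ((g x)\<^sup>2) \<partial>M)"
    using Cauchy_Schwarz_nn_integral[of "\<lambda>x. ennreal \<bar>f x\<bar>" M "\<lambda>x. ennreal \<bar>g x\<bar>"]
    by (simp add: ennreal_mult'[symmetric] abs_mult ennreal_power)
  then show *: "(LINT x|M. \<bar>f x * g x\<bar>)\<^sup>2 \<le> (LINT x|M. (f x)\<^sup>2) * (LINT x|M. (g x)\<^sup>2)"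
    by (subst (asm) (1 2 3) nn_integral_eq_integral)
      (use int f g in \<open>auto simp: ennreal_mult'[symmetric] ennreal_power\<close>)
  have "\<bar>LINT x|M. f x * g x\<bar> \<le> (LINT x|M. \<bar>f x * g x\<bar>)" by (rule integral_abs_bound)
  then have "(LINT x|M. f x * g x)\<^sup>2 \<le> (LINT x|M. \<bar>f x * g x\<bar>)\<^sup>2"
    by (metis abs_ge_zero power2_abs power_mono)
  with * show "(LINT x|M. f x * g x)\<^sup>2 \<le> (LINT x|M. (f x)\<^sup>2) * (LINT x|M. (g x)\<^sup>2)" by linarith
qed

section \<open>The squared L2 norm, Cauchy-Schwarz and completeness\<close>

definition L2_sq :: "('n::finite) wavefun \<Rightarrow> real" where
  "L2_sq f = (LINT x|lborel. (cmod (f x))\<^sup>2)"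

lemma L2_sq_nonneg [simp]: "0 \<le> L2_sq f" by (simp add: L2_sq_def)

lemma L2_measurable [measurable_dest]: "f \<in> L2 \<Longrightarrow> f \<in> borel_measurable borel"
  by (simp add: L2_def)

lemma L2_integrable: "f \<in> L2 \<Longrightarrow> integrable lborel (\<lambda>x. (cmod (f x))\<^sup>2)"
  by (simp add: L2_def)

lemma L2_bound_AE:
  assumes "f \<in> borel_measurable borel" "integrable lborel G" "AE x in lborel. (cmod (f x))\<^sup>2 \<le> G x"
  shows "f \<in> L2" "L2_sq f \<le> (LINT x|lborel. G x)"
proof -
  note [measurable] = assms(1)
  have int: "integrable lborel (\<lambda>x. (cmod (f x))\<^sup>2)"
    by (rule Bochner_Integration.integrable_bound[OF assms(2)]) (use assms(3) in \<open>auto intro: order_trans[OF _ abs_ge_self]\<close>)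
  with assms(1) show "f \<in> L2" by (simp add: L2_def)
  show "L2_sq f \<le> (LINT x|lborel. G x)"
    unfolding L2_sq_def using int assms by (intro integral_mono_AE) auto
qed

lemma L2_bound:
  assumes "f \<in> borel_measurable borel" "integrable lborel G" "\<And>x. (cmod (f x))\<^sup>2 \<le> G x"
  shows "f \<in> L2" "L2_sq f \<le> (LINT x|lborel. G x)"
  using L2_bound_AE[OF assms(1,2)] assms(3) by auto

lemma cmod_add_sq_le: "(cmod (a + b))\<^sup>2 \<le> 2 * (cmod a)\<^sup>2 + 2 * (cmod b)\<^sup>2"
proof -
  have "(cmod (a + b))\<^sup>2 \<le> (cmod a + cmod b)\<^sup>2" by (intro power_mono norm_triangle_ineq) simp
  also have "\<dots> \<le> 2 * (cmod a)\<^sup>2 + 2 * (cmod b)\<^sup>2"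
    using sum_squares_bound[of "cmod a" "cmod b"] by (simp add: power2_eq_square algebra_simps)
  finally show ?thesis .
qed

lemma L2_add:
  assumes "f \<in> L2" "g \<in> L2"
  shows "(\<lambda>x. f x + g x) \<in> L2" "L2_sq (\<lambda>x. f x + g x) \<le> 2 * L2_sq f + 2 * L2_sq g"
proof -
  note [measurable] = assms[THEN L2_measurable]
  have "integrable lborel (\<lambda>x. 2 * (cmod (f x))\<^sup>2 + 2 * (cmod (g x))\<^sup>2)"
    using assms[THEN L2_integrable] by simp
  from L2_bound[OF _ this, of "\<lambda>x. f x + g x"] cmod_add_sq_le
  show "(\<lambda>x. f x + g x) \<in> L2" "L2_sq (\<lambda>x. f x + g x) \<le> 2 * L2_sq f + 2 * L2_sq g"
    using assms[THEN L2_integrable] by (auto simp: L2_sq_def)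
qed

lemma L2_mult_bounded:
  assumes "f \<in> L2" "m \<in> borel_measurable borel" "\<And>x. cmod (m x) \<le> B"
  shows "(\<lambda>x. m x * f x) \<in> L2" "L2_sq (\<lambda>x. m x * f x) \<le> B\<^sup>2 * L2_sq f"
proof -
  note [measurable] = assms(1)[THEN L2_measurable] assms(2)
  have "integrable lborel (\<lambda>x. B\<^sup>2 * (cmod (f x))\<^sup>2)"
    using assms(1)[THEN L2_integrable] by simp
  moreover have "(cmod (m x * f x))\<^sup>2 \<le> B\<^sup>2 * (cmod (f x))\<^sup>2" for x
    using assms(3)[of x] by (simp add: norm_mult power_mult_distrib power_mono mult_right_mono)
  ultimately show "(\<lambda>x. m x * f x) \<in> L2" "L2_sq (\<lambda>x. m x * f x) \<le> B\<^sup>2 * L2_sq f"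
    using L2_bound[of "\<lambda>x. m x * f x" "\<lambda>x. B\<^sup>2 * (cmod (f x))\<^sup>2"] by (auto simp: L2_sq_def)
qed

lemma L2_cmult: "f \<in> L2 \<Longrightarrow> (\<lambda>x. c * f x) \<in> L2"
  by (rule L2_mult_bounded(1)[of _ "\<lambda>_. c" "cmod c"]) auto

lemma L2_sq_cmult: "L2_sq (\<lambda>x. c * f x) = (cmod c)\<^sup>2 * L2_sq f"
  by (simp add: L2_sq_def norm_mult power_mult_distrib)

lemma L2_diff: assumes "f \<in> L2" "g \<in> L2"
  shows "(\<lambda>x. f x - g x) \<in> L2" "L2_sq (\<lambda>x. f x - g x) \<le> 2 * L2_sq f + 2 * L2_sq g"
  using L2_add[OF assms(1) L2_cmult[OF assms(2), of "-1"]] L2_sq_cmult[of "-1" g] by auto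

lemma L2_cmod: assumes "f \<in> L2"
  shows "(\<lambda>x. complex_of_real (cmod (f x))) \<in> L2"
proof -
  note [measurable] = assms[THEN L2_measurable]
  show ?thesis using assms by (simp add: L2_def)
qed

lemma L2_sq_eq_AE:
  assumes "AE x in lborel. f x = g x" "f \<in> borel_measurable borel" "g \<in> borel_measurable borel"
  shows "L2_sq f = L2_sq g"
  unfolding L2_sq_def using assms by (intro integral_cong_AE) auto

lemma L2_cong_AE:
  assumes "AE x in lborel. f x = g x" "f \<in> L2" "g \<in> borel_measurable borel"
  shows "g \<in> L2"
proof -
  note [measurable] = assms(2)[THEN L2_measurable] assms(3)
  have "integrable lborel (\<lambda>x. (cmod (g x))\<^sup>2) \<longleftrightarrow> integrable lborel (\<lambda>x. (cmod (f x))\<^sup>2)"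
    using assms(1) by (intro integrable_cong_AE) (measurable, auto)
  with assms show ?thesis by (simp add: L2_def)
qed

lemma L2_mult_integrable:
  assumes "f \<in> L2" "g \<in> L2"
  shows "integrable lborel (\<lambda>x. cmod (f x) * cmod (g x))" "integrable lborel (\<lambda>x. f x * g x)"
    and "(LINT x|lborel. cmod (f x) * cmod (g x))\<^sup>2 \<le> L2_sq f * L2_sq g"
    and "(cmod (LINT x|lborel. f x * g x))\<^sup>2 \<le> L2_sq f * L2_sq g"
proof -
  note [measurable] = assms[THEN L2_measurable]
  show a: "integrable lborel (\<lambda>x. cmod (f x) * cmod (g x))"
    using assms[THEN L2_integrable] by (intro Cauchy_Schwarz_integral) auto
  then show "integrable lborel (\<lambda>x. f x * g x)"
    by (rule Bochner_Integration.integrable_bound) (auto simp: norm_mult)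
  show b: "(LINT x|lborel. cmod (f x) * cmod (g x))\<^sup>2 \<le> L2_sq f * L2_sq g"
    unfolding L2_sq_def using assms[THEN L2_integrable]
    by (intro Cauchy_Schwarz_integral) auto
  have "cmod (LINT x|lborel. f x * g x) \<le> (LINT x|lborel. cmod (f x) * cmod (g x))"
    using integral_norm_bound[of lborel "\<lambda>x. f x * g x"] by (simp add: norm_mult)
  from power_mono[OF this, of 2] b show "(cmod (LINT x|lborel. f x * g x))\<^sup>2 \<le> L2_sq f * L2_sq g"
    by (meson norm_ge_zero order_trans)
qed

lemma L2_norm_triangle:
  assumes "f \<in> L2" "g \<in> L2"
  shows "sqrt (L2_sq (\<lambda>x. f x + g x)) \<le> sqrt (L2_sq f) + sqrt (L2_sq g)"
proof (rule real_le_lsqrt)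
  note i = assms[THEN L2_integrable] L2_mult_integrable(1)[OF assms] L2_add(1)[OF assms, THEN L2_integrable]
  have "L2_sq (\<lambda>x. f x + g x) \<le> (LINT x|lborel. (cmod (f x))\<^sup>2 + 2 * (cmod (f x) * cmod (g x)) + (cmod (g x))\<^sup>2)"
    unfolding L2_sq_def
  proof (rule integral_mono)
    fix x
    have "(cmod (f x + g x))\<^sup>2 \<le> (cmod (f x) + cmod (g x))\<^sup>2" by (intro power_mono norm_triangle_ineq) simp
    then show "(cmod (f x + g x))\<^sup>2 \<le> (cmod (f x))\<^sup>2 + 2 * (cmod (f x) * cmod (g x)) + (cmod (g x))\<^sup>2"
      by (simp add: power2_eq_square algebra_simps)
  qed (use i in auto)
  also have "\<dots> = L2_sq f + 2 * (LINT x|lborel. cmod (f x) * cmod (g x)) + L2_sq g"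
    using i by (simp add: L2_sq_def)
  also have "(LINT x|lborel. cmod (f x) * cmod (g x)) \<le> sqrt (L2_sq f * L2_sq g)"
    by (rule real_le_rsqrt) (rule L2_mult_integrable(3)[OF assms])
  finally show "L2_sq (\<lambda>x. f x + g x) \<le> (sqrt (L2_sq f) + sqrt (L2_sq g))\<^sup>2"
    by (simp add: power2_sum real_sqrt_mult)
qed auto

lemma L2_locally_integrable:
  assumes "f \<in> L2" shows "locally_integrable f"
  unfolding locally_integrable_def set_integrable_def
proof (intro allI impI)
  fix K :: "'a point set" assume "compact K"
  then have K: "integrable lborel (indicator K :: _ \<Rightarrow> real)"
    using borel_compact emeasure_compact_finite by (intro integrable_real_indicator) (auto simp: less_top)
  note [measurable] = L2_measurable[OF assms] borel_compact[OF \<open>compact K\<close>]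
  show "integrable lborel (\<lambda>x. indicator K x *\<^sub>R f x)"
  proof (rule Bochner_Integration.integrable_bound[OF Bochner_Integration.integrable_add[OF K L2_integrable[OF assms]]])
    have "a \<le> 1 + a\<^sup>2" for a :: real using sum_squares_bound[of 1 a] zero_le_power2[of a] by (simp only: mult_1_right power_one)
    then show "AE x in lborel. norm (indicator K x *\<^sub>R f x) \<le> norm (indicator K x + (cmod (f x))\<^sup>2)"
      by (auto simp: indicator_def)
  qed measurable
qed

lemma L2_translate:
  fixes f :: "('n::finite) wavefun"
  assumes "f \<in> L2"
  shows "(\<lambda>x. f (x + a)) \<in> L2" "L2_sq (\<lambda>x. f (x + a)) = L2_sq f"
proof -
  note [measurable] = L2_measurable[OF assms]
  have d: "distr lborel borel (\<lambda>x. x + a) = lborel"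
  proof -
    have "(\<lambda>x. x + a) = (+) a" by (auto simp: add.commute)
    then show ?thesis using lborel_distr_plus[of a] by simp
  qed
  have "integrable lborel (\<lambda>x. (cmod (f (x + a)))\<^sup>2) \<longleftrightarrow> integrable lborel (\<lambda>x. (cmod (f x))\<^sup>2)"
    by (subst (2) d[symmetric], subst integrable_distr_eq) auto
  then show "(\<lambda>x. f (x + a)) \<in> L2" using assms by (simp add: L2_def)
  show "L2_sq (\<lambda>x. f (x + a)) = L2_sq f"
    unfolding L2_sq_def by (subst (2) d[symmetric], subst integral_distr) auto
qed

lemma lborel_translate:
  fixes f :: "'a::euclidean_space \<Rightarrow> 'b::{banach, second_countable_topology}"
  assumes [measurable]: "f \<in> borel_measurable borel"
  shows "(LINT x|lborel. f (x + a)) = (LINT x|lborel. f x)"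
proof -
  have d: "distr lborel borel (\<lambda>x. x + a) = lborel"
  proof -
    have "(\<lambda>x. x + a) = (+) a" by (auto simp: add.commute)
    then show ?thesis using lborel_distr_plus[of a] by simp
  qed
  show ?thesis by (subst (2) d[symmetric], subst integral_distr) auto
qed

lemma L2_subseq_AE:
  assumes "\<And>n. h n \<in> L2" "f \<in> L2" "(\<lambda>n. L2_sq (\<lambda>x. h n x - f x)) \<longlonglongrightarrow> 0"
  obtains r where "strict_mono r" "AE x in lborel. (\<lambda>k. h (r k) x) \<longlonglongrightarrow> f x"
proof -
  have "\<exists>r::nat\<Rightarrow>nat. strict_mono r \<and> (AE x in lborel. (\<lambda>n. (cmod (h (r n) x - f x))\<^sup>2) \<longlonglongrightarrow> 0)"
    by (rule tendsto_L1_AE_subseq)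
      (use assms L2_diff(1)[THEN L2_integrable] in \<open>auto simp: L2_sq_def\<close>)
  then obtain r :: "nat \<Rightarrow> nat" where r: "strict_mono r" "AE x in lborel. (\<lambda>n. (cmod (h (r n) x - f x))\<^sup>2) \<longlonglongrightarrow> 0"
    by blast
  from r(2) have "AE x in lborel. (\<lambda>k. h (r k) x) \<longlonglongrightarrow> f x"
  proof eventually_elim
    case (elim x)
    then have "(\<lambda>n. cmod (h (r n) x - f x)) \<longlonglongrightarrow> 0"
      using tendsto_real_sqrt[OF elim] by simp
    then show ?case by (rule LIM_zero_cancel[OF tendsto_norm_zero_cancel])
  qed
  with r(1) that show ?thesis by blast
qed

text \<open>Riesz-Fischer. Along a subsequence the increments have squared norm at most 8^-k;
  weighting them by 2^k leaves the summable 4^-k, so the weighted squares are summable at almost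
  every point. Then |D| <= 2^-k + 2^k |D|^2 makes the increments themselves absolutely summable
  there.\<close>

theorem L2_complete:
  fixes h :: "nat \<Rightarrow> ('n::finite) wavefun"
  assumes h: "\<And>n. h n \<in> L2"
    and C: "\<And>e. e > 0 \<Longrightarrow> \<exists>N. \<forall>m\<ge>N. \<forall>n\<ge>N. L2_sq (\<lambda>x. h m x - h n x) \<le> e"
  obtains f where "f \<in> L2" "(\<lambda>n. L2_sq (\<lambda>x. h n x - f x)) \<longlonglongrightarrow> 0"
proof -
  note [measurable] = h[THEN L2_measurable]
  obtain N where N: "\<And>k m n. m \<ge> N k \<Longrightarrow> n \<ge> N k \<Longrightarrow> L2_sq (\<lambda>x. h m x - h n x) \<le> (1/8) ^ k"
  proof -
    have "\<forall>k. \<exists>N. \<forall>m\<ge>N. \<forall>n\<ge>N. L2_sq (\<lambda>x. h m x - h n x) \<le> (1/8) ^ k"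
      using C by simp
    with that show ?thesis unfolding choice_iff by blast
  qed
  \<comment> \<open>The partial sum dominates every \<open>N j\<close> with j <= k, so
    \<open>r k\<close> and \<open>r (Suc k)\<close> both lie beyond the threshold
    \<open>N k\<close>.\<close>
  define r where "r k = k + (\<Sum>j\<le>k. N j)" for k
  have rN: "r k \<ge> N k" "r (Suc k) \<ge> N k" for k
    using member_le_sum[of k "{..k}" N] by (auto simp: r_def)
  define D where "D k x = h (r (Suc k)) x - h (r k) x" for k x
  have [measurable]: "D k \<in> borel_measurable borel" for k unfolding D_def[abs_def] by measurable
  have D: "D k \<in> L2" "L2_sq (D k) \<le> (1/8) ^ k" for k
    unfolding D_def[abs_def] using L2_diff(1)[OF h h] N rN by auto
  have "(\<integral>\<^sup>+x. (\<Sum>k. ennreal (2 ^ k * (cmod (D k x))\<^sup>2)) \<partial>lborel)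
      = (\<Sum>k. \<integral>\<^sup>+x. ennreal (2 ^ k * (cmod (D k x))\<^sup>2) \<partial>lborel)"
    by (rule nn_integral_suminf) measurable
  also have "\<dots> \<le> (\<Sum>k. ennreal ((1/4) ^ k))"
  proof (intro suminf_le allI)
    fix k
    have "(\<integral>\<^sup>+x. ennreal (2 ^ k * (cmod (D k x))\<^sup>2) \<partial>lborel) = ennreal (2 ^ k * L2_sq (D k))"
      unfolding L2_sq_def using D(1)[of k, THEN L2_integrable]
      by (subst nn_integral_eq_integral) auto
    also have "2 ^ k * L2_sq (D k) \<le> 2 ^ k * (1/8) ^ k" using D(2) by (intro mult_left_mono) auto
    also have "(2::real) ^ k * (1/8) ^ k = (1/4) ^ k" by (simp flip: power_mult_distrib)
    finally show "(\<integral>\<^sup>+x. ennreal (2 ^ k * (cmod (D k x))\<^sup>2) \<partial>lborel) \<le> ennreal ((1/4) ^ k)"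
      by (simp add: ennreal_leI)
  qed auto
  also have "\<dots> < \<infinity>"
    by (subst suminf_ennreal_eq[OF _ summable_sums]) (auto intro: summable_geometric)
  finally have "AE x in lborel. (\<Sum>k. ennreal (2 ^ k * (cmod (D k x))\<^sup>2)) \<noteq> \<infinity>"
    by (intro nn_integral_PInf_AE) auto
  then have conv: "AE x in lborel. convergent (\<lambda>k. h (r k) x)"
  proof eventually_elim
    case (elim x)
    have "summable (\<lambda>k. 2 ^ k * (cmod (D k x))\<^sup>2)"
      using elim by (intro summable_suminf_not_top) auto
    moreover have "summable (\<lambda>k. (1/2) ^ k :: real)" by (intro summable_geometric) auto
    ultimately have "summable (\<lambda>k. (1/2) ^ k + 2 ^ k * (cmod (D k x))\<^sup>2)" by (intro summable_add)
    then have "summable (\<lambda>k. D k x)"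
    proof (rule summable_norm_cancel[OF summable_comparison_test'[where N=0]])
      fix k
      have *: "a \<le> b + a\<^sup>2 / b" if "b > 0" for a b :: real
      proof -
        have "a * b \<le> b * b + a * a"
          using sum_squares_bound[of a b] zero_le_power2[of a] zero_le_power2[of b]
          unfolding power2_eq_square by linarith
        then show ?thesis using that by (simp add: field_simps power2_eq_square)
      qed
      have "(1/2) ^ k + (cmod (D k x))\<^sup>2 / (1/2) ^ k = (1/2) ^ k + 2 ^ k * (cmod (D k x))\<^sup>2"
        by (simp add: power_divide)
      with *[of "(1/2) ^ k" "cmod (D k x)"]
      show "norm (norm (D k x)) \<le> (1/2) ^ k + 2 ^ k * (cmod (D k x))\<^sup>2" by simp
    qed
    then have "convergent (\<lambda>n. \<Sum>k<n. D k x)" by (simp add: summable_iff_convergent)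
    then have "convergent (\<lambda>n. h (r n) x - h (r 0) x)"
      unfolding D_def by (simp only: sum_lessThan_telescope[of "\<lambda>k. h (r k) x"])
    then have "convergent (\<lambda>n. (h (r n) x - h (r 0) x) + h (r 0) x)"
      by (intro convergent_add convergent_const)
    then show ?case by simp
  qed
  define f where "f x = lim (\<lambda>k. h (r k) x)" for x
  have [measurable]: "f \<in> borel_measurable borel"
    unfolding f_def[abs_def] by (rule borel_measurable_lim_metric) measurable
  have lim: "AE x in lborel. (\<lambda>k. h (r k) x) \<longlonglongrightarrow> f x"
    using conv by eventually_elim (simp add: f_def convergent_LIMSEQ_iff)
  \<comment> \<open>Fatou's lemma is applied in the second index only, with \<open>n\<close> fixed.
    This gives convergence of the full sequence, not just of the subsequence.\<close>
  have F: "integrable lborel (\<lambda>x. (cmod (h n x - f x))\<^sup>2) \<and> L2_sq (\<lambda>x. h n x - f x) \<le> (1/8) ^ k" if "n \<ge> N k" for n k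
  proof -
    have a: "integrable lborel (\<lambda>x. (cmod (h n x - h (r (j + k)) x))\<^sup>2)" for j
      using L2_diff(1)[OF h h] by (rule L2_integrable)
    have b: "AE x in lborel. (\<lambda>j. (cmod (h n x - h (r (j + k)) x))\<^sup>2) \<longlonglongrightarrow> (cmod (h n x - f x))\<^sup>2"
      using lim by eventually_elim (intro tendsto_intros LIMSEQ_ignore_initial_segment)
    have "r (j + k) \<ge> N k" for j
      using member_le_sum[of k "{..j + k}" N] by (auto simp: r_def)
    then have c: "(LINT x|lborel. (cmod (h n x - h (r (j + k)) x))\<^sup>2) \<le> (1/8) ^ k" for j
      using N[OF that] by (simp add: L2_sq_def)
    show ?thesis unfolding L2_sq_def
      using Fatou_bound[OF a _ b _ c, of "(1/8)^k"] by auto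
  qed
  have "(\<lambda>x. h (N 0) x - f x) \<in> L2" using F[of 0 "N 0"] by (auto simp: L2_def)
  from L2_diff(1)[OF h[of "N 0"] this] have f: "f \<in> L2" by simp
  have "(\<lambda>n. L2_sq (\<lambda>x. h n x - f x)) \<longlonglongrightarrow> 0"
  proof (rule LIMSEQ_I)
    fix e :: real assume "e > 0"
    then obtain k where "(1/8) ^ k < e" using real_arch_pow_inv[of e "1/8"] by auto
    then show "\<exists>no. \<forall>n\<ge>no. norm (L2_sq (\<lambda>x. h n x - f x) - 0) < e"
      using F[of k] by (intro exI[of _ "N k"]) force
  qed
  with f that show ?thesis by blast
qed

subsection \<open>Weak derivatives and translates\<close>

lemma test_function_mult_integrable:
  fixes g :: "('n::finite) wavefun"
  assumes "test_function \<eta>" "locally_integrable g"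
  shows "integrable lborel (\<lambda>x. \<eta> x *\<^sub>R g x)"
proof -
  note [measurable] = test_function_measurable[OF assms(1)] locally_integrable_measurable[OF assms(2)]
  obtain M where M: "M > 0" "\<And>x. \<bar>\<eta> x\<bar> \<le> M" using bounded_test_function[OF assms(1)] by blast
  obtain a where a: "{x. \<eta> x \<noteq> 0} \<subseteq> cbox (-a) a"
    using bounded_subset_cbox_symmetric[OF test_function_bounded[OF assms(1)]] by blast
  show ?thesis
  proof (rule Bochner_Integration.integrable_bound)
    show "integrable lborel (\<lambda>x. M *\<^sub>R (indicator (cbox (-a) a) x *\<^sub>R g x))"
      using set_integrable_cbox[OF assms(2), of "-a" a] by (intro integrable_scaleR_right)
    show "AE x in lborel. norm (\<eta> x *\<^sub>R g x) \<le> norm (M *\<^sub>R (indicator (cbox (-a) a) x *\<^sub>R g x))"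
    proof (intro AE_I2)
      fix x show "norm (\<eta> x *\<^sub>R g x) \<le> norm (M *\<^sub>R (indicator (cbox (-a) a) x *\<^sub>R g x))"
        using a M(1) M(2)[of x] by (cases "\<eta> x = 0") (auto simp: indicator_def intro!: mult_right_mono)
    qed
  qed measurable
qed

lemma test_function_L2:
  fixes \<eta> :: "('n::finite) point \<Rightarrow> real"
  assumes "test_function \<eta>" shows "(\<lambda>x. complex_of_real (\<eta> x)) \<in> L2"
proof -
  note [measurable] = test_function_measurable[OF assms]
  have m: "test_function (\<lambda>x. \<eta> x * \<eta> x)"
    using assms by (intro test_function_mult test_function_Ck)
  have "locally_integrable (\<lambda>x::'n point. 1::complex)"
    unfolding locally_integrable_def set_integrable_def
    using borel_compact emeasure_compact_finite
    by (intro allI impI integrable_scaleR_left integrable_real_indicator) (auto simp: less_top)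
  from test_function_mult_integrable[OF m this, THEN integrable_norm]
  have "integrable lborel (\<lambda>x. (cmod (complex_of_real (\<eta> x)))\<^sup>2)"
    by (simp add: power2_eq_square abs_mult)
  then show ?thesis by (simp add: L2_def)
qed

section \<open>Algebra, uniqueness and limits of weak derivatives\<close>

lemma locally_integrable_add:
  "locally_integrable f \<Longrightarrow> locally_integrable g \<Longrightarrow> locally_integrable (\<lambda>x. f x + g x)"
  by (simp add: locally_integrable_def set_integral_add)

lemma locally_integrable_mult:
  fixes f :: "('n::finite) wavefun"
  assumes f: "locally_integrable f" and m: "continuous_on UNIV m"
  shows "locally_integrable (\<lambda>x. complex_of_real (m x) * f x)"
  unfolding locally_integrable_def set_integrable_def
proof (intro allI impI)
  fix K :: "'n point set" assume K: "compact K"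
  note [measurable] = locally_integrable_measurable[OF f] borel_measurable_continuous_onI[OF m] borel_compact[OF K]
  have "bounded (m ` K)" by (rule compact_imp_bounded[OF compact_continuous_image[OF continuous_on_subset[OF m subset_UNIV] K]])
  then obtain M where M: "\<And>x. x \<in> K \<Longrightarrow> \<bar>m x\<bar> \<le> M" unfolding bounded_iff by auto
  have i: "integrable lborel (\<lambda>x. indicator K x *\<^sub>R f x)"
    using f K by (simp add: locally_integrable_def set_integrable_def)
  show "integrable lborel (\<lambda>x. indicator K x *\<^sub>R (complex_of_real (m x) * f x))"
  proof (rule Bochner_Integration.integrable_bound[OF integrable_scaleR_right[OF i, of M]])
    have "cmod (indicator K x *\<^sub>R (complex_of_real (m x) * f x)) \<le> cmod (M *\<^sub>R (indicator K x *\<^sub>R f x))" for x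
      using M[of x] by (auto simp: indicator_def norm_mult intro!: mult_right_mono order_trans[OF _ abs_ge_self])
    then show "AE x in lborel. cmod (indicator K x *\<^sub>R (complex_of_real (m x) * f x)) \<le> cmod (M *\<^sub>R (indicator K x *\<^sub>R f x))"
      by simp
  qed measurable
qed

lemma locally_integrable_cmult: "locally_integrable f \<Longrightarrow> locally_integrable (\<lambda>x. c * f x)"
  by (simp add: locally_integrable_def)

lemma has_weak_partial_locally_integrable:
  "has_weak_partial i f g \<Longrightarrow> locally_integrable f" "has_weak_partial i f g \<Longrightarrow> locally_integrable g"
  by (auto simp: has_weak_partial_def)

lemma has_weak_partialD:
  "has_weak_partial i f g \<Longrightarrow> test_function \<eta> \<Longrightarrow>
    (LINT x|lborel. partial_deriv i \<eta> x *\<^sub>R f x) = - (LINT x|lborel. \<eta> x *\<^sub>R g x)"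
  by (auto simp: has_weak_partial_def)

lemma has_weak_partial_unique:
  assumes "has_weak_partial i f g" "has_weak_partial i f h"
  shows "AE x in lborel. g x = h x"
proof -
  note l = has_weak_partial_locally_integrable(2)[OF assms(1)] has_weak_partial_locally_integrable(2)[OF assms(2)]
  have "AE x in lborel. g x + (-1) * h x = 0"
  proof (rule fundamental_lemma)
    show "locally_integrable (\<lambda>x. g x + (-1) * h x)"
      by (intro locally_integrable_add locally_integrable_cmult l)
    fix \<eta> :: "'a point \<Rightarrow> real" assume \<eta>: "test_function \<eta>"
    have "(LINT x|lborel. \<eta> x *\<^sub>R (g x + (-1) * h x)) = (LINT x|lborel. \<eta> x *\<^sub>R g x) - (LINT x|lborel. \<eta> x *\<^sub>R h x)"
      using l[THEN test_function_mult_integrable[OF \<eta>]] by (simp add: scaleR_diff_right)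
    then show "(LINT x|lborel. \<eta> x *\<^sub>R (g x + (-1) * h x)) = 0"
      using has_weak_partialD[OF assms(1) \<eta>] has_weak_partialD[OF assms(2) \<eta>] by simp
  qed
  then show ?thesis by simp
qed

lemma has_weak_partial_add:
  assumes "has_weak_partial i f g" "has_weak_partial i f' g'"
  shows "has_weak_partial i (\<lambda>x. f x + f' x) (\<lambda>x. g x + g' x)"
proof -
  note l = has_weak_partial_locally_integrable[OF assms(1)] has_weak_partial_locally_integrable[OF assms(2)]
  show ?thesis unfolding has_weak_partial_def
  proof (intro conjI allI impI locally_integrable_add l)
    fix \<eta> :: "'a point \<Rightarrow> real" assume \<eta>: "test_function \<eta>"
    show "(LINT x|lborel. partial_deriv i \<eta> x *\<^sub>R (f x + f' x)) = - (LINT x|lborel. \<eta> x *\<^sub>R (g x + g' x))"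
      using l[THEN test_function_mult_integrable[OF \<eta>]]
        l[THEN test_function_mult_integrable[OF test_function_partial[OF \<eta>, of i]]]
        has_weak_partialD[OF assms(1) \<eta>] has_weak_partialD[OF assms(2) \<eta>]
      by (simp add: scaleR_add_right)
  qed
qed

lemma has_weak_partial_cmult:
  assumes "has_weak_partial i f g"
  shows "has_weak_partial i (\<lambda>x. c * f x) (\<lambda>x. c * g x)"
proof -
  note l = has_weak_partial_locally_integrable[OF assms(1)]
  show ?thesis unfolding has_weak_partial_def
  proof (intro conjI allI impI locally_integrable_cmult l)
    fix \<eta> :: "'a point \<Rightarrow> real" assume \<eta>: "test_function \<eta>"
    have *: "(LINT x|lborel. r x *\<^sub>R (c * h x)) = c * (LINT x|lborel. r x *\<^sub>R h x)" for r :: "'a point \<Rightarrow> real" and h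
      by (simp flip: integral_mult_right_zero add: scaleR_conv_of_real mult_ac)
    show "(LINT x|lborel. partial_deriv i \<eta> x *\<^sub>R (c * f x)) = - (LINT x|lborel. \<eta> x *\<^sub>R (c * g x))"
      unfolding * using has_weak_partialD[OF assms(1) \<eta>] by simp
  qed
qed

lemma has_weak_partial_mult_smooth:
  fixes f :: "('n::finite) wavefun"
  assumes fg: "has_weak_partial i f g" and m: "\<And>k. Ck k m"
  shows "has_weak_partial i (\<lambda>x. of_real (m x) * f x) (\<lambda>x. of_real (m x) * g x + of_real (partial_deriv i m x) * f x)"
proof -
  note l = has_weak_partial_locally_integrable[OF assms(1)]
  have mc: "continuous_on UNIV m" "continuous_on UNIV (partial_deriv i m)"
    using m[of 0] m[of "Suc 0"] by auto
  have md: "m differentiable (at x)" for x using m[of "Suc 0"] by simp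
  note ll = locally_integrable_mult[OF l(1) mc(1)] locally_integrable_mult[OF l(2) mc(1)] locally_integrable_mult[OF l(1) mc(2)]
  show ?thesis unfolding has_weak_partial_def
  proof (intro conjI allI impI locally_integrable_add ll)
    fix \<eta> :: "'n point \<Rightarrow> real" assume \<eta>: "test_function \<eta>"
    have t: "test_function (\<lambda>x. m x * \<eta> x)" by (rule test_function_mult[OF \<eta> m])
    have p: "partial_deriv i (\<lambda>x. m x * \<eta> x) x = m x * partial_deriv i \<eta> x + partial_deriv i m x * \<eta> x" for x
      by (rule partial_deriv_mult[OF md test_function_differentiable[OF \<eta>]])
    note i1 = ll[THEN test_function_mult_integrable[OF \<eta>]]
    note i2 = ll[THEN test_function_mult_integrable[OF test_function_partial[OF \<eta>, of i]]]
    have "(LINT x|lborel. partial_deriv i \<eta> x *\<^sub>R (of_real (m x) * f x))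
        = (LINT x|lborel. partial_deriv i (\<lambda>x. m x * \<eta> x) x *\<^sub>R f x) - (LINT x|lborel. \<eta> x *\<^sub>R (of_real (partial_deriv i m x) * f x))"
      unfolding p by (subst Bochner_Integration.integral_diff[symmetric])
        (use i1 i2 test_function_mult_integrable[OF test_function_partial[OF t, of i] l(1), unfolded p]
         in \<open>auto simp: scaleR_conv_of_real algebra_simps\<close>)
    also have "\<dots> = - (LINT x|lborel. (m x * \<eta> x) *\<^sub>R g x) - (LINT x|lborel. \<eta> x *\<^sub>R (of_real (partial_deriv i m x) * f x))"
      using has_weak_partialD[OF fg t] by simp
    also have "\<dots> = - ((LINT x|lborel. \<eta> x *\<^sub>R (of_real (m x) * g x)) + (LINT x|lborel. \<eta> x *\<^sub>R (of_real (partial_deriv i m x) * f x)))"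
      by (simp add: scaleR_conv_of_real mult_ac)
    also have "\<dots> = - (LINT x|lborel. \<eta> x *\<^sub>R (of_real (m x) * g x + of_real (partial_deriv i m x) * f x))"
      using i1 by (simp add: scaleR_add_right)
    finally show "(LINT x|lborel. partial_deriv i \<eta> x *\<^sub>R (of_real (m x) * f x))
      = - (LINT x|lborel. \<eta> x *\<^sub>R (of_real (m x) * g x + of_real (partial_deriv i m x) * f x))" .
  qed
qed

lemma L2_tendsto_integral:
  fixes f :: "('n::finite) wavefun"
  assumes \<eta>: "test_function \<eta>" and h: "\<And>n. h n \<in> L2" "f \<in> L2" "(\<lambda>n. L2_sq (\<lambda>x. h n x - f x)) \<longlonglongrightarrow> 0"
  shows "(\<lambda>n. LINT x|lborel. \<eta> x *\<^sub>R h n x) \<longlonglongrightarrow> (LINT x|lborel. \<eta> x *\<^sub>R f x)"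
proof (rule LIM_zero_cancel, rule tendsto_norm_zero_cancel)
  let ?\<eta> = "\<lambda>x. complex_of_real (\<eta> x)"
  have eq: "(LINT x|lborel. \<eta> x *\<^sub>R h n x) - (LINT x|lborel. \<eta> x *\<^sub>R f x) = (LINT x|lborel. ?\<eta> x * (h n x - f x))" for n
  proof -
    have "?\<eta> x * (h n x - f x) = \<eta> x *\<^sub>R h n x - \<eta> x *\<^sub>R f x" for x
      by (simp add: scaleR_conv_of_real algebra_simps)
    then show ?thesis
      using h(1)[of n] h(2) by (simp add: test_function_mult_integrable \<eta> L2_locally_integrable)
  qed
  have "cmod (LINT x|lborel. ?\<eta> x * (h n x - f x)) \<le> sqrt (L2_sq ?\<eta> * L2_sq (\<lambda>x. h n x - f x))" for n
    by (intro real_le_rsqrt L2_mult_integrable(4) test_function_L2 \<eta> L2_diff h)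
  moreover have "(\<lambda>n. sqrt (L2_sq ?\<eta> * L2_sq (\<lambda>x. h n x - f x))) \<longlonglongrightarrow> 0"
    using tendsto_real_sqrt[OF tendsto_mult_right_zero[OF h(3), of "L2_sq ?\<eta>"]] by simp
  ultimately show "(\<lambda>n. cmod ((LINT x|lborel. \<eta> x *\<^sub>R h n x) - (LINT x|lborel. \<eta> x *\<^sub>R f x))) \<longlonglongrightarrow> 0"
    unfolding eq by (rule_tac Lim_null_comparison[OF always_eventually]) auto
qed

lemma has_weak_partial_limit:
  fixes f :: "('n::finite) wavefun"
  assumes p: "\<And>n. has_weak_partial i (h n) (g n)"
    and h: "\<And>n. h n \<in> L2" "f \<in> L2" "(\<lambda>n. L2_sq (\<lambda>x. h n x - f x)) \<longlonglongrightarrow> 0"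
    and g: "\<And>n. g n \<in> L2" "k \<in> L2" "(\<lambda>n. L2_sq (\<lambda>x. g n x - k x)) \<longlonglongrightarrow> 0"
  shows "has_weak_partial i f k"
  unfolding has_weak_partial_def
proof (intro conjI allI impI L2_locally_integrable h g)
  fix \<eta> :: "'n point \<Rightarrow> real" assume \<eta>: "test_function \<eta>"
  have "(\<lambda>n. LINT x|lborel. partial_deriv i \<eta> x *\<^sub>R h n x) \<longlonglongrightarrow> (LINT x|lborel. partial_deriv i \<eta> x *\<^sub>R f x)"
    by (rule L2_tendsto_integral[OF test_function_partial[OF \<eta>] h])
  moreover have "(\<lambda>n. LINT x|lborel. partial_deriv i \<eta> x *\<^sub>R h n x) \<longlonglongrightarrow> - (LINT x|lborel. \<eta> x *\<^sub>R k x)"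
    unfolding has_weak_partialD[OF p \<eta>] by (intro tendsto_minus L2_tendsto_integral[OF \<eta> g])
  ultimately show "(LINT x|lborel. partial_deriv i \<eta> x *\<^sub>R f x) = - (LINT x|lborel. \<eta> x *\<^sub>R k x)"
    by (rule LIMSEQ_unique)
qed

lemma H1_L2: "f \<in> H1 \<Longrightarrow> f \<in> L2" by (simp add: H1_def)

text \<open>\<open>weak_partial\<close> picks an arbitrary locally integrable weak derivative, so
  its square integrability has to be transferred from some derivative in L2 by uniqueness almost
  everywhere.\<close>

lemma H1_weak_partial:
  assumes "f \<in> H1"
  shows "has_weak_partial i f (weak_partial i f)" "weak_partial i f \<in> L2"
proof -
  obtain g where g: "g \<in> L2" "has_weak_partial i f g" using assms by (auto simp: H1_def)
  then show w: "has_weak_partial i f (weak_partial i f)"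
    unfolding weak_partial_def by (intro someI[of "has_weak_partial i f"])
  have "AE x in lborel. g x = weak_partial i f x" by (rule has_weak_partial_unique[OF g(2) w])
  then show "weak_partial i f \<in> L2"
    by (rule L2_cong_AE[OF _ g(1) locally_integrable_measurable[OF has_weak_partial_locally_integrable(2)[OF w]]])
qed

lemma H1I:
  assumes "f \<in> L2" "\<And>i. g i \<in> L2" "\<And>i. has_weak_partial i f (g i)"
  shows "f \<in> H1" "AE x in lborel. \<forall>i. weak_partial i f x = g i x"
proof -
  show f: "f \<in> H1" using assms by (auto simp: H1_def)
  have "AE x in lborel. weak_partial i f x = g i x" for i
    by (rule has_weak_partial_unique[OF H1_weak_partial(1)[OF f] assms(3)])
  then show "AE x in lborel. \<forall>i. weak_partial i f x = g i x"
    using AE_finite_allI[of UNIV "\<lambda>i x. weak_partial i f x = g i x" lborel] by simp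
qed

text \<open>This licenses Fubini in \<open>weak_partial_line\<close>. For fixed s the x-integral is
  bounded by Cauchy-Schwarz, independently of s because translation preserves the L2 norm, and s
  runs through a bounded interval. The factor \<open>c\<close> is used with the values 1 and
  -1.\<close>

lemma integrable_line_product:
  fixes a b :: "('n::finite) wavefun"
  assumes a: "a \<in> L2" and b: "b \<in> L2"
  shows "integrable (lborel \<Otimes>\<^sub>M lborel)
    (\<lambda>(x, s). indicator {0..t::real} s *\<^sub>R (a x * b (x + (c * s) *\<^sub>R axis i 1)))"
proof (rule integrableI_bounded)
  note [measurable] = L2_measurable[OF a] L2_measurable[OF b]
  show "(\<lambda>(x, s). indicator {0..t} s *\<^sub>R (a x * b (x + (c * s) *\<^sub>R axis i 1))) \<in> borel_measurable (lborel \<Otimes>\<^sub>M lborel)"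
    by measurable
  have "(\<integral>\<^sup>+z. ennreal (norm (case z of (x, s) \<Rightarrow> indicator {0..t} s *\<^sub>R (a x * b (x + (c * s) *\<^sub>R axis i 1)))) \<partial>(lborel \<Otimes>\<^sub>M lborel))
      = (\<integral>\<^sup>+s. \<integral>\<^sup>+x. ennreal (norm (indicator {0..t} s *\<^sub>R (a x * b (x + (c * s) *\<^sub>R axis i 1)))) \<partial>lborel \<partial>lborel)"
    by (subst lborel_pair.nn_integral_snd[symmetric]) auto
  also have "\<dots> \<le> (\<integral>\<^sup>+s. ennreal (sqrt (L2_sq a * L2_sq b)) * indicator {0..t} s \<partial>lborel)"
  proof (rule nn_integral_mono)
    fix s :: real
    let ?b = "\<lambda>x. b (x + (c * s) *\<^sub>R axis i 1)"
    have b': "?b \<in> L2" "L2_sq ?b = L2_sq b" using L2_translate[OF b] by auto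
    have "(LINT x|lborel. cmod (a x) * cmod (?b x)) \<le> sqrt (L2_sq a * L2_sq b)"
      using L2_mult_integrable(3)[OF a b'(1)] b'(2) by (simp add: real_le_rsqrt)
    then have "(\<integral>\<^sup>+x. ennreal (cmod (a x) * cmod (?b x)) \<partial>lborel) \<le> ennreal (sqrt (L2_sq a * L2_sq b))"
      using L2_mult_integrable(1)[OF a b'(1)] by (subst nn_integral_eq_integral) (auto intro: ennreal_leI)
    then show "(\<integral>\<^sup>+x. ennreal (norm (indicator {0..t} s *\<^sub>R (a x * ?b x))) \<partial>lborel)
        \<le> ennreal (sqrt (L2_sq a * L2_sq b)) * indicator {0..t} s"
      by (auto simp: indicator_def norm_mult)
  qed
  also have "\<dots> < \<infinity>" by (subst nn_integral_cmult_indicator) (auto simp: ennreal_mult_less_top emeasure_lborel_Icc_eq)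
  finally show "(\<integral>\<^sup>+z. ennreal (norm (case z of (x, s) \<Rightarrow> indicator {0..t} s *\<^sub>R (a x * b (x + (c * s) *\<^sub>R axis i 1)))) \<partial>(lborel \<Otimes>\<^sub>M lborel)) < \<infinity>" .
qed

text \<open>The integral over the segment is not divided by its length, which explains the factor
  \<open>t\<^sup>2\<close> in the norm bound.\<close>

definition line_average :: "'n \<Rightarrow> real \<Rightarrow> ('n::finite) wavefun \<Rightarrow> 'n wavefun" where
  "line_average i t g x = (LINT s|lborel. indicator {0..t} s *\<^sub>R g (x + s *\<^sub>R axis i 1))"

text \<open>One factor t comes from Cauchy-Schwarz on the segment, the other from Tonelli: for each
  s the translate of \<open>g\<close> has the same norm as \<open>g\<close>, and s ranges over an
  interval of length t.\<close>

lemma line_average_L2: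
  fixes g :: "('n::finite) wavefun"
  assumes g: "g \<in> L2" and t: "t \<ge> 0"
  shows "line_average i t g \<in> L2" "L2_sq (line_average i t g) \<le> t\<^sup>2 * L2_sq g"
proof -
  note [measurable] = L2_measurable[OF g]
  define P where "P = (\<lambda>z::'n point \<times> real. indicator {0..t} (snd z) * (cmod (g (fst z + snd z *\<^sub>R axis i 1)))\<^sup>2)"
  have [measurable]: "P \<in> borel_measurable (lborel \<Otimes>\<^sub>M lborel)" unfolding P_def by measurable
  have nn: "(\<integral>\<^sup>+z. ennreal (P z) \<partial>(lborel \<Otimes>\<^sub>M lborel)) = ennreal (t * L2_sq g)"
  proof -
    have "(\<integral>\<^sup>+z. ennreal (P z) \<partial>(lborel \<Otimes>\<^sub>M lborel)) = (\<integral>\<^sup>+s. \<integral>\<^sup>+x. ennreal (P (x, s)) \<partial>lborel \<partial>lborel)"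
      by (subst lborel_pair.nn_integral_snd[symmetric]) auto
    also have "\<dots> = (\<integral>\<^sup>+s. ennreal (L2_sq g) * indicator {0..t} s \<partial>lborel)"
    proof (rule nn_integral_cong)
      fix s :: real
      have "(\<integral>\<^sup>+x. ennreal ((cmod (g (x + s *\<^sub>R axis i 1)))\<^sup>2) \<partial>lborel) = ennreal (L2_sq g)"
        using L2_translate[OF g, of "s *\<^sub>R axis i 1"] L2_integrable
        by (subst nn_integral_eq_integral) (auto simp: L2_sq_def)
      then show "(\<integral>\<^sup>+x. ennreal (P (x, s)) \<partial>lborel) = ennreal (L2_sq g) * indicator {0..t} s"
        by (auto simp: P_def indicator_def)
    qed
    also have "\<dots> = ennreal (t * L2_sq g)"
      using t by (subst nn_integral_cmult_indicator) (auto simp: ennreal_mult' mult.commute)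
    finally show ?thesis .
  qed
  have P0: "0 \<le> P z" for z by (simp add: P_def)
  have Pint: "integrable (lborel \<Otimes>\<^sub>M lborel) P"
    using nn P0 by (intro integrableI_nonneg) auto
  have PL: "integral\<^sup>L (lborel \<Otimes>\<^sub>M lborel) P = t * L2_sq g"
    using nn P0 t by (subst (asm) nn_integral_eq_integral[OF Pint]) auto
  define H where "H x = (LINT s|lborel. P (x, s))" for x
  have H: "integrable lborel H" "(LINT x|lborel. H x) = t * L2_sq g"
    unfolding H_def using lborel_pair.integrable_fst'[OF Pint] lborel_pair.integral_fst'[OF Pint] PL by auto
  have AEb: "AE x in lborel. (cmod (line_average i t g x))\<^sup>2 \<le> t * H x"
    using lborel_pair.AE_integrable_fst'[OF Pint]
  proof eventually_elim
    case (elim x)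
    let ?i = "indicator {0..t} :: real \<Rightarrow> real"
    have i: "integrable lborel (\<lambda>s. (?i s)\<^sup>2)" "(LINT s|lborel. (?i s)\<^sup>2) = t"
      using t by (auto simp: power2_eq_square indicator_inter_arith[symmetric] intro!: integrable_real_indicator)
    have P2: "(\<lambda>s. P (x, s)) = (\<lambda>s. (?i s * cmod (g (x + s *\<^sub>R axis i 1)))\<^sup>2)"
      by (auto simp: P_def indicator_def)
    have "cmod (line_average i t g x) \<le> (LINT s|lborel. norm (?i s *\<^sub>R g (x + s *\<^sub>R axis i 1)))"
      unfolding line_average_def by (rule integral_norm_bound)
    also have "\<dots> = (LINT s|lborel. ?i s * (?i s * cmod (g (x + s *\<^sub>R axis i 1))))"
      by (rule Bochner_Integration.integral_cong) (auto simp: indicator_def)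
    finally have "(cmod (line_average i t g x))\<^sup>2 \<le> (LINT s|lborel. ?i s * (?i s * cmod (g (x + s *\<^sub>R axis i 1))))\<^sup>2"
      by (intro power_mono) auto
    also have "\<dots> \<le> (LINT s|lborel. (?i s)\<^sup>2) * (LINT s|lborel. (?i s * cmod (g (x + s *\<^sub>R axis i 1)))\<^sup>2)"
      by (intro Cauchy_Schwarz_integral(3) i(1) elim[unfolded P2]) measurable
    also have "\<dots> = t * H x" using i P2 by (simp add: H_def)
    finally show ?case .
  qed
  have m: "line_average i t g \<in> borel_measurable borel"
    unfolding line_average_def[abs_def] by measurable
  from L2_bound_AE[OF m integrable_mult_right[OF H(1)] AEb]
  show "line_average i t g \<in> L2" "L2_sq (line_average i t g) \<le> t\<^sup>2 * L2_sq g"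
    using H(2) by (auto simp: power2_eq_square mult_ac)
qed

text \<open>Both sides are compared by pairing with a test function. Fubini fixes the position s on
  the segment, translation invariance moves the shift from \<open>g\<close> to the test function,
  and the definition of the weak derivative replaces \<open>g\<close> by \<open>u\<close>. After a
  second use of Fubini the s-integral is a classical one, evaluated by the fundamental theorem of
  calculus for the smooth test function.\<close>

theorem weak_partial_line:
  fixes u :: "('n::finite) wavefun"
  assumes w: "has_weak_partial i u g" and u: "u \<in> L2" and g: "g \<in> L2" and t: "t \<ge> 0"
  shows "AE x in lborel. u (x + t *\<^sub>R axis i 1) - u x = line_average i t g x"
proof -
  note [measurable] = L2_measurable[OF u] L2_measurable[OF g]
  let ?e = "axis i 1 :: 'n point"
  let ?G = "line_average i t g"
  have G: "?G \<in> L2" by (rule line_average_L2[OF g t])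
  note [measurable] = L2_measurable[OF G]
  have ut: "(\<lambda>x. u (x + t *\<^sub>R ?e)) \<in> L2" by (rule L2_translate[OF u])
  have "AE x in lborel. (u (x + t *\<^sub>R ?e) - u x) - ?G x = 0"
  proof (rule fundamental_lemma)
    show "locally_integrable (\<lambda>x. (u (x + t *\<^sub>R ?e) - u x) - ?G x)"
      by (intro L2_locally_integrable L2_diff ut u G)
    fix \<eta> :: "'n point \<Rightarrow> real" assume \<eta>: "test_function \<eta>"
    note [measurable] = test_function_measurable[OF \<eta>] test_function_measurable[OF test_function_partial[OF \<eta>, of i]]
    let ?h = "\<lambda>x. complex_of_real (\<eta> x)" and ?p = "\<lambda>x. complex_of_real (partial_deriv i \<eta> x)"
    have h: "?h \<in> L2" and p: "?p \<in> L2" by (intro test_function_L2 \<eta> test_function_partial)+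
    have "(LINT x|lborel. \<eta> x *\<^sub>R ?G x) = (LINT x|lborel. LINT s|lborel. indicator {0..t} s *\<^sub>R (?h x * g (x + (1 * s) *\<^sub>R ?e)))"
      unfolding line_average_def
      by (intro Bochner_Integration.integral_cong refl)
        (simp flip: integral_mult_right_zero integral_scaleR_right add: scaleR_conv_of_real mult_ac)
    also have "\<dots> = (LINT s|lborel. LINT x|lborel. indicator {0..t} s *\<^sub>R (?h x * g (x + (1 * s) *\<^sub>R ?e)))"
      using lborel_pair.Fubini_integral[OF integrable_line_product[OF h g, of t 1 i]]
      by simp
    also have "\<dots> = (LINT s|lborel. LINT x|lborel. indicator {0..t} s *\<^sub>R - (u x * ?p (x + ((-1) * s) *\<^sub>R ?e)))"
    proof (rule Bochner_Integration.integral_cong[OF refl])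
      fix s :: real
      have "(LINT x|lborel. ?h x * g (x + s *\<^sub>R ?e)) = (LINT x|lborel. ?h (x + (- s) *\<^sub>R ?e) * g x)"
        using lborel_translate[of "\<lambda>x. ?h x * g (x + s *\<^sub>R ?e)" "(- s) *\<^sub>R ?e"] by simp
      also have "\<dots> = (LINT x|lborel. \<eta> (x + (- s) *\<^sub>R ?e) *\<^sub>R g x)" by (simp add: scaleR_conv_of_real)
      also have "\<dots> = - (LINT x|lborel. partial_deriv i (\<lambda>x. \<eta> (x + (- s) *\<^sub>R ?e)) x *\<^sub>R u x)"
        using has_weak_partialD[OF w test_function_translate[OF \<eta>, of "(- s) *\<^sub>R ?e"]] by simp
      also have "\<dots> = (LINT x|lborel. - (u x * ?p (x + (- s) *\<^sub>R ?e)))"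
        by (subst partial_deriv_translate(1)[OF test_function_differentiable[OF \<eta>]])
          (simp add: scaleR_conv_of_real mult.commute)
      finally show "(LINT x|lborel. indicator {0..t} s *\<^sub>R (?h x * g (x + (1 * s) *\<^sub>R ?e)))
        = (LINT x|lborel. indicator {0..t} s *\<^sub>R - (u x * ?p (x + ((-1) * s) *\<^sub>R ?e)))"
        by (simp add: indicator_def)
    qed
    also have "\<dots> = - (LINT s|lborel. LINT x|lborel. indicator {0..t} s *\<^sub>R (u x * ?p (x + ((-1) * s) *\<^sub>R ?e)))"
      by simp
    also have "\<dots> = - (LINT x|lborel. LINT s|lborel. indicator {0..t} s *\<^sub>R (u x * ?p (x + ((-1) * s) *\<^sub>R ?e)))"
      using lborel_pair.Fubini_integral[OF integrable_line_product[OF u p, of t "-1" i]]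
      by simp
    also have "\<dots> = - (LINT x|lborel. u x * of_real (\<eta> x - \<eta> (x + (- t) *\<^sub>R ?e)))"
    proof (intro arg_cong[where f=uminus] Bochner_Integration.integral_cong[OF refl])
      fix x :: "'n point"
      let ?q = "\<lambda>s::real. - \<eta> (x + (- s) *\<^sub>R ?e)"
      have D: "(?q has_real_derivative partial_deriv i \<eta> (x + (- s) *\<^sub>R ?e)) (at s)" for s
      proof -
        have "((\<lambda>s. \<eta> (x + (- s) *\<^sub>R ?e)) has_real_derivative partial_deriv i \<eta> (x + (- s) *\<^sub>R ?e) * (-1)) (at s)"
          by (rule DERIV_chain2[OF DERIV_along_axis[OF test_function_differentiable[OF \<eta>]]])
            (auto intro!: derivative_eq_intros)
        from DERIV_minus[OF this] show ?thesis by simp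
      qed
      have "(LINT s|lborel. partial_deriv i \<eta> (x + (- s) *\<^sub>R ?e) * indicator {0..t} s) = ?q t - ?q 0"
      proof (rule integral_FTC_Icc_real[OF t D])
        have "continuous_on UNIV (partial_deriv i \<eta>)" by (rule test_function_continuous[OF test_function_partial[OF \<eta>]])
        then have "continuous_on UNIV (\<lambda>s::real. partial_deriv i \<eta> (x + (- s) *\<^sub>R ?e))"
          by (rule continuous_on_compose2) (auto intro!: continuous_intros)
        then show "isCont (\<lambda>s. partial_deriv i \<eta> (x + (- s) *\<^sub>R ?e)) s" for s
          by (simp add: continuous_on_eq_continuous_at)
      qed
      then have "(LINT s|lborel. complex_of_real (partial_deriv i \<eta> (x + (- s) *\<^sub>R ?e) * indicator {0..t} s)) = of_real (\<eta> x - \<eta> (x + (- t) *\<^sub>R ?e))"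
        by (simp del: of_real_mult)
      moreover have "indicator {0..t} s *\<^sub>R (u x * ?p (x + ((-1) * s) *\<^sub>R ?e))
          = u x * complex_of_real (partial_deriv i \<eta> (x + (- s) *\<^sub>R ?e) * indicator {0..t} s)" for s
        by (simp add: scaleR_conv_of_real)
      ultimately show "(LINT s|lborel. indicator {0..t} s *\<^sub>R (u x * ?p (x + ((-1) * s) *\<^sub>R ?e))) = u x * of_real (\<eta> x - \<eta> (x + (- t) *\<^sub>R ?e))"
        by (simp only: integral_mult_right_zero)
    qed
    also have "\<dots> = (LINT x|lborel. \<eta> (x + (- t) *\<^sub>R ?e) *\<^sub>R u x) - (LINT x|lborel. \<eta> x *\<^sub>R u x)"
    proof -
      have "u x * of_real (\<eta> x - \<eta> (x + (- t) *\<^sub>R ?e)) = \<eta> x *\<^sub>R u x - \<eta> (x + (- t) *\<^sub>R ?e) *\<^sub>R u x" for x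
        by (simp add: scaleR_conv_of_real algebra_simps)
      moreover note Bochner_Integration.integral_diff[OF test_function_mult_integrable[OF \<eta> L2_locally_integrable[OF u]]
          test_function_mult_integrable[OF test_function_translate[OF \<eta>] L2_locally_integrable[OF u]], of "(- t) *\<^sub>R ?e"]
      ultimately show ?thesis by (simp only: minus_diff_eq)
    qed
    also have "(LINT x|lborel. \<eta> (x + (- t) *\<^sub>R ?e) *\<^sub>R u x) = (LINT x|lborel. \<eta> x *\<^sub>R u (x + t *\<^sub>R ?e))"
      using lborel_translate[of "\<lambda>x. \<eta> (x + (- t) *\<^sub>R ?e) *\<^sub>R u x" "t *\<^sub>R ?e"] by simp
    finally show "(LINT x|lborel. \<eta> x *\<^sub>R (u (x + t *\<^sub>R ?e) - u x - ?G x)) = 0"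
      using G ut u by (simp add: scaleR_diff_right test_function_mult_integrable[OF \<eta> L2_locally_integrable])
  qed
  then show ?thesis by simp
qed

lemma weak_partial_translate_bound:
  fixes u :: "('n::finite) wavefun"
  assumes w: "has_weak_partial i u g" and u: "u \<in> L2" and g: "g \<in> L2"
  shows "L2_sq (\<lambda>x. u (x + t *\<^sub>R axis i 1) - u x) \<le> t\<^sup>2 * L2_sq g"
proof -
  note [measurable] = L2_measurable[OF u]
  have pos: "L2_sq (\<lambda>x. u (x + t *\<^sub>R axis i 1) - u x) \<le> t\<^sup>2 * L2_sq g" if "t \<ge> 0" for t
  proof -
    have "L2_sq (\<lambda>x. u (x + t *\<^sub>R axis i 1) - u x) = L2_sq (line_average i t g)"
      using line_average_L2(1)[OF g that, THEN L2_measurable]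
      by (intro L2_sq_eq_AE weak_partial_line[OF w u g that]) auto
    with line_average_L2(2)[OF g that] show ?thesis by simp
  qed
  show ?thesis
  proof (cases "t \<ge> 0")
    \<comment> \<open>Shifting the variable by -t turns the increment of step t into minus the
      increment of step -t, which is covered by \<open>pos\<close>.\<close>
    case False
    have "L2_sq (\<lambda>x. u (x + (- t) *\<^sub>R axis i 1 + t *\<^sub>R axis i 1) - u (x + (- t) *\<^sub>R axis i 1)) = L2_sq (\<lambda>x. u (x + t *\<^sub>R axis i 1) - u x)"
      by (rule L2_translate(2)[OF L2_diff(1)[OF L2_translate(1)[OF u] u]])
    moreover have "L2_sq (\<lambda>x. u (x + (- t) *\<^sub>R axis i 1) - u x) = L2_sq (\<lambda>x. u (x + (- t) *\<^sub>R axis i 1 + t *\<^sub>R axis i 1) - u (x + (- t) *\<^sub>R axis i 1))"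
      unfolding L2_sq_def by (rule Bochner_Integration.integral_cong[OF refl]) (metis (no_types) add.assoc add.right_neutral add_diff_cancel_right' diff_add_cancel norm_minus_commute scaleR_left_distrib add.left_inverse scaleR_zero_left)
    ultimately have "L2_sq (\<lambda>x. u (x + t *\<^sub>R axis i 1) - u x) = L2_sq (\<lambda>x. u (x + (- t) *\<^sub>R axis i 1) - u x)"
      by (metis (no_types))
    with pos[of "- t"] False show ?thesis by simp
  qed (rule pos)
qed

text \<open>The shift by \<open>z\<close> is carried out one coordinate at a time. Each partial move
  costs only its own directional bound, since the moves already made are translations and preserve
  the norm.\<close>

lemma H1_translate_bound:
  fixes u :: "('n::finite) wavefun"
  assumes w: "\<And>i. has_weak_partial i u (g i)" and u: "u \<in> L2" and g: "\<And>i. g i \<in> L2"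
  shows "sqrt (L2_sq (\<lambda>x. u (x + z) - u x)) \<le> (\<Sum>i\<in>UNIV. \<bar>z $ i\<bar> * sqrt (L2_sq (g i)))"
proof -
  have S: "sqrt (L2_sq (\<lambda>x. u (x + (\<Sum>i\<in>S. (z $ i) *\<^sub>R axis i 1)) - u x)) \<le> (\<Sum>i\<in>S. \<bar>z $ i\<bar> * sqrt (L2_sq (g i)))" for S
  proof (induction S rule: infinite_finite_induct)
    case (insert j S)
    define y where "y = (\<Sum>i\<in>S. (z $ i) *\<^sub>R axis i (1::real))"
    define v where "v x = u (x + (z $ j) *\<^sub>R axis j 1) - u x" for x
    have v: "v \<in> L2" unfolding v_def[abs_def] by (intro L2_diff L2_translate u)
    have "sqrt (L2_sq (\<lambda>x. v (x + y) + (u (x + y) - u x))) \<le> sqrt (L2_sq (\<lambda>x. v (x + y))) + sqrt (L2_sq (\<lambda>x. u (x + y) - u x))"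
      by (intro L2_norm_triangle L2_diff L2_translate u v)
    also have "sqrt (L2_sq (\<lambda>x. v (x + y))) = sqrt (L2_sq v)"
      using L2_translate(2)[OF v] by simp
    also have "sqrt (L2_sq v) \<le> \<bar>z $ j\<bar> * sqrt (L2_sq (g j))"
      using real_sqrt_le_mono[OF weak_partial_translate_bound[OF w[of j] u g[of j], of "z $ j"]]
      by (simp add: v_def[abs_def] real_sqrt_mult)
    finally have "sqrt (L2_sq (\<lambda>x. v (x + y) + (u (x + y) - u x)))
        \<le> \<bar>z $ j\<bar> * sqrt (L2_sq (g j)) + (\<Sum>i\<in>S. \<bar>z $ i\<bar> * sqrt (L2_sq (g i)))"
      using insert.IH unfolding y_def[symmetric] by linarith
    moreover have "v (x + y) + (u (x + y) - u x) = u (x + (\<Sum>i\<in>insert j S. (z $ i) *\<^sub>R axis i 1)) - u x" for x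
      unfolding v_def sum.insert[OF insert.hyps] y_def[symmetric] by (simp add: ac_simps)
    ultimately show ?case unfolding sum.insert[OF insert.hyps(1,2), of "\<lambda>i. \<bar>z $ i\<bar> * sqrt (L2_sq (g i))"] by simp
  qed (auto simp: L2_sq_def)
  have "(\<Sum>i\<in>UNIV. (z $ i) *\<^sub>R axis i 1) = z"
    by (simp add: vec_eq_iff axis_def if_distrib cong: if_cong)
  with S[of UNIV] show ?thesis by simp
qed

subsection \<open>Dyadic averages\<close>

definition dyadic_cell :: "nat \<Rightarrow> ('n::finite) point \<Rightarrow> int ^ 'n" where
  "dyadic_cell k x = (\<chi> i. \<lfloor>2 ^ k * x $ i\<rfloor>)"

definition dyadic_cube :: "nat \<Rightarrow> int ^ 'n \<Rightarrow> ('n::finite) point set" where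
  "dyadic_cube k c = {y. dyadic_cell k y = c}"

definition dyadic_average :: "nat \<Rightarrow> ('n::finite) wavefun \<Rightarrow> 'n wavefun" where
  "dyadic_average k u x = (2 ^ k) ^ CARD('n) *
     (LINT y|lborel. indicator (dyadic_cube k (dyadic_cell k x)) y *\<^sub>R u y)"

text \<open>This is the only information about the gradient that the embedding and the compactness
  theorem use. The shift is measured coordinatewise because two points of one dyadic cube differ by
  at most the side length in each coordinate.\<close>

definition translation_bounded :: "real \<Rightarrow> ('n::finite) wavefun \<Rightarrow> bool" where
  "translation_bounded A u \<longleftrightarrow> u \<in> L2 \<and>
     (\<forall>r\<ge>0. \<forall>z. (\<forall>i. \<bar>z $ i\<bar> \<le> r) \<longrightarrow> L2_sq (\<lambda>x. u (x + z) - u x) \<le> r\<^sup>2 * A)"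

section \<open>Dyadic cubes and the averages over them\<close>

lemma emeasure_cart_cube:
  fixes a :: "'n::finite point" assumes "h \<ge> 0"
  shows "emeasure lborel (cbox a (a + (\<chi> i. h))) = ennreal (h ^ CARD('n))"
    "emeasure lborel (box a (a + (\<chi> i. h))) = ennreal (h ^ CARD('n))"
proof -
  have *: "(\<chi> i. h) \<bullet> b = h" if "b \<in> Basis" for b :: "'n point"
    using that by (auto simp: Basis_vec_def inner_axis)
  have "\<forall>b\<in>Basis. a \<bullet> b \<le> (a + (\<chi> i. h)) \<bullet> b" using assms by (simp add: inner_add_left *)
  then show "emeasure lborel (cbox a (a + (\<chi> i. h))) = ennreal (h ^ CARD('n))"
    "emeasure lborel (box a (a + (\<chi> i. h))) = ennreal (h ^ CARD('n))"
    by (subst emeasure_lborel_cbox emeasure_lborel_box; simp add: *)+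
qed

lemma mem_symmetric_cbox:
  fixes z :: "real ^ 'n"
  shows "z \<in> cbox (- (\<chi> i. r)) (\<chi> i. r) \<longleftrightarrow> (\<forall>i. \<bar>z $ i\<bar> \<le> r)"
  by (simp add: mem_box_cart abs_le_iff conj_commute minus_le_iff[of r])

lemma dyadic_cube_iff: "y \<in> dyadic_cube k c \<longleftrightarrow> (\<forall>i. of_int (c $ i) \<le> 2 ^ k * y $ i \<and> 2 ^ k * y $ i < of_int (c $ i) + 1)"
  by (simp add: dyadic_cube_def dyadic_cell_def vec_eq_iff floor_eq_iff)

lemma dyadic_cube_borel [measurable]: "dyadic_cube k c \<in> sets borel"
proof -
  have eq: "dyadic_cube k c = (\<Inter>i\<in>UNIV. {y. of_int (c $ i) \<le> 2 ^ k * y $ i} \<inter> {y. 2 ^ k * y $ i < of_int (c $ i) + 1})"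
    by (auto simp: dyadic_cube_iff)
  have "closed {y::'a point. of_int (c $ i) \<le> 2 ^ k * y $ i}" "open {y::'a point. 2 ^ k * y $ i < of_int (c $ i) + 1}" for i
    by (intro closed_Collect_le open_Collect_less continuous_intros)+
  then show ?thesis unfolding eq by (intro sets.finite_INT sets.Int) auto
qed

lemma emeasure_dyadic_cube: "emeasure lborel (dyadic_cube k c :: 'n::finite point set) = ennreal ((1 / 2 ^ k) ^ CARD('n))"
proof -
  let ?a = "(\<chi> i. of_int (c $ i) / 2 ^ k) :: 'n point" and ?h = "(\<chi> i. 1 / 2 ^ k) :: 'n point"
  have "dyadic_cube k c \<subseteq> cbox ?a (?a + ?h)" "box ?a (?a + ?h) \<subseteq> dyadic_cube k c"
    by (auto simp: dyadic_cube_iff mem_box_cart field_simps less_imp_le)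
  then have "emeasure lborel (dyadic_cube k c) \<le> emeasure lborel (cbox ?a (?a + ?h))"
    "emeasure lborel (box ?a (?a + ?h)) \<le> emeasure lborel (dyadic_cube k c)"
    by (auto intro!: emeasure_mono)
  then show ?thesis using emeasure_cart_cube[of "1 / 2 ^ k" ?a] by simp
qed

lemma measure_dyadic_cube: "measure lborel (dyadic_cube k c :: 'n::finite point set) = (1 / 2 ^ k) ^ CARD('n)"
  by (simp add: measure_def emeasure_dyadic_cube)

lemma dyadic_indicator:
  fixes c :: "int ^ 'n::finite"
  shows "integrable lborel (\<lambda>x. (indicator (dyadic_cube k c) x)\<^sup>2 :: real)"
    "(LINT x|lborel. (indicator (dyadic_cube k c) x)\<^sup>2 :: real) = (1 / 2 ^ k) ^ CARD('n)"
proof -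
  have *: "(indicator (dyadic_cube k c) x)\<^sup>2 = (indicator (dyadic_cube k c) x :: real)" for x
    by (auto simp: indicator_def)
  show "integrable lborel (\<lambda>x. (indicator (dyadic_cube k c) x)\<^sup>2 :: real)"
    unfolding * by (intro integrable_real_indicator) (auto simp: emeasure_dyadic_cube)
  show "(LINT x|lborel. (indicator (dyadic_cube k c) x)\<^sup>2 :: real) = (1 / 2 ^ k) ^ CARD('n)"
    unfolding * by (simp add: measure_dyadic_cube)
qed

lemma cube_average_bound:
  fixes w :: "('n::finite) wavefun" and c :: "int ^ 'n"
  assumes [measurable]: "w \<in> borel_measurable borel"
    and int: "integrable lborel (\<lambda>y. indicator (dyadic_cube k c) y * (cmod (w y))\<^sup>2)"
  shows "integrable lborel (\<lambda>y. indicator (dyadic_cube k c) y *\<^sub>R w y)"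
    and "(cmod (LINT y|lborel. indicator (dyadic_cube k c) y *\<^sub>R w y))\<^sup>2
      \<le> (1 / 2 ^ k) ^ CARD('n) * (LINT y|lborel. indicator (dyadic_cube k c) y * (cmod (w y))\<^sup>2)"
proof -
  let ?i = "indicator (dyadic_cube k c) :: 'n point \<Rightarrow> real"
  have e: "(?i y * cmod (w y))\<^sup>2 = ?i y * (cmod (w y))\<^sup>2" for y by (auto simp: indicator_def)
  have e2: "?i y * (?i y * cmod (w y)) = norm (?i y *\<^sub>R w y)" for y by (auto simp: indicator_def)
  have m: "?i \<in> borel_measurable lborel" "(\<lambda>y. ?i y * cmod (w y)) \<in> borel_measurable lborel" by measurable
  note CS = Cauchy_Schwarz_integral[OF m dyadic_indicator(1) int[folded e], unfolded e e2 dyadic_indicator(2)]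
  show "integrable lborel (\<lambda>y. ?i y *\<^sub>R w y)"
    using CS(1) by (subst (asm) integrable_norm_iff) auto
  have "cmod (LINT y|lborel. ?i y *\<^sub>R w y) \<le> (LINT y|lborel. norm (?i y *\<^sub>R w y))"
    by (rule integral_norm_bound)
  from power_mono[OF this norm_ge_zero, of 2] CS(3)
  show "(cmod (LINT y|lborel. ?i y *\<^sub>R w y))\<^sup>2 \<le> (1 / 2 ^ k) ^ CARD('n) * (LINT y|lborel. ?i y * (cmod (w y))\<^sup>2)"
    by (rule order_trans)
qed

lemma cube_L2_integrable:
  assumes "w \<in> L2"
  shows "integrable lborel (\<lambda>y. indicator (dyadic_cube k c) y * (cmod (w y))\<^sup>2)"
    "(LINT y|lborel. indicator (dyadic_cube k c) y * (cmod (w y))\<^sup>2) \<le> L2_sq w"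
proof -
  note [measurable] = L2_measurable[OF assms]
  show i: "integrable lborel (\<lambda>y. indicator (dyadic_cube k c) y * (cmod (w y))\<^sup>2)"
    by (rule Bochner_Integration.integrable_bound[OF L2_integrable[OF assms]]) (auto simp: indicator_def)
  show "(LINT y|lborel. indicator (dyadic_cube k c) y * (cmod (w y))\<^sup>2) \<le> L2_sq w"
    unfolding L2_sq_def by (intro integral_mono i L2_integrable[OF assms]) (auto simp: indicator_def)
qed

lemma cube_integral_bound:
  fixes w :: "('n::finite) wavefun"
  assumes "w \<in> L2"
  shows "(cmod (LINT y|lborel. indicator (dyadic_cube k c) y *\<^sub>R w y))\<^sup>2 \<le> (1 / 2 ^ k) ^ CARD('n) * L2_sq w"
  using cube_average_bound(2)[OF L2_measurable cube_L2_integrable(1), OF assms assms, of k c]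
    mult_left_mono[OF cube_L2_integrable(2)[OF assms, of k c], of "(1 / 2 ^ k) ^ CARD('n)"]
  by (rule order_trans) simp

text \<open>The sup-norm half of the interpolation: an average over a cube of volume 2^(-k d) is
  controlled by the L2 norm at the price of the inverse volume.\<close>

lemma dyadic_average_bound:
  fixes w :: "('n::finite) wavefun"
  assumes "w \<in> L2"
  shows "(cmod (dyadic_average k w x))\<^sup>2 \<le> (2 ^ k) ^ CARD('n) * L2_sq w"
proof -
  have "(cmod (dyadic_average k w x))\<^sup>2 = ((2 ^ k) ^ CARD('n))\<^sup>2 * (cmod (LINT y|lborel. indicator (dyadic_cube k (dyadic_cell k x)) y *\<^sub>R w y))\<^sup>2"
    by (simp add: dyadic_average_def norm_mult norm_power power_mult_distrib)
  also have "\<dots> \<le> ((2 ^ k) ^ CARD('n))\<^sup>2 * ((1 / 2 ^ k) ^ CARD('n) * L2_sq w)"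
    by (intro mult_left_mono cube_integral_bound assms) auto
  also have "\<dots> = (2 ^ k) ^ CARD('n) * L2_sq w"
    by (simp add: power2_eq_square power_one_over field_simps)
  finally show ?thesis .
qed

lemma dyadic_average_diff:
  assumes "u \<in> L2" "v \<in> L2"
  shows "dyadic_average k (\<lambda>x. u x - v x) x = dyadic_average k u x - dyadic_average k v x"
  using cube_average_bound(1)[OF L2_measurable cube_L2_integrable(1), OF assms(1,1)]
    cube_average_bound(1)[OF L2_measurable cube_L2_integrable(1), OF assms(2,2)]
  by (simp add: dyadic_average_def scaleR_diff_right right_diff_distrib)

lemma dyadic_average_const:
  fixes w :: "('n::finite) wavefun"
  assumes "\<And>y. dyadic_cell k y = dyadic_cell k x \<Longrightarrow> w y = b"
  shows "dyadic_average k w x = b"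
proof -
  have "(LINT y|lborel. indicator (dyadic_cube k (dyadic_cell k x)) y *\<^sub>R w y)
     = (LINT y|lborel. indicator (dyadic_cube k (dyadic_cell k x)) y *\<^sub>R b)"
    by (rule Bochner_Integration.integral_cong) (use assms in \<open>auto simp: indicator_def dyadic_cube_def\<close>)
  also have "\<dots> = of_real ((1 / 2 ^ k) ^ CARD('n)) * b"
    by (simp add: measure_dyadic_cube scaleR_conv_of_real emeasure_dyadic_cube)
  finally show ?thesis by (simp add: dyadic_average_def power_one_over)
qed

lemma dyadic_average_cong: "dyadic_cell k x = dyadic_cell k y \<Longrightarrow> dyadic_average k u x = dyadic_average k u y"
  by (simp add: dyadic_average_def)

lemma dyadic_cell_Suc: "dyadic_cell (Suc k) x = dyadic_cell (Suc k) y \<Longrightarrow> dyadic_cell k x = dyadic_cell k y"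
proof -
  have "\<lfloor>2 ^ k * t\<rfloor> = \<lfloor>2 ^ Suc k * t\<rfloor> div 2" for t :: real
    using floor_divide_real_eq_div[of 2 "2 ^ Suc k * t"] by simp
  then show "dyadic_cell (Suc k) x = dyadic_cell (Suc k) y \<Longrightarrow> dyadic_cell k x = dyadic_cell k y"
    by (simp add: dyadic_cell_def vec_eq_iff)
qed

lemma dyadic_cell_measurable: "(dyadic_cell k :: 'n::finite point \<Rightarrow> int ^ 'n) \<in> measurable borel (count_space UNIV)"
proof (subst measurable_count_space_eq_countable)
  have "dyadic_cell k -` {c} \<inter> space borel \<in> sets borel" for c :: "int ^ 'n"
  proof -
    have "dyadic_cell k -` {c} \<inter> space borel = dyadic_cube k c" by (auto simp: dyadic_cube_def)
    then show ?thesis using dyadic_cube_borel by metis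
  qed
  then show "(dyadic_cell k :: 'n point \<Rightarrow> int ^ 'n) \<in> space borel \<rightarrow> UNIV \<and>
      (\<forall>c\<in>UNIV. (dyadic_cell k :: 'n point \<Rightarrow> int ^ 'n) -` {c} \<inter> space borel \<in> sets borel)"
    by blast
qed auto

lemma dyadic_average_measurable [measurable]: "dyadic_average k u \<in> borel_measurable borel"
proof -
  have "(\<lambda>x. (\<lambda>c. (2 ^ k) ^ CARD('n) * (LINT y|lborel. indicator (dyadic_cube k c) y *\<^sub>R u y)) (dyadic_cell k x)) \<in> borel_measurable borel"
    by (rule measurable_compose[OF dyadic_cell_measurable]) simp
  then show ?thesis by (simp add: dyadic_average_def[abs_def])
qed

lemma dyadic_cell_close:
  assumes "dyadic_cell k x = dyadic_cell k y" shows "\<bar>(y - x) $ i\<bar> \<le> 1 / 2 ^ k"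
proof -
  have "\<lfloor>2 ^ k * x $ i\<rfloor> = \<lfloor>2 ^ k * y $ i\<rfloor>" using assms by (simp add: dyadic_cell_def vec_eq_iff)
  then have "\<bar>2 ^ k * y $ i - 2 ^ k * x $ i\<bar> \<le> 1" by linarith
  then have "2 ^ k * \<bar>(y - x) $ i\<bar> \<le> 1" by (simp add: abs_mult right_diff_distrib[symmetric])
  then show ?thesis by (simp add: field_simps)
qed

lemma translation_bounded_L2: "translation_bounded A u \<Longrightarrow> u \<in> L2"
  by (simp add: translation_bounded_def)

lemma translation_bounded_nonneg: "translation_bounded A u \<Longrightarrow> 0 \<le> A"
proof -
  assume "translation_bounded A u"
  then have "L2_sq (\<lambda>x. u (x + 0) - u x) \<le> 1\<^sup>2 * A"
    unfolding translation_bounded_def by (metis abs_zero zero_index zero_le_one)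
  then show "0 \<le> A" by (simp add: L2_sq_def)
qed

text \<open>By Cauchy-Schwarz the squared error at x is at most the mean of |u(x) - u(y)|^2 over the
  cell of x. Replacing y by x + z and exchanging integrals leaves translates with |z_i| <= 2^-k,
  each of size at most 4^-k A. The factor \<open>2 ^ CARD('n)\<close> is the ratio of the volumes of
  the range of z and of a cell.\<close>

lemma dyadic_average_error:
  fixes u :: "('n::finite) wavefun"
  assumes u: "translation_bounded A u"
  shows "(\<lambda>x. u x - dyadic_average k u x) \<in> L2"
    "L2_sq (\<lambda>x. u x - dyadic_average k u x) \<le> 2 ^ CARD('n) * (1 / 4) ^ k * A"
proof -
  let ?N = "(2 ^ k) ^ CARD('n) :: real" and ?r = "1 / 2 ^ k :: real"
  let ?Z = "cbox (- (\<chi> i. ?r)) (\<chi> i. ?r) :: 'n point set"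
  have uL: "u \<in> L2" and A: "0 \<le> A" using u translation_bounded_L2 translation_bounded_nonneg by auto
  note [measurable] = L2_measurable[OF uL]
  have pw: "ennreal ((cmod (u x - dyadic_average k u x))\<^sup>2)
      \<le> ennreal ?N * (\<integral>\<^sup>+z. indicator ?Z z * ennreal ((cmod (u (x + z) - u x))\<^sup>2) \<partial>lborel)" for x
  proof -
    let ?c = "dyadic_cell k x"
    let ?i = "indicator (dyadic_cube k ?c) :: 'n point \<Rightarrow> real"
    have int: "integrable lborel (\<lambda>y. ?i y * (cmod (u x - u y))\<^sup>2)"
    proof (rule Bochner_Integration.integrable_bound)
      show "integrable lborel (\<lambda>y. 2 * (cmod (u x))\<^sup>2 * (?i y)\<^sup>2 + 2 * (?i y * (cmod (u y))\<^sup>2))"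
        by (intro Bochner_Integration.integrable_add integrable_mult_right dyadic_indicator cube_L2_integrable uL)
      have "?i y * (cmod (u x - u y))\<^sup>2 \<le> 2 * (cmod (u x))\<^sup>2 * (?i y)\<^sup>2 + 2 * (?i y * (cmod (u y))\<^sup>2)" for y
        using cmod_add_sq_le[of "u x" "- u y"] by (auto simp: indicator_def)
      then show "AE y in lborel. norm (?i y * (cmod (u x - u y))\<^sup>2) \<le> norm (2 * (cmod (u x))\<^sup>2 * (?i y)\<^sup>2 + 2 * (?i y * (cmod (u y))\<^sup>2))"
        by (intro AE_I2) (auto intro: order_trans[OF _ abs_ge_self])
    qed measurable
    note CA = cube_average_bound[OF _ int]
    have ui: "integrable lborel (\<lambda>y. ?i y *\<^sub>R u y)"
      using cube_average_bound(1)[OF _ cube_L2_integrable(1)[OF uL]] by simp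
    have "dyadic_average k (\<lambda>y. u x) x = u x" by (rule dyadic_average_const) simp
    then have "u x - dyadic_average k u x = ?N * ((LINT y|lborel. ?i y *\<^sub>R u x) - (LINT y|lborel. ?i y *\<^sub>R u y))"
      by (simp add: dyadic_average_def right_diff_distrib)
    also have "(LINT y|lborel. ?i y *\<^sub>R u x) - (LINT y|lborel. ?i y *\<^sub>R u y) = (LINT y|lborel. ?i y *\<^sub>R (u x - u y))"
      using ui by (simp add: scaleR_diff_right emeasure_dyadic_cube)
    finally have "(cmod (u x - dyadic_average k u x))\<^sup>2 = ?N\<^sup>2 * (cmod (LINT y|lborel. ?i y *\<^sub>R (u x - u y)))\<^sup>2"
      by (simp add: norm_mult norm_power power_mult_distrib)
    also have "\<dots> \<le> ?N\<^sup>2 * (?r ^ CARD('n) * (LINT y|lborel. ?i y * (cmod (u x - u y))\<^sup>2))"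
      by (intro mult_left_mono CA(2)) auto
    also have "\<dots> = ?N * (LINT y|lborel. ?i y * (cmod (u x - u y))\<^sup>2)"
      by (simp add: power2_eq_square power_one_over field_simps)
    finally have "ennreal ((cmod (u x - dyadic_average k u x))\<^sup>2) \<le> ennreal ?N * (\<integral>\<^sup>+y. ennreal (?i y * (cmod (u x - u y))\<^sup>2) \<partial>lborel)"
      using int by (subst nn_integral_eq_integral) (auto simp flip: ennreal_mult' intro: ennreal_leI)
    \<comment> \<open>Enlarging the cell of x to a symmetric cube around x makes the range of z = y
      - x independent of x, so that the order of integration can be exchanged.\<close>
    also have "(\<integral>\<^sup>+y. ennreal (?i y * (cmod (u x - u y))\<^sup>2) \<partial>lborel) \<le> (\<integral>\<^sup>+y. indicator ?Z (y - x) * ennreal ((cmod (u y - u x))\<^sup>2) \<partial>lborel)"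
    proof (rule nn_integral_mono)
      fix y
      show "ennreal (?i y * (cmod (u x - u y))\<^sup>2) \<le> indicator ?Z (y - x) * ennreal ((cmod (u y - u x))\<^sup>2)"
      proof (cases "y \<in> dyadic_cube k ?c")
        case True
        have "\<bar>(y - x) $ i\<bar> \<le> ?r" for i
          by (rule dyadic_cell_close) (use True in \<open>simp add: dyadic_cube_def\<close>)
        then have "y - x \<in> ?Z" unfolding mem_symmetric_cbox by blast
        then show ?thesis using True by (simp add: norm_minus_commute)
      qed simp
    qed
    also have "\<dots> = (\<integral>\<^sup>+z. indicator ?Z z * ennreal ((cmod (u (x + z) - u x))\<^sup>2) \<partial>lborel)"
    proof -
      have "(\<integral>\<^sup>+y. indicator ?Z (y - x) * ennreal ((cmod (u y - u x))\<^sup>2) \<partial>distr lborel borel ((+) x))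
        = (\<integral>\<^sup>+z. indicator ?Z z * ennreal ((cmod (u (x + z) - u x))\<^sup>2) \<partial>lborel)"
        by (subst nn_integral_distr) auto
      then show ?thesis by (simp add: lborel_distr_plus)
    qed
    finally show ?thesis by (simp add: mult_left_mono)
  qed
  have "(\<integral>\<^sup>+x. ennreal ((cmod (u x - dyadic_average k u x))\<^sup>2) \<partial>lborel)
      \<le> (\<integral>\<^sup>+x. ennreal ?N * (\<integral>\<^sup>+z. indicator ?Z z * ennreal ((cmod (u (x + z) - u x))\<^sup>2) \<partial>lborel) \<partial>lborel)"
    by (intro nn_integral_mono pw)
  also have "\<dots> = ennreal ?N * (\<integral>\<^sup>+x. (\<integral>\<^sup>+z. indicator ?Z z * ennreal ((cmod (u (x + z) - u x))\<^sup>2) \<partial>lborel) \<partial>lborel)"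
    by (rule nn_integral_cmult) measurable
  also have "(\<integral>\<^sup>+x. (\<integral>\<^sup>+z. indicator ?Z z * ennreal ((cmod (u (x + z) - u x))\<^sup>2) \<partial>lborel) \<partial>lborel)
      = (\<integral>\<^sup>+z. (\<integral>\<^sup>+x. indicator ?Z z * ennreal ((cmod (u (x + z) - u x))\<^sup>2) \<partial>lborel) \<partial>lborel)"
    by (rule lborel_pair.Fubini'[symmetric]) measurable
  also have "\<dots> \<le> (\<integral>\<^sup>+z. ennreal (?r\<^sup>2 * A) * indicator ?Z z \<partial>lborel)"
  proof (rule nn_integral_mono)
    fix z :: "'n point"
    have i: "(\<lambda>x. u (x + z) - u x) \<in> L2" by (intro L2_diff L2_translate uL)
    have "L2_sq (\<lambda>x. u (x + z) - u x) \<le> ?r\<^sup>2 * A" if "z \<in> ?Z"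
    proof -
      have "\<bar>z $ i\<bar> \<le> ?r" for i using that unfolding mem_symmetric_cbox by blast
      then show ?thesis using u unfolding translation_bounded_def by simp
    qed
    then show "(\<integral>\<^sup>+x. indicator ?Z z * ennreal ((cmod (u (x + z) - u x))\<^sup>2) \<partial>lborel) \<le> ennreal (?r\<^sup>2 * A) * indicator ?Z z"
      using nn_integral_eq_integral[OF L2_integrable[OF i]]
      by (auto simp: indicator_def L2_sq_def intro: ennreal_leI)
  qed
  also have "\<dots> = ennreal (?r\<^sup>2 * A) * ennreal ((2 * ?r) ^ CARD('n))"
  proof -
    have "- (\<chi> i. ?r) + (\<chi> i. 2 * ?r) = ((\<chi> i. ?r) :: 'n point)" by (simp add: vec_eq_iff)
    then have "emeasure lborel ?Z = ennreal ((2 * ?r) ^ CARD('n))"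
      using emeasure_cart_cube(1)[of "2 * ?r" "- (\<chi> i. ?r) :: 'n point"] by simp
    then show ?thesis by (subst nn_integral_cmult_indicator) auto
  qed
  also have "ennreal ?N * (ennreal (?r\<^sup>2 * A) * ennreal ((2 * ?r) ^ CARD('n))) = ennreal (?N * (?r\<^sup>2 * A * (2 * ?r) ^ CARD('n)))"
    using A by (simp add: ennreal_mult')
  also have "?N * (?r\<^sup>2 * A * (2 * ?r) ^ CARD('n)) = 2 ^ CARD('n) * (1 / 4) ^ k * A"
  proof -
    have "?N * (2 * ?r) ^ CARD('n) = 2 ^ CARD('n)" by (simp flip: power_mult_distrib)
    moreover have "?r\<^sup>2 = (1 / 4) ^ k"
      by (simp add: power_one_over power2_eq_square flip: power_mult_distrib)
    moreover have "?N * (?r\<^sup>2 * A * (2 * ?r) ^ CARD('n)) = (?N * (2 * ?r) ^ CARD('n)) * ?r\<^sup>2 * A"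
      by (simp only: mult_ac)
    ultimately show ?thesis by (simp only:)
  qed
  finally have fin: "(\<integral>\<^sup>+x. ennreal ((cmod (u x - dyadic_average k u x))\<^sup>2) \<partial>lborel) \<le> ennreal (2 ^ CARD('n) * (1 / 4) ^ k * A)" 
    by (simp add: mult_left_mono)
  then have int: "integrable lborel (\<lambda>x. (cmod (u x - dyadic_average k u x))\<^sup>2)"
    by (intro integrableI_nonneg) (auto simp: top.not_eq_extremum[symmetric] top_unique)
  then show "(\<lambda>x. u x - dyadic_average k u x) \<in> L2" by (simp add: L2_def)
  show "L2_sq (\<lambda>x. u x - dyadic_average k u x) \<le> 2 ^ CARD('n) * (1 / 4) ^ k * A"
    using fin A unfolding L2_sq_def
    by (subst (asm) nn_integral_eq_integral[OF int]) (auto simp: ennreal_le_iff)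
qed

section \<open>The embedding into L4 in dimension at most three\<close>

lemma power4_add_le:
  fixes a b :: real
  shows "(a + b) ^ 4 \<le> 216 * a ^ 4 + 1728 / 1000 * b ^ 4"
proof -
  \<comment> \<open>This is (5x - y)^2 >= 0 rearranged. Using it twice produces the constants 6^3 =
    216 and (6/5)^3 = 1728/1000.\<close>
  have sq: "(x + y)\<^sup>2 \<le> 6 * x\<^sup>2 + 6 / 5 * y\<^sup>2" for x y :: real
    using zero_le_power2[of "5 * x - y"] by (simp add: power2_eq_square algebra_simps)
  have "(a + b) ^ 4 = ((a + b)\<^sup>2)\<^sup>2" by (simp flip: power_mult)
  also have "\<dots> \<le> (6 * a\<^sup>2 + 6 / 5 * b\<^sup>2)\<^sup>2" by (intro power_mono sq) simp
  also have "\<dots> \<le> 6 * (6 * a\<^sup>2)\<^sup>2 + 6 / 5 * (6 / 5 * b\<^sup>2)\<^sup>2" by (rule sq)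
  also have "\<dots> = 216 * a ^ 4 + 1728 / 1000 * b ^ 4"
    by (simp add: power_mult_distrib power_divide flip: power_mult)
  finally show ?thesis .
qed

lemma power4_add_le8: "(a + b) ^ 4 \<le> 8 * a ^ 4 + 8 * (b::real) ^ 4"
proof -
  have sq: "(x + y)\<^sup>2 \<le> 2 * x\<^sup>2 + 2 * y\<^sup>2" for x y :: real
    using zero_le_power2[of "x - y"] by (simp add: power2_eq_square algebra_simps)
  have "(a + b) ^ 4 = ((a + b)\<^sup>2)\<^sup>2" by (simp flip: power_mult)
  also have "\<dots> \<le> (2 * a\<^sup>2 + 2 * b\<^sup>2)\<^sup>2" by (intro power_mono sq) simp
  also have "\<dots> \<le> 2 * (2 * a\<^sup>2)\<^sup>2 + 2 * (2 * b\<^sup>2)\<^sup>2" by (rule sq)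
  also have "\<dots> = 8 * a ^ 4 + 8 * b ^ 4"
    by (simp add: power_mult_distrib power_divide flip: power_mult)
  finally show ?thesis .
qed

lemma L4_of_sup_L2:
  assumes "w \<in> L2" "\<And>x. (cmod (w x))\<^sup>2 \<le> S"
  shows "integrable lborel (\<lambda>x. cmod (w x) ^ 4)" "(LINT x|lborel. cmod (w x) ^ 4) \<le> S * L2_sq w"
proof -
  note [measurable] = L2_measurable[OF assms(1)]
  have b: "cmod (w x) ^ 4 \<le> S * (cmod (w x))\<^sup>2" for x
    using mult_right_mono[OF assms(2)[of x], of "(cmod (w x))\<^sup>2"] by (simp flip: power_add)
  have i: "integrable lborel (\<lambda>x. S * (cmod (w x))\<^sup>2)" using L2_integrable[OF assms(1)] by simp
  show j: "integrable lborel (\<lambda>x. cmod (w x) ^ 4)"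
    by (rule Bochner_Integration.integrable_bound[OF i]) (use b in \<open>auto intro: order_trans[OF _ abs_ge_self]\<close>)
  show "(LINT x|lborel. cmod (w x) ^ 4) \<le> S * L2_sq w"
    using integral_mono[OF j i b] by (simp add: L2_sq_def)
qed

text \<open>Averaging at level k+1 leaves a function that is constant on the larger cubes of level k
  unchanged. The increment is thus an average of the level-k error, so its sup norm inherits the
  smallness of that error.\<close>

lemma dyadic_increment_eq:
  fixes u :: "('n::finite) wavefun"
  assumes u: "translation_bounded A u"
  shows "dyadic_average (Suc k) u x - dyadic_average k u x = dyadic_average (Suc k) (\<lambda>y. u y - dyadic_average k u y) x"
proof -
  let ?i = "indicator (dyadic_cube (Suc k) (dyadic_cell (Suc k) x)) :: 'n point \<Rightarrow> real"
  have uL: "u \<in> L2" using u translation_bounded_L2 by auto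
  note E = dyadic_average_error[OF u, of k]
  have "dyadic_average (Suc k) (\<lambda>y. u y - (u y - dyadic_average k u y)) x
      = dyadic_average (Suc k) u x - dyadic_average (Suc k) (\<lambda>y. u y - dyadic_average k u y) x"
    by (rule dyadic_average_diff[OF uL E(1)])
  moreover have "dyadic_average (Suc k) (dyadic_average k u) x = dyadic_average k u x"
    by (rule dyadic_average_const) (rule dyadic_average_cong[OF dyadic_cell_Suc])
  ultimately show ?thesis by simp
qed

text \<open>The integral of |w|^4 is at most sup |w|^2 times the integral of |w|^2. Up to constants
  the first factor is 2^(k d) 4^-k A and the second 4^-k A, so the product decays like 2^(k (d -
  4)); d <= 3 gives the rate 2^-k. With the constants 64 and 32 for the two factors, 2048 is their
  product.\<close>

lemma dyadic_increment_L4: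
  fixes u :: "('n::finite) wavefun"
  assumes u: "translation_bounded A u" and d: "CARD('n) \<le> 3"
  shows "integrable lborel (\<lambda>x. cmod (dyadic_average (Suc k) u x - dyadic_average k u x) ^ 4)"
    "(LINT x|lborel. cmod (dyadic_average (Suc k) u x - dyadic_average k u x) ^ 4) \<le> 2048 * A\<^sup>2 * (1 / 2) ^ k"
proof -
  have A: "0 \<le> A" by (rule translation_bounded_nonneg[OF u])
  let ?D = "2 ^ CARD('n) :: real"
  have D: "?D \<le> 8" using power_increasing[OF d, of "2::real"] by simp
  let ?w = "\<lambda>x. dyadic_average (Suc k) u x - dyadic_average k u x"
  let ?E = "\<lambda>k x. u x - dyadic_average k u x"
  note E = dyadic_average_error[OF u]
  have Ek: "L2_sq (?E k) \<le> 8 * (1 / 4) ^ k * A" for k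
    using E(2)[of k] mult_right_mono[OF D, of "(1 / 4) ^ k * A"] A by (simp add: mult_ac)
  have w: "?w \<in> L2" "L2_sq ?w \<le> 32 * (1 / 4) ^ k * A"
  proof -
    have "?w = (\<lambda>x. ?E k x - ?E (Suc k) x)" by auto
    then have *: "?w \<in> L2" "L2_sq ?w \<le> 2 * L2_sq (?E k) + 2 * L2_sq (?E (Suc k))"
      using L2_diff[OF E(1)[of k] E(1)[of "Suc k"]] by simp_all
    show "?w \<in> L2" by (rule *)
    have "L2_sq (?E (Suc k)) \<le> 2 * ((1 / 4) ^ k * A)" using Ek[of "Suc k"] by simp
    moreover have "L2_sq (?E k) \<le> 8 * ((1 / 4) ^ k * A)" using Ek[of k] by simp
    moreover have "0 \<le> (1 / 4) ^ k * A" using A by simp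
    ultimately have "L2_sq ?w \<le> 32 * ((1 / 4) ^ k * A)" using *(2) by linarith
    then show "L2_sq ?w \<le> 32 * (1 / 4) ^ k * A" by simp
  qed
  have "(2 ^ Suc k :: real) ^ CARD('n) \<le> (2 ^ Suc k) ^ 3"
    by (rule power_increasing[OF d]) (rule one_le_power, simp)
  also have "\<dots> = 8 * 8 ^ k" 
  proof -
    have "(2 ^ Suc k :: real) ^ 3 = (2 ^ 3) ^ Suc k" by (simp only: power_mult[symmetric] mult.commute)
    then show ?thesis by simp
  qed
  finally have N: "(2 ^ Suc k :: real) ^ CARD('n) \<le> 8 * 8 ^ k" .
  have S: "(cmod (?w x))\<^sup>2 \<le> 64 * 2 ^ k * A" for x
  proof -
    have "(cmod (?w x))\<^sup>2 \<le> (2 ^ Suc k) ^ CARD('n) * L2_sq (?E k)"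
      unfolding dyadic_increment_eq[OF u] by (rule dyadic_average_bound[OF E(1)])
    also have "\<dots> \<le> (8 * 8 ^ k) * (8 * (1 / 4) ^ k * A)"
      by (intro mult_mono N Ek) auto
    also have "\<dots> = 64 * (8 * (1 / 4)) ^ k * A" unfolding power_mult_distrib by (simp only: mult_ac)
    finally show ?thesis by simp
  qed
  from L4_of_sup_L2[OF w(1) S]
  show "integrable lborel (\<lambda>x. cmod (?w x) ^ 4)" by simp
  have "(LINT x|lborel. cmod (?w x) ^ 4) \<le> 64 * 2 ^ k * A * L2_sq ?w" by (rule L4_of_sup_L2[OF w(1) S])
  also have "\<dots> \<le> 64 * 2 ^ k * A * (32 * (1 / 4) ^ k * A)" using w(2) A by (intro mult_left_mono) auto
  also have "\<dots> = 2048 * A\<^sup>2 * (2 * (1 / 4)) ^ k" unfolding power_mult_distrib power2_eq_square by (simp only: mult_ac)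
  finally show "(LINT x|lborel. cmod (?w x) ^ 4) \<le> 2048 * A\<^sup>2 * (1 / 2) ^ k" by simp
qed

text \<open>
  The convexity weights \<open>1/6\<close> and \<open>5/6\<close> behind \<open>power4_add_le\<close> are chosen so that \<open>1728 / 1000 / 2 < 1\<close>:
  the bound then survives an arbitrary number of increments.
\<close>

lemma dyadic_telescope_L4:
  fixes u :: "('n::finite) wavefun"
  assumes u: "translation_bounded A u" and d: "CARD('n) \<le> 3"
  shows "integrable lborel (\<lambda>x. cmod (dyadic_average (K + j) u x - dyadic_average K u x) ^ 4) \<and>
    (LINT x|lborel. cmod (dyadic_average (K + j) u x - dyadic_average K u x) ^ 4) \<le> 4000000 * A\<^sup>2 * (1 / 2) ^ K"
proof (induction j arbitrary: K)
  case (Suc j)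
  let ?a = "\<lambda>x. cmod (dyadic_average (Suc K) u x - dyadic_average K u x)"
  let ?b = "\<lambda>x. cmod (dyadic_average (Suc K + j) u x - dyadic_average (Suc K) u x)"
  let ?c = "\<lambda>x. cmod (dyadic_average (K + Suc j) u x - dyadic_average K u x)"
  note IH = Suc[of "Suc K"] note a = dyadic_increment_L4[OF u d, of K]
  have i: "integrable lborel (\<lambda>x. 216 * ?a x ^ 4 + 1728 / 1000 * ?b x ^ 4)" using IH a by simp
  have b: "?c x ^ 4 \<le> 216 * ?a x ^ 4 + 1728 / 1000 * ?b x ^ 4" for x
  proof -
    have "?c x \<le> ?a x + ?b x"
      using norm_triangle_ineq[of "dyadic_average (Suc K) u x - dyadic_average K u x" "dyadic_average (Suc K + j) u x - dyadic_average (Suc K) u x"]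
      by simp
    then have "?c x ^ 4 \<le> (?a x + ?b x) ^ 4" by (intro power_mono) auto
    from this power4_add_le show ?thesis by (rule order_trans)
  qed
  have j: "integrable lborel (\<lambda>x. ?c x ^ 4)"
    by (rule Bochner_Integration.integrable_bound[OF i]) (use b in \<open>auto intro: order_trans[OF _ abs_ge_self]\<close>)
  have "(LINT x|lborel. ?c x ^ 4) \<le> (LINT x|lborel. 216 * ?a x ^ 4 + 1728 / 1000 * ?b x ^ 4)"
    by (rule integral_mono[OF j i b])
  also have "\<dots> = 216 * (LINT x|lborel. ?a x ^ 4) + 1728 / 1000 * (LINT x|lborel. ?b x ^ 4)"
    using IH a by simp
  \<comment> \<open>The new increment contributes 216 * 2048 = 442368 and the halved old bound 1.728
    * 2000000 = 3456000. Any constant above 442368 / (1 - 0.864), about 3.26 million, would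
    reproduce itself in this induction.\<close>
  also have "\<dots> \<le> 216 * (2048 * A\<^sup>2 * (1 / 2) ^ K) + 1728 / 1000 * (4000000 * A\<^sup>2 * (1 / 2) ^ Suc K)"
    using IH a by (intro add_mono mult_left_mono) auto
  also have "\<dots> = 3898368 * (A\<^sup>2 * (1 / 2) ^ K)" by simp
  also have "\<dots> \<le> 4000000 * (A\<^sup>2 * (1 / 2) ^ K)" by (intro mult_right_mono) auto
  finally show ?case using j by simp
qed simp

text \<open>The free level \<open>K\<close> separates two kinds of smallness: for fixed
  \<open>K\<close> the first summand tends to 0 with the L2 norm, while the second is small for
  large \<open>K\<close> whatever that norm is. \<open>L4_tendsto_zero\<close> exploits
  this.\<close>

lemma L4_embedding:
  fixes u :: "('n::finite) wavefun"
  assumes u: "translation_bounded A u" and d: "CARD('n) \<le> 3"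
  shows "integrable lborel (\<lambda>x. cmod (u x) ^ 4)"
    "(LINT x|lborel. cmod (u x) ^ 4) \<le> 8 * (8 ^ K * L2_sq u * (2 * L2_sq u + 16 * A)) + 32000000 * A\<^sup>2 * (1 / 2) ^ K"
proof -
  have A: "0 \<le> A" and uL: "u \<in> L2"
    using translation_bounded_nonneg translation_bounded_L2 u by auto
  note [measurable] = L2_measurable[OF uL]
  let ?D = "2 ^ CARD('n) :: real"
  have D: "?D \<le> 8" using power_increasing[OF d, of "2::real"] by simp
  note E = dyadic_average_error[OF u]
  have Ek: "L2_sq (\<lambda>x. u x - dyadic_average k u x) \<le> 8 * (1 / 4) ^ k * A" for k
    using E(2)[of k] mult_right_mono[OF D, of "(1 / 4) ^ k * A"] A by (simp add: mult_ac)
  let ?aK = "dyadic_average K u"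
  have aK: "?aK \<in> L2" "L2_sq ?aK \<le> 2 * L2_sq u + 16 * A"
  proof -
    have "?aK = (\<lambda>x. u x - (u x - ?aK x))" by simp
    then have "?aK \<in> L2" "L2_sq ?aK \<le> 2 * L2_sq u + 2 * L2_sq (\<lambda>x. u x - ?aK x)"
      using L2_diff[OF uL E(1)[of K]] by auto
    moreover have "2 * L2_sq (\<lambda>x. u x - ?aK x) \<le> 16 * A"
      using Ek[of K] mult_right_mono[OF power_le_one[of "1/4::real" K], of A] A by simp
    ultimately show "?aK \<in> L2" "L2_sq ?aK \<le> 2 * L2_sq u + 16 * A" by auto
  qed
  have N: "(2 ^ K :: real) ^ CARD('n) \<le> 8 ^ K"
  proof -
    have "(2 ^ K :: real) ^ CARD('n) = ?D ^ K" by (simp only: power_mult[symmetric] mult.commute)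
    also have "\<dots> \<le> 8 ^ K" by (intro power_mono D) simp
    finally show ?thesis .
  qed
  have S: "(cmod (?aK x))\<^sup>2 \<le> 8 ^ K * L2_sq u" for x
    using dyadic_average_bound[OF uL, of K x] mult_right_mono[OF N L2_sq_nonneg[of u]] by linarith
  note a4 = L4_of_sup_L2[OF aK(1) S]
  have a4': "(LINT x|lborel. cmod (?aK x) ^ 4) \<le> 8 ^ K * L2_sq u * (2 * L2_sq u + 16 * A)"
    by (rule order_trans[OF a4(2) mult_left_mono[OF aK(2)]]) auto
  have "(\<lambda>k. L2_sq (\<lambda>x. dyadic_average k u x - u x)) \<longlonglongrightarrow> 0"
  proof (rule Lim_null_comparison[OF always_eventually])
    show "\<forall>k. norm (L2_sq (\<lambda>x. dyadic_average k u x - u x)) \<le> 8 * (1 / 4) ^ k * A"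
      using Ek by (simp add: L2_sq_def norm_minus_commute)
    have "(\<lambda>k. (1 / 4 :: real) ^ k) \<longlonglongrightarrow> 0" by (rule LIMSEQ_power_zero) simp
    then show "(\<lambda>k. 8 * (1 / 4) ^ k * A) \<longlonglongrightarrow> 0"
      by (intro tendsto_mult_left_zero tendsto_mult_right_zero)
  qed
  moreover have aL: "dyadic_average k u \<in> L2" for k
    using L2_diff(1)[OF uL E(1)[of k]] by simp
  ultimately obtain r where r: "strict_mono r" "AE x in lborel. (\<lambda>k. dyadic_average (r k) u x) \<longlonglongrightarrow> u x"
    using L2_subseq_AE[of "\<lambda>k. dyadic_average k u", OF _ uL] by blast
  \<comment> \<open>Subsequence indices are written as K plus an offset, the form required by
    \<open>dyadic_telescope_L4\<close>. The natural subtraction is exact because r (k + K) >= k +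
    K.\<close>
  define s where "s k = r (k + K) - K" for k
  have s: "r (k + K) = K + s k" for k
    using seq_suble[OF r(1), of "k + K"] by (simp add: s_def)
  have lim: "AE x in lborel. (\<lambda>k. cmod (dyadic_average (K + s k) u x - ?aK x) ^ 4) \<longlonglongrightarrow> cmod (u x - ?aK x) ^ 4"
    using r(2)
  proof eventually_elim
    case (elim x)
    from LIMSEQ_ignore_initial_segment[OF this, of K]
    show ?case unfolding s by (intro tendsto_intros)
  qed
  have e4: "integrable lborel (\<lambda>x. cmod (u x - ?aK x) ^ 4)"
    "(LINT x|lborel. cmod (u x - ?aK x) ^ 4) \<le> 4000000 * A\<^sup>2 * (1 / 2) ^ K"
    using Fatou_bound[OF _ _ lim, of "\<lambda>_. 4000000 * A\<^sup>2 * (1 / 2) ^ K" "4000000 * A\<^sup>2 * (1 / 2) ^ K"]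
      dyadic_telescope_L4[OF u d] by auto
  have b: "cmod (u x) ^ 4 \<le> 8 * cmod (?aK x) ^ 4 + 8 * cmod (u x - ?aK x) ^ 4" for x
  proof -
    have "cmod (u x) \<le> cmod (?aK x) + cmod (u x - ?aK x)"
      using norm_triangle_ineq[of "?aK x" "u x - ?aK x"] by simp
    then have "cmod (u x) ^ 4 \<le> (cmod (?aK x) + cmod (u x - ?aK x)) ^ 4" by (intro power_mono) auto
    from this power4_add_le8 show ?thesis by (rule order_trans)
  qed
  have i: "integrable lborel (\<lambda>x. 8 * cmod (?aK x) ^ 4 + 8 * cmod (u x - ?aK x) ^ 4)"
    using a4(1) e4(1) by simp
  show j: "integrable lborel (\<lambda>x. cmod (u x) ^ 4)"
    by (rule Bochner_Integration.integrable_bound[OF i]) (use b in \<open>auto intro: order_trans[OF _ abs_ge_self]\<close>)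
  have "(LINT x|lborel. cmod (u x) ^ 4) \<le> 8 * (LINT x|lborel. cmod (?aK x) ^ 4) + 8 * (LINT x|lborel. cmod (u x - ?aK x) ^ 4)"
    using integral_mono[OF j i b] a4(1) e4(1) by simp
  with a4' e4(2) show "(LINT x|lborel. cmod (u x) ^ 4) \<le> 8 * (8 ^ K * L2_sq u * (2 * L2_sq u + 16 * A)) + 32000000 * A\<^sup>2 * (1 / 2) ^ K"
    by linarith
qed

section \<open>Compactness in L2 under a second-moment bound\<close>

lemma L2_norm_diff_le:
  assumes "f \<in> L2" "g \<in> L2"
  shows "sqrt (L2_sq f) \<le> sqrt (L2_sq g) + sqrt (L2_sq (\<lambda>x. f x - g x))"
  using L2_norm_triangle[OF assms(2) L2_diff(1)[OF assms]] by simp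

lemma L2_sq_tendsto:
  assumes "\<And>n. h n \<in> L2" "f \<in> L2" "(\<lambda>n. L2_sq (\<lambda>x. h n x - f x)) \<longlonglongrightarrow> 0"
  shows "(\<lambda>n. L2_sq (h n)) \<longlonglongrightarrow> L2_sq f"
proof -
  have s: "L2_sq (\<lambda>x. f x - h n x) = L2_sq (\<lambda>x. h n x - f x)" for n
    by (simp add: L2_sq_def norm_minus_commute)
  have z: "(\<lambda>n. sqrt (L2_sq (\<lambda>x. h n x - f x))) \<longlonglongrightarrow> 0" using tendsto_real_sqrt[OF assms(3)] by simp
  have "\<bar>sqrt (L2_sq (h n)) - sqrt (L2_sq f)\<bar> \<le> sqrt (L2_sq (\<lambda>x. h n x - f x))" for n
    using L2_norm_diff_le[OF assms(1)[of n] assms(2)] L2_norm_diff_le[OF assms(2) assms(1)[of n]] unfolding s by linarith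
  then have "(\<lambda>n. sqrt (L2_sq (h n)) - sqrt (L2_sq f)) \<longlonglongrightarrow> 0"
    by (intro Lim_null_comparison[OF always_eventually z]) simp
  from LIM_zero_cancel[OF this] have "(\<lambda>n. (sqrt (L2_sq (h n)))\<^sup>2) \<longlonglongrightarrow> (sqrt (L2_sq f))\<^sup>2" by (rule tendsto_power)
  then show ?thesis by simp
qed

lemma translation_bounded_diff:
  assumes u: "translation_bounded A u" and v: "translation_bounded B v"
  shows "translation_bounded (2 * A + 2 * B) (\<lambda>x. u x - v x)"
  unfolding translation_bounded_def
proof (intro conjI allI impI)
  note uL = translation_bounded_L2[OF u] note vL = translation_bounded_L2[OF v]
  show "(\<lambda>x. u x - v x) \<in> L2" by (intro L2_diff uL vL)
  fix r :: real and z :: "'a point" assume r: "0 \<le> r" "\<forall>i. \<bar>z $ i\<bar> \<le> r"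
  have "L2_sq (\<lambda>x. (u (x + z) - u x) - (v (x + z) - v x)) \<le> 2 * L2_sq (\<lambda>x. u (x + z) - u x) + 2 * L2_sq (\<lambda>x. v (x + z) - v x)"
    by (intro L2_diff(2) L2_diff(1) L2_translate uL vL)
  also have "\<dots> \<le> 2 * (r\<^sup>2 * A) + 2 * (r\<^sup>2 * B)"
    using u v r unfolding translation_bounded_def by (intro add_mono mult_left_mono) auto
  finally show "L2_sq (\<lambda>x. u (x + z) - v (x + z) - (u x - v x)) \<le> r\<^sup>2 * (2 * A + 2 * B)"
    by (simp add: algebra_simps)
qed

text \<open>A subsequence along which all dyadic cube integrals converge is shown to be Cauchy. Each
  difference of two members is split into three parts: outside a large ball the second moment makes
  it small, inside it is compared with its averages at one fine level uniformly in the sequence, and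
  the averages on the ball converge in L2 by dominated convergence.\<close>

theorem Rellich_compactness:
  fixes u :: "nat \<Rightarrow> ('n::finite) wavefun"
  assumes u: "\<And>n. translation_bounded A (u n)" and B: "\<And>n. L2_sq (u n) \<le> B"
    and V: "\<And>n. integrable lborel (\<lambda>x. (norm x)\<^sup>2 * (cmod (u n x))\<^sup>2)" "\<And>n. (LINT x|lborel. (norm x)\<^sup>2 * (cmod (u n x))\<^sup>2) \<le> C"
  obtains r f where "strict_mono r" "f \<in> L2" "(\<lambda>n. L2_sq (\<lambda>x. u (r n) x - f x)) \<longlonglongrightarrow> 0"
proof -
  have uL: "u n \<in> L2" for n by (rule translation_bounded_L2[OF u])
  note [measurable] = L2_measurable[OF uL]
  have A: "0 \<le> A" by (rule translation_bounded_nonneg[OF u])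
  have B0: "0 \<le> B" using B[of 0] L2_sq_nonneg[of "u 0"] by linarith
  define a where "a n = (\<lambda>(k, c). LINT y|lborel. indicator (dyadic_cube k c) y *\<^sub>R u n y)" for n
  have a_bound: "norm (a n p) \<le> sqrt B" for n p
  proof (rule real_le_rsqrt)
    obtain k c where p: "p = (k, c)" by fastforce
    have "(cmod (a n p))\<^sup>2 \<le> (1 / 2 ^ k) ^ CARD('n) * L2_sq (u n)"
      unfolding p a_def using cube_integral_bound[OF uL] by simp
    also have "\<dots> \<le> 1 * B"
      by (intro mult_mono power_le_one B) (auto simp: power_le_one)
    finally show "(cmod (a n p))\<^sup>2 \<le> B" by simp
  qed
  \<comment> \<open>The pairs of a level and a cell form a countable set, so a diagonal subsequence
    makes every cube integral converge simultaneously.\<close>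
  obtain r where r: "strict_mono r" "\<And>p. \<exists>l. (\<lambda>n. a (r n) p) \<longlonglongrightarrow> l"
    using function_convergent_subsequence[of "UNIV :: (nat \<times> (int ^ 'n)) set" a "sqrt B"] a_bound
    by (metis UNIV_I countableI_type)
  define v where "v n = u (r n)" for n
  have vL: "v n \<in> L2" for n by (simp add: v_def uL)
  have avg: "convergent (\<lambda>n. dyadic_average k (v n) x)" for k x
  proof -
    have "convergent (\<lambda>n. a (r n) (k, dyadic_cell k x))" using r(2) by (simp add: convergent_def)
    then have "convergent (\<lambda>n. (2 ^ k) ^ CARD('n) * a (r n) (k, dyadic_cell k x))"
      by (rule convergent_mult[OF convergent_const])
    then show ?thesis by (simp add: a_def dyadic_average_def v_def)
  qed
  have "\<exists>N. \<forall>m\<ge>N. \<forall>n\<ge>N. L2_sq (\<lambda>x. v m x - v n x) \<le> e" if "e > 0" for e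
  proof -
    \<comment> \<open>\<open>4 * C\<close> bounds the second moment of a difference of two members,
      so the part outside the ball contributes at most a third of \<open>e\<close>. The witness
      rests on c <= (1 + c)^2 with c = 12 |C| / e.\<close>
    obtain R :: real where R: "R > 0" "4 * C / R\<^sup>2 \<le> e / 3"
    proof
      show "1 + 12 * \<bar>C\<bar> / e > 0" using \<open>e > 0\<close> by (simp add: add_pos_nonneg)
      let ?R = "1 + 12 * \<bar>C\<bar> / e"
      have R1: "?R \<ge> 1" using \<open>e > 0\<close> by simp
      have "c \<le> (1 + c)\<^sup>2" if "c \<ge> 0" for c :: real
        using that zero_le_power2[of c] by (simp add: power2_sum)
      then have "12 * \<bar>C\<bar> / e \<le> ?R\<^sup>2" using \<open>e > 0\<close> by simp
      then have "12 * \<bar>C\<bar> \<le> ?R\<^sup>2 * e" using \<open>e > 0\<close> by (simp only: pos_divide_le_eq)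
      moreover have "12 * C \<le> 12 * \<bar>C\<bar>" by simp
      ultimately have "12 * C \<le> e * ?R\<^sup>2" unfolding mult.commute[of e] by (rule order_trans[rotated])
      then show "4 * C / ?R\<^sup>2 \<le> e / 3" using R1 by (simp add: divide_le_eq)
    qed
    \<comment> \<open>\<open>4 * A\<close> is the translation constant \<open>2 * A + 2 * A\<close>
      of a difference of two members; the outer factor 2 comes from |a + b|^2 <= 2 |a|^2 + 2
      |b|^2.\<close>
    have "(\<lambda>k. 2 * (2 ^ CARD('n) * (1 / 4) ^ k * (4 * A))) \<longlonglongrightarrow> 2 * (2 ^ CARD('n) * 0 * (4 * A))"
      by (intro tendsto_intros LIMSEQ_power_zero) simp
    then have "\<forall>\<^sub>F k in sequentially. 2 * (2 ^ CARD('n) * (1 / 4) ^ k * (4 * A)) < e / 3"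
      by (rule order_tendstoD(2)) (use \<open>e > 0\<close> in simp)
    then obtain k where k: "2 * (2 ^ CARD('n) * (1 / 4) ^ k * (4 * A)) < e / 3"
      using eventually_happens'[OF sequentially_bot] by blast
    let ?b = "indicator (cball 0 R) :: 'n point \<Rightarrow> real"
    define w where "w n x = complex_of_real (?b x) * dyadic_average k (v n) x" for n x
    define wl where "wl x = lim (\<lambda>n. w n x)" for x
    define M where "M = (2 ^ k) ^ CARD('n) * B"
    have [measurable]: "w n \<in> borel_measurable borel" for n
    proof -
      have [measurable]: "cball 0 R \<in> sets (borel :: 'n point measure)" by simp
      have "(\<lambda>x. complex_of_real (?b x)) \<in> borel_measurable borel" by measurable
      then show ?thesis
        unfolding w_def[abs_def] by (intro borel_measurable_times dyadic_average_measurable)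
    qed
    have bI: "integrable lborel ?b" 
      using emeasure_compact_finite[OF compact_cball, of "0 :: 'n point" R]
      by (intro integrable_real_indicator) (auto simp: less_top)
    have wb: "(cmod (w n x))\<^sup>2 \<le> M * ?b x" for n x
    proof -
      have "(cmod (dyadic_average k (v n) x))\<^sup>2 \<le> M"
        unfolding M_def v_def by (rule order_trans[OF dyadic_average_bound[OF uL] mult_left_mono[OF B]]) simp
      then show ?thesis by (auto simp: w_def indicator_def)
    qed
    have wL: "w n \<in> L2" for n
      by (rule L2_bound(1)[OF _ _ wb]) (use bI in auto)
    have wconv: "(\<lambda>n. w n x) \<longlonglongrightarrow> wl x" for x
    proof -
      have "convergent (\<lambda>n. w n x)" unfolding w_def by (intro convergent_mult convergent_const avg)
      then show ?thesis by (simp add: wl_def convergent_LIMSEQ_iff)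
    qed
    have [measurable]: "wl \<in> borel_measurable borel" by (rule borel_measurable_LIMSEQ_metric[OF _ wconv]) measurable
    have wlb: "(cmod (wl x))\<^sup>2 \<le> M * ?b x" for x
      by (rule LIMSEQ_le_const2[OF tendsto_power[OF tendsto_norm[OF wconv]]]) (use wb in auto)
    have wlL: "wl \<in> L2"
      by (rule L2_bound(1)[OF _ _ wlb]) (use bI in auto)
    have "(\<lambda>n. L2_sq (\<lambda>x. w n x - wl x)) \<longlonglongrightarrow> (LINT x|(lborel :: 'n point measure). (0::real))"
      unfolding L2_sq_def
    proof (rule integral_dominated_convergence[where w="\<lambda>x. 4 * M * ?b x"])
      show "AE x in lborel. (\<lambda>n. (cmod (w n x - wl x))\<^sup>2) \<longlonglongrightarrow> 0"
      proof (intro AE_I2)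
        fix x
        have "(\<lambda>n. (cmod (w n x - wl x))\<^sup>2) \<longlonglongrightarrow> (cmod (wl x - wl x))\<^sup>2" by (intro tendsto_intros wconv)
        then show "(\<lambda>n. (cmod (w n x - wl x))\<^sup>2) \<longlonglongrightarrow> 0" by simp
      qed
      show "AE x in lborel. norm ((cmod (w n x - wl x))\<^sup>2) \<le> 4 * M * ?b x" for n
      proof (intro AE_I2)
        fix x
        show "norm ((cmod (w n x - wl x))\<^sup>2) \<le> 4 * M * ?b x"
          using cmod_add_sq_le[of "w n x" "- wl x"] wb[of n x] wlb[of x] by simp
      qed
    qed (use bI in auto)
    then have "(\<lambda>n. L2_sq (\<lambda>x. w n x - wl x)) \<longlonglongrightarrow> 0" by simp
    \<comment> \<open>Comparing two members through the limit doubles each distance, giving 4 * e/24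
      = e/6, and the final splitting doubles once more to e/3.\<close>
    then have "\<forall>\<^sub>F n in sequentially. L2_sq (\<lambda>x. w n x - wl x) < e / 24"
      by (rule order_tendstoD(2)) (use \<open>e > 0\<close> in simp)
    then obtain N where N: "\<And>n. n \<ge> N \<Longrightarrow> L2_sq (\<lambda>x. w n x - wl x) < e / 24"
      by (auto simp: eventually_sequentially)
    have "L2_sq (\<lambda>x. v m x - v n x) \<le> e" if mn: "m \<ge> N" "n \<ge> N" for m n
    proof -
      let ?d = "\<lambda>x. v m x - v n x"
      have td: "translation_bounded (2 * A + 2 * A) ?d" unfolding v_def by (rule translation_bounded_diff[OF u u])
      let ?E = "\<lambda>x. ?d x - dyadic_average k ?d x"
      note E = dyadic_average_error[OF td, of k]
      have W: "(\<lambda>x. w m x - w n x) \<in> L2" "L2_sq (\<lambda>x. w m x - w n x) \<le> e / 6"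
      proof -
        have "(\<lambda>x. w m x - w n x) = (\<lambda>x. (w m x - wl x) - (w n x - wl x))" by simp
        then show "L2_sq (\<lambda>x. w m x - w n x) \<le> e / 6"
          using L2_diff(2)[OF L2_diff(1)[OF wL wlL] L2_diff(1)[OF wL wlL], of m n] N[OF mn(1)] N[OF mn(2)] by simp
      qed (intro L2_diff wL)
      have m2: "integrable lborel (\<lambda>x. (norm x)\<^sup>2 * (cmod (?d x))\<^sup>2) \<and> (LINT x|lborel. (norm x)\<^sup>2 * (cmod (?d x))\<^sup>2) \<le> 4 * C"
      proof -
        have i: "integrable lborel (\<lambda>x. 2 * ((norm x)\<^sup>2 * (cmod (v m x))\<^sup>2) + 2 * ((norm x)\<^sup>2 * (cmod (v n x))\<^sup>2))"
          unfolding v_def using V(1) by simp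
        have b: "(norm x)\<^sup>2 * (cmod (?d x))\<^sup>2 \<le> 2 * ((norm x)\<^sup>2 * (cmod (v m x))\<^sup>2) + 2 * ((norm x)\<^sup>2 * (cmod (v n x))\<^sup>2)" for x
          using mult_left_mono[OF cmod_add_sq_le[of "v m x" "- v n x"], of "(norm x)\<^sup>2"] by (simp add: algebra_simps)
        have [measurable]: "v k \<in> borel_measurable borel" for k unfolding v_def by measurable
        have j: "integrable lborel (\<lambda>x. (norm x)\<^sup>2 * (cmod (?d x))\<^sup>2)"
        proof (rule Bochner_Integration.integrable_bound[OF i])
          show "AE x in lborel. norm ((norm x)\<^sup>2 * (cmod (?d x))\<^sup>2) \<le> norm (2 * ((norm x)\<^sup>2 * (cmod (v m x))\<^sup>2) + 2 * ((norm x)\<^sup>2 * (cmod (v n x))\<^sup>2))"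
          proof (intro AE_I2)
            fix x
            have "norm ((norm x)\<^sup>2 * (cmod (?d x))\<^sup>2) = (norm x)\<^sup>2 * (cmod (?d x))\<^sup>2" by simp
            also note b[of x]
            finally show "norm ((norm x)\<^sup>2 * (cmod (?d x))\<^sup>2) \<le> norm (2 * ((norm x)\<^sup>2 * (cmod (v m x))\<^sup>2) + 2 * ((norm x)\<^sup>2 * (cmod (v n x))\<^sup>2))"
              unfolding real_norm_def by (rule order_trans[OF _ abs_ge_self])
          qed
        qed measurable
        have "(LINT x|lborel. (norm x)\<^sup>2 * (cmod (?d x))\<^sup>2) \<le> 2 * (LINT x|lborel. (norm x)\<^sup>2 * (cmod (v m x))\<^sup>2) + 2 * (LINT x|lborel. (norm x)\<^sup>2 * (cmod (v n x))\<^sup>2)"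
          using integral_mono[OF j i b] V(1) by (simp add: v_def)
        with V(2)[of "r m"] V(2)[of "r n"] j show ?thesis by (simp add: v_def)
      qed
      let ?G = "\<lambda>x. 1 / R\<^sup>2 * ((norm x)\<^sup>2 * (cmod (?d x))\<^sup>2) + 2 * (cmod (?E x))\<^sup>2 + 2 * (cmod (w m x - w n x))\<^sup>2"
      have Gi: "integrable lborel ?G"
        using m2 L2_integrable[OF E(1)] L2_integrable[OF W(1)] by simp
      have G: "(cmod (?d x))\<^sup>2 \<le> ?G x" for x
      proof (cases "x \<in> cball 0 R")
        case True
        have "w m x - w n x = dyadic_average k ?d x"
          unfolding dyadic_average_diff[OF vL vL] w_def using True by simp
        then have "(cmod (?d x))\<^sup>2 \<le> 2 * (cmod (?E x))\<^sup>2 + 2 * (cmod (w m x - w n x))\<^sup>2"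
          using cmod_add_sq_le[of "?E x" "dyadic_average k ?d x"] by simp
        moreover have "0 \<le> 1 / R\<^sup>2 * ((norm x)\<^sup>2 * (cmod (?d x))\<^sup>2)" by simp
        ultimately show ?thesis by linarith
      next
        case False
        then have "R \<le> norm x" by simp
        then have "R\<^sup>2 \<le> (norm x)\<^sup>2" using R(1) by (intro power_mono) auto
        then have "1 \<le> 1 / R\<^sup>2 * (norm x)\<^sup>2" using R(1) by (simp add: field_simps)
        from mult_right_mono[OF this, of "(cmod (?d x))\<^sup>2"]
        have "(cmod (?d x))\<^sup>2 \<le> 1 / R\<^sup>2 * ((norm x)\<^sup>2 * (cmod (?d x))\<^sup>2)" by simp
        moreover have "0 \<le> 2 * (cmod (?E x))\<^sup>2" "0 \<le> 2 * (cmod (w m x - w n x))\<^sup>2" by simp_all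
        ultimately show ?thesis by linarith
      qed
      have "L2_sq ?d \<le> (LINT x|lborel. ?G x)"
        by (rule L2_bound(2)[OF L2_measurable[OF L2_diff(1)[OF vL vL]] Gi G])
      also have "\<dots> = 1 / R\<^sup>2 * (LINT x|lborel. (norm x)\<^sup>2 * (cmod (?d x))\<^sup>2) + 2 * L2_sq ?E + 2 * L2_sq (\<lambda>x. w m x - w n x)"
        using m2 L2_integrable[OF E(1)] L2_integrable[OF W(1)] by (simp add: L2_sq_def)
      also have "\<dots> \<le> 1 / R\<^sup>2 * (4 * C) + 2 * (2 ^ CARD('n) * (1 / 4) ^ k * (4 * A)) + 2 * (e / 6)"
        using m2 E(2) W(2) by (intro add_mono mult_left_mono) auto
      also have "\<dots> \<le> e" using R(2) k by simp
      finally show ?thesis .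
    qed
    then show ?thesis by blast
  qed
  from L2_complete[OF vL this] obtain f where "f \<in> L2" "(\<lambda>n. L2_sq (\<lambda>x. v n x - f x)) \<longlonglongrightarrow> 0"
    by blast
  with r(1) that show ?thesis unfolding v_def by blast
qed

subsection \<open>Weak derivatives from translation bounds and the diamagnetic inequality\<close>

text \<open>This replaces the weak compactness of bounded sets in $L^2$; closedness under midpoints stands in for convexity.\<close>

lemma parallelogram_minimizers_Cauchy:
  fixes q :: "'a \<Rightarrow> real"
  assumes dec: "\<And>m n. m \<le> n \<Longrightarrow> C n \<subseteq> C m"
    and mid: "\<And>n x y. x \<in> C n \<Longrightarrow> y \<in> C n \<Longrightarrow> mid x y \<in> C n"
    and nonneg: "\<And>x. x \<in> C 0 \<Longrightarrow> 0 \<le> q x"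
    and par: "\<And>x y. x \<in> C 0 \<Longrightarrow> y \<in> C 0 \<Longrightarrow> 4 * q (mid x y) + sqdist x y = 2 * q x + 2 * q y"
    and bound: "\<And>n. \<exists>x\<in>C n. q x \<le> B"
  obtains h d D where "\<And>n. h n \<in> C n" "\<And>n. q (h n) \<le> d n + 1 / Suc n" "\<And>n x. x \<in> C n \<Longrightarrow> d n \<le> q x"
    "d \<longlonglongrightarrow> D" "\<And>e. e > 0 \<Longrightarrow> \<exists>N. \<forall>m\<ge>N. \<forall>n\<ge>N. sqdist (h m) (h n) \<le> e"
proof -
  define d where "d n = Inf (q ` C n)" for n
  have bdd: "bdd_below (q ` C n)" for n
    using nonneg dec[of 0 n] by (intro bdd_belowI[of _ 0]) auto
  have ne: "q ` C n \<noteq> {}" for n using bound[of n] by auto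
  have lower: "d n \<le> q x" if "x \<in> C n" for n x
    unfolding d_def using that bdd by (intro cInf_lower) auto
  have dB: "d n \<le> B" for n using bound[of n] lower by force
  have inc: "incseq d"
  proof (rule incseq_SucI)
    show "d n \<le> d (Suc n)" for n
      unfolding d_def using dec[of n "Suc n"] by (intro cInf_superset_mono ne bdd) auto
  qed
  obtain D where D: "d \<longlonglongrightarrow> D" "\<And>n. d n \<le> D"
    using incseq_convergent[OF inc] dB by blast
  have "\<exists>x\<in>C n. q x \<le> d n + 1 / Suc n" for n
  proof -
    have "Inf (q ` C n) < d n + 1 / Suc n" by (simp add: d_def)
    then obtain y where "y \<in> q ` C n" "y < d n + 1 / Suc n" using cInf_lessD[OF ne] by blast
    then show ?thesis by (auto intro: less_imp_le)
  qed
  then obtain h where h: "\<And>n. h n \<in> C n" "\<And>n. q (h n) \<le> d n + 1 / Suc n" by metis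
  have "\<exists>N. \<forall>m\<ge>N. \<forall>n\<ge>N. sqdist (h m) (h n) \<le> e" if "e > 0" for e
  proof -
    have "(\<lambda>N. 4 * (D - d N) + 4 * (1 / Suc N)) \<longlonglongrightarrow> 4 * (D - D) + 4 * 0"
      by (intro tendsto_intros D LIMSEQ_inverse_real_of_nat[unfolded inverse_eq_divide])
    then have "\<forall>\<^sub>F N in sequentially. 4 * (D - d N) + 4 * (1 / Suc N) < e"
      by (rule order_tendstoD(2)) (use that in simp)
    then obtain N where N: "4 * (D - d N) + 4 * (1 / real (Suc N)) < e"
      using eventually_happens'[OF sequentially_bot] by blast
    have "sqdist (h m) (h n) \<le> e" if "m \<ge> N" "n \<ge> N" for m n
    proof -
      have hN: "h m \<in> C N" "h n \<in> C N" using h(1) dec[OF that(1)] dec[OF that(2)] by auto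
      have h0: "h m \<in> C 0" "h n \<in> C 0" using h(1) dec by blast+
      define s where "s k = 1 / real (Suc k)" for k
      have le: "s m \<le> s N" "s n \<le> s N"
        using that by (auto simp: s_def intro!: divide_left_mono)
      \<comment> \<open>Both points lie in \<open>C N\<close>, hence so does their midpoint, whose
        value is at least \<open>d N\<close>; the two points themselves have values at most D + s
        N.\<close>
      have "sqdist (h m) (h n) = 2 * q (h m) + 2 * q (h n) - 4 * q (mid (h m) (h n))"
        using par[OF h0] by linarith
      also have "\<dots> \<le> 2 * (D + s N) + 2 * (D + s N) - 4 * d N"
        using lower[OF mid[OF hN]] h(2)[of m, folded s_def] h(2)[of n, folded s_def] D(2)[of m] D(2)[of n] le
        by (intro diff_mono add_mono mult_left_mono) linarith+
      also have "\<dots> = 4 * (D - d N) + 4 * s N" by (simp add: algebra_simps)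
      also have "\<dots> \<le> e" using N[folded s_def] by (rule less_imp_le)
      finally show ?thesis .
    qed
    then show ?thesis by blast
  qed
  with that[OF h lower D(1)] show ?thesis by (simp only:)
qed

lemma cmod_parallelogram: "4 * (cmod ((a + b) / 2))\<^sup>2 + (cmod (a - b))\<^sup>2 = 2 * (cmod a)\<^sup>2 + 2 * (cmod b)\<^sup>2"
proof -
  have "(cmod (a + b))\<^sup>2 + (cmod (a - b))\<^sup>2 = 2 * (cmod a)\<^sup>2 + 2 * (cmod b)\<^sup>2"
    unfolding cmod_power2 by (simp add: power2_eq_square algebra_simps)
  then show ?thesis by (simp add: norm_divide power_divide)
qed

lemma L2_midpoint: "f \<in> L2 \<Longrightarrow> g \<in> L2 \<Longrightarrow> (\<lambda>x. (f x + g x) / 2) \<in> L2"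
  using L2_cmult[OF L2_add(1), of f g "1 / 2"] by simp

lemma L2_sq_parallelogram:
  assumes "f \<in> L2" "g \<in> L2"
  shows "4 * L2_sq (\<lambda>x. (f x + g x) / 2) + L2_sq (\<lambda>x. f x - g x) = 2 * L2_sq f + 2 * L2_sq g"
proof -
  note i = L2_integrable[OF L2_midpoint[OF assms]] L2_integrable[OF L2_diff(1)[OF assms]] assms[THEN L2_integrable]
  have "4 * L2_sq (\<lambda>x. (f x + g x) / 2) + L2_sq (\<lambda>x. f x - g x)
      = (LINT x|lborel. 4 * (cmod ((f x + g x) / 2))\<^sup>2 + (cmod (f x - g x))\<^sup>2)"
    unfolding L2_sq_def using i by (subst Bochner_Integration.integral_add) auto
  also have "\<dots> = 2 * L2_sq f + 2 * L2_sq g"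
    unfolding cmod_parallelogram L2_sq_def using i by simp
  finally show ?thesis .
qed

text \<open>Translation invariance moves the difference quotient onto the test function, with
  reversed step. There it converges pointwise to minus the partial derivative, and it is bounded
  with support in a fixed ball, so local integrability of \<open>v\<close> suffices for dominated
  convergence.\<close>

lemma test_function_difference_quotient:
  fixes v :: "('n::finite) wavefun"
  assumes \<eta>: "test_function \<eta>" and v: "v \<in> L2"
  shows "(\<lambda>n. LINT x|lborel. \<eta> x *\<^sub>R (of_nat (Suc n) * (v (x + (1 / Suc n) *\<^sub>R axis i 1) - v x)))
    \<longlonglongrightarrow> - (LINT x|lborel. partial_deriv i \<eta> x *\<^sub>R v x)"
proof -
  let ?e = "axis i 1 :: 'n point"
  note [measurable] = L2_measurable[OF v] test_function_measurable[OF \<eta>] test_function_measurable[OF test_function_partial[OF \<eta>, of i]]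
  note vl = L2_locally_integrable[OF v]
  define Q where "Q n x = real (Suc n) * (\<eta> (x + (- (1 / Suc n)) *\<^sub>R ?e) - \<eta> x)" for n x
  have [measurable]: "Q n \<in> borel_measurable borel" for n unfolding Q_def[abs_def] by measurable
  have eq: "(LINT x|lborel. \<eta> x *\<^sub>R (of_nat (Suc n) * (v (x + (1 / Suc n) *\<^sub>R ?e) - v x))) = (LINT x|lborel. Q n x *\<^sub>R v x)" for n
  proof -
    let ?t = "1 / Suc n :: real"
    have tr: "(\<lambda>x. v (x + ?t *\<^sub>R ?e)) \<in> L2" by (rule L2_translate[OF v])
    note i1 = test_function_mult_integrable[OF \<eta> vl] test_function_mult_integrable[OF \<eta> L2_locally_integrable[OF tr]]
      test_function_mult_integrable[OF test_function_translate[OF \<eta>] vl]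
    have "(LINT x|lborel. \<eta> x *\<^sub>R (of_nat (Suc n) * (v (x + ?t *\<^sub>R ?e) - v x)))
        = of_nat (Suc n) * ((LINT x|lborel. \<eta> x *\<^sub>R v (x + ?t *\<^sub>R ?e)) - (LINT x|lborel. \<eta> x *\<^sub>R v x))"
      using i1 by (simp only: Bochner_Integration.integral_diff[symmetric] integral_mult_right_zero[symmetric])
        (simp add: scaleR_conv_of_real algebra_simps)
    also have "(LINT x|lborel. \<eta> x *\<^sub>R v (x + ?t *\<^sub>R ?e)) = (LINT x|lborel. \<eta> (x + (- ?t) *\<^sub>R ?e) *\<^sub>R v x)"
      using lborel_translate[of "\<lambda>x. \<eta> (x + (- ?t) *\<^sub>R ?e) *\<^sub>R v x" "?t *\<^sub>R ?e"] by simp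
    also have "of_nat (Suc n) * ((LINT x|lborel. \<eta> (x + (- ?t) *\<^sub>R ?e) *\<^sub>R v x) - (LINT x|lborel. \<eta> x *\<^sub>R v x)) = (LINT x|lborel. Q n x *\<^sub>R v x)"
      using i1 by (simp only: Bochner_Integration.integral_diff[symmetric] integral_mult_right_zero[symmetric])
        (simp add: Q_def scaleR_conv_of_real algebra_simps)
    finally show ?thesis .
  qed
  obtain M where M: "\<And>x. \<bar>partial_deriv i \<eta> x\<bar> \<le> M" using bounded_test_function[OF test_function_partial[OF \<eta>]] by blast
  obtain R where R: "\<And>x. \<eta> x \<noteq> 0 \<Longrightarrow> norm x \<le> R" using test_function_bounded[OF \<eta>] unfolding bounded_iff by auto
  \<comment> \<open>The mean value theorem bounds the quotient by \<open>M\<close>. The radius grows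
    by 1 because the shift 1/(n+1) is at most 1.\<close>
  have Qb: "\<bar>Q n x\<bar> \<le> M * indicator (cball 0 (R + 1)) x" for n x
  proof (cases "x \<in> cball 0 (R + 1)")
    case True
    have "norm (\<eta> (x + (- (1 / Suc n)) *\<^sub>R ?e) - \<eta> (x + 0 *\<^sub>R ?e)) \<le> M * norm (- (1 / real (Suc n)) - 0)"
      by (rule field_differentiable_bound[of UNIV "\<lambda>s. \<eta> (x + s *\<^sub>R ?e)"])
        (auto intro: DERIV_along_axis test_function_differentiable[OF \<eta>] M)
    then have "\<bar>\<eta> (x + (- (1 / Suc n)) *\<^sub>R ?e) - \<eta> x\<bar> \<le> M * (1 / real (Suc n))" by simp
    from mult_left_mono[OF this, of "real (Suc n)"]
    have "\<bar>Q n x\<bar> \<le> M" unfolding Q_def abs_mult by simp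
    then show ?thesis using True by simp
  next
    case False
    have "norm (x + (- (1 / Suc n)) *\<^sub>R ?e) \<ge> norm x - 1"
    proof -
      have "norm ((- (1 / real (Suc n))) *\<^sub>R ?e) \<le> 1" by simp
      then show ?thesis using norm_diff_ineq[of x "(- (1 / real (Suc n))) *\<^sub>R ?e"] by linarith
    qed
    then have "\<eta> (x + (- (1 / Suc n)) *\<^sub>R ?e) = 0" "\<eta> x = 0" using False R by force+
    then show ?thesis using False by (simp add: Q_def)
  qed
  have "(\<lambda>n. LINT x|lborel. Q n x *\<^sub>R v x) \<longlonglongrightarrow> (LINT x|lborel. - partial_deriv i \<eta> x *\<^sub>R v x)"
  proof (rule integral_dominated_convergence[where w="\<lambda>x. norm (M *\<^sub>R (indicator (cball 0 (R + 1)) x *\<^sub>R v x))"])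
    show "integrable lborel (\<lambda>x. norm (M *\<^sub>R (indicator (cball 0 (R + 1)) x *\<^sub>R v x)))"
      using vl compact_cball unfolding locally_integrable_def set_integrable_def
      by (intro integrable_norm integrable_scaleR_right) blast
    show "AE x in lborel. (\<lambda>n. Q n x *\<^sub>R v x) \<longlonglongrightarrow> - partial_deriv i \<eta> x *\<^sub>R v x"
    proof (intro AE_I2 tendsto_scaleR tendsto_const)
      fix x
      have "((\<lambda>s. \<eta> (x + s *\<^sub>R ?e)) has_real_derivative partial_deriv i \<eta> x) (at 0)"
        using DERIV_along_axis[of \<eta> x 0 i] test_function_differentiable[OF \<eta>] by simp
      then have lim: "((\<lambda>h. (\<eta> (x + h *\<^sub>R ?e) - \<eta> x) / h) \<longlongrightarrow> partial_deriv i \<eta> x) (at 0)"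
        by (simp add: has_field_derivative_iff)
      have "filterlim (\<lambda>n. - (1 / real (Suc n))) (at 0) sequentially"
        using tendsto_minus[OF LIMSEQ_inverse_real_of_nat[unfolded inverse_eq_divide]]
        by (intro filterlim_atI) (auto intro!: always_eventually)
      from filterlim_compose[OF lim this]
      have "(\<lambda>n. - Q n x) \<longlonglongrightarrow> partial_deriv i \<eta> x"
        by (simp add: Q_def field_simps)
      from tendsto_minus[OF this] show "(\<lambda>n. Q n x) \<longlonglongrightarrow> - partial_deriv i \<eta> x" by simp
    qed
    show "AE x in lborel. norm (Q n x *\<^sub>R v x) \<le> norm (M *\<^sub>R (indicator (cball 0 (R + 1)) x *\<^sub>R v x))" for n
      using Qb[of n] by (intro AE_I2) (simp only: norm_scaleR mult.assoc[symmetric] real_norm_def,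
        intro mult_right_mono norm_ge_zero, metis abs_ge_self abs_mult order_trans)
  qed measurable
  then show ?thesis unfolding eq by simp
qed

text \<open>The difference quotients \<open>g n\<close> are known only to be bounded in L2.
  Functions of nearly minimal norm in the sets \<open>C n\<close> form a Cauchy sequence, so they
  converge strongly; the defect \<open>E\<close> measures the failure to be a weak derivative of
  \<open>v\<close> and vanishes in the limit. The bound \<open>K\<close> survives because each
  \<open>g n\<close> competes in \<open>C n\<close>.\<close>

theorem weak_partial_of_translation_bound:
  fixes v :: "('n::finite) wavefun"
  assumes v: "v \<in> L2" and K: "\<And>t. L2_sq (\<lambda>x. v (x + t *\<^sub>R axis i 1) - v x) \<le> t\<^sup>2 * K"
  obtains g where "g \<in> L2" "has_weak_partial i v g" "L2_sq g \<le> K"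
proof -
  let ?e = "axis i 1 :: 'n point"
  define g where "g n x = of_nat (Suc n) * (v (x + (1 / Suc n) *\<^sub>R ?e) - v x)" for n x
  have gL: "g n \<in> L2" for n
    unfolding g_def[abs_def] by (intro L2_cmult L2_diff L2_translate v)
  have gK: "L2_sq (g n) \<le> K" for n
  proof -
    have "L2_sq (g n) = (real (Suc n))\<^sup>2 * L2_sq (\<lambda>x. v (x + (1 / Suc n) *\<^sub>R ?e) - v x)"
      unfolding g_def[abs_def] L2_sq_cmult by (simp only: norm_of_nat)
    also have "\<dots> \<le> (real (Suc n))\<^sup>2 * ((1 / Suc n)\<^sup>2 * K)" by (intro mult_left_mono K) auto
    finally show ?thesis by (simp add: power_divide)
  qed
  define E where "E \<eta> w = cmod ((LINT x|lborel. \<eta> x *\<^sub>R w x) + (LINT x|lborel. partial_deriv i \<eta> x *\<^sub>R v x))" for \<eta> w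
  \<comment> \<open>\<open>C n\<close> contains the difference quotients \<open>g k\<close> with \<open>k \<ge> n\<close>, is closed under midpoints, and shrinks to the weak derivatives of \<open>v\<close>.\<close>
  define C where "C n = {w \<in> L2. \<forall>\<eta> \<epsilon>. test_function \<eta> \<longrightarrow> (\<forall>k\<ge>n. E \<eta> (g k) \<le> \<epsilon>) \<longrightarrow> E \<eta> w \<le> \<epsilon>}" for n
  have Eg: "(\<lambda>k. E \<eta> (g k)) \<longlonglongrightarrow> 0" if "test_function \<eta>" for \<eta>
  proof -
    have "(\<lambda>k. (LINT x|lborel. \<eta> x *\<^sub>R g k x) + (LINT x|lborel. partial_deriv i \<eta> x *\<^sub>R v x)) \<longlonglongrightarrow>
        - (LINT x|lborel. partial_deriv i \<eta> x *\<^sub>R v x) + (LINT x|lborel. partial_deriv i \<eta> x *\<^sub>R v x)"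
      unfolding g_def by (intro tendsto_add tendsto_const test_function_difference_quotient that v)
    from tendsto_norm[OF this] show ?thesis by (simp add: E_def)
  qed
  have CL: "w \<in> L2" if "w \<in> C n" for w n using that by (simp add: C_def)
  have mid: "(\<lambda>z. (x z + y z) / 2) \<in> C n" if xy: "x \<in> C n" "y \<in> C n" for n x y
  proof -
    have "E \<eta> (\<lambda>z. (x z + y z) / 2) \<le> \<epsilon>" if \<eta>: "test_function \<eta>" and e: "\<forall>k\<ge>n. E \<eta> (g k) \<le> \<epsilon>" for \<eta> \<epsilon>
    proof -
      let ?I = "\<lambda>w. LINT x|lborel. \<eta> x *\<^sub>R w x" and ?P = "LINT x|lborel. partial_deriv i \<eta> x *\<^sub>R v x"
      have i: "integrable lborel (\<lambda>z. \<eta> z *\<^sub>R x z)" "integrable lborel (\<lambda>z. \<eta> z *\<^sub>R y z)"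
        using CL xy by (auto intro!: test_function_mult_integrable \<eta> L2_locally_integrable)
      have "?I (\<lambda>z. (x z + y z) / 2) = (?I x + ?I y) / 2"
      proof -
        have "\<eta> z *\<^sub>R ((x z + y z) / 2) = (\<eta> z *\<^sub>R x z + \<eta> z *\<^sub>R y z) / 2" for z
          by (simp add: scaleR_conv_of_real algebra_simps)
        then show ?thesis using i by (simp only: integral_divide_zero Bochner_Integration.integral_add)
      qed
      then have "?I (\<lambda>z. (x z + y z) / 2) + ?P = ((?I x + ?P) + (?I y + ?P)) / 2" by (simp add: field_simps)
      then have "E \<eta> (\<lambda>z. (x z + y z) / 2) \<le> (E \<eta> x + E \<eta> y) / 2"
        unfolding E_def using norm_triangle_ineq[of "?I x + ?P" "?I y + ?P"] by (simp only: norm_divide) simp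
      moreover have "E \<eta> x \<le> \<epsilon>" "E \<eta> y \<le> \<epsilon>" using xy \<eta> e by (auto simp: C_def)
      ultimately show ?thesis by simp
    qed
    then show ?thesis using L2_midpoint xy by (auto simp: C_def)
  qed
  obtain h d D where h: "\<And>n. h n \<in> C n" "\<And>n. L2_sq (h n) \<le> d n + 1 / Suc n" "\<And>n x. x \<in> C n \<Longrightarrow> d n \<le> L2_sq x"
    and C: "\<And>e. e > 0 \<Longrightarrow> \<exists>N. \<forall>m\<ge>N. \<forall>n\<ge>N. L2_sq (\<lambda>x. h m x - h n x) \<le> e"
  proof (rule parallelogram_minimizers_Cauchy[of C "\<lambda>x y z. (x z + y z) / 2" L2_sq "\<lambda>x y. L2_sq (\<lambda>z. x z - y z)" K])
    show "C n \<subseteq> C m" if "m \<le> n" for m n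
      using that unfolding C_def by (auto dest: order_trans)
    show "\<exists>x\<in>C n. L2_sq x \<le> K" for n
      using gL gK by (intro bexI[of _ "g n"]) (auto simp: C_def)
    show "4 * L2_sq (\<lambda>z. (x z + y z) / 2) + L2_sq (\<lambda>z. x z - y z) = 2 * L2_sq x + 2 * L2_sq y"
      if "x \<in> C 0" "y \<in> C 0" for x y
      by (rule L2_sq_parallelogram[OF CL[OF that(1)] CL[OF that(2)]])
  qed (use mid in auto)
  have hL: "h n \<in> L2" for n using h CL by blast
  obtain f where f: "f \<in> L2" "(\<lambda>n. L2_sq (\<lambda>x. h n x - f x)) \<longlonglongrightarrow> 0"
    using L2_complete[OF hL C] by blast
  have "L2_sq f \<le> K"
  proof (rule LIMSEQ_le[OF L2_sq_tendsto[OF hL f]])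
    show "(\<lambda>n. K + 1 / Suc n) \<longlonglongrightarrow> K"
      using tendsto_add[OF tendsto_const LIMSEQ_inverse_real_of_nat[unfolded inverse_eq_divide], of K] by simp
    have "g n \<in> C n" for n using gL by (auto simp: C_def)
    then have "d n \<le> K" for n using h(3)[of "g n" n] gK[of n] by fastforce
    then show "\<exists>N. \<forall>n\<ge>N. L2_sq (h n) \<le> K + 1 / Suc n" using h(2) by (meson add_right_mono order_trans)
  qed
  moreover have "has_weak_partial i v f"
    unfolding has_weak_partial_def
  proof (intro conjI allI impI L2_locally_integrable v f(1))
    fix \<eta> :: "'n point \<Rightarrow> real" assume \<eta>: "test_function \<eta>"
    have "(\<lambda>n. E \<eta> (h n)) \<longlonglongrightarrow> E \<eta> f"
      unfolding E_def by (intro tendsto_intros L2_tendsto_integral[OF \<eta> hL f])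
    moreover have "(\<lambda>n. E \<eta> (h n)) \<longlonglongrightarrow> 0"
    proof (rule LIMSEQ_I)
      fix r :: real assume "r > 0"
      then obtain N where N: "\<And>k. k \<ge> N \<Longrightarrow> E \<eta> (g k) < r / 2"
        using order_tendstoD(2)[OF Eg[OF \<eta>], of "r / 2"] by (auto simp: eventually_sequentially)
      have "E \<eta> (h n) \<le> r / 2" if "n \<ge> N" for n
      proof -
        have "\<forall>k\<ge>n. E \<eta> (g k) \<le> r / 2" using N that by (meson less_imp_le order_trans)
        then show ?thesis using h(1)[of n] \<eta> unfolding C_def by blast
      qed
      then show "\<exists>no. \<forall>n\<ge>no. norm (E \<eta> (h n) - 0) < r" using \<open>r > 0\<close>
        by (intro exI[of _ N]) (force simp: E_def)
    qed
    ultimately have "E \<eta> f = 0" by (rule LIMSEQ_unique)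
    then show "(LINT x|lborel. partial_deriv i \<eta> x *\<^sub>R v x) = - (LINT x|lborel. \<eta> x *\<^sub>R f x)"
      by (simp add: E_def eq_neg_iff_add_eq_0 add.commute)
  qed
  ultimately show ?thesis using f(1) that by blast
qed

section \<open>Gauge transformations and the modulus\<close>

lemma sin_cos_Ck: assumes "\<And>k. Ck k p" shows "Ck k (\<lambda>x. cos (p x))" "Ck k (\<lambda>x. sin (p x))"
proof -
  \<comment> \<open>Differentiating a cosine shifts its phase by pi/2, so these functions form a
    derivative sequence as in \<open>Ck_chain\<close>. Index 0 is the cosine, index 3 the
    sine.\<close>
  let ?h = "\<lambda>m t. cos (t + real m * (pi / 2))"
  have h: "(?h m has_real_derivative ?h (Suc m) t) (at t)" for m t
  proof -
    have "?h (Suc m) t = - sin (t + real m * (pi / 2))"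
    proof -
      have "t + real (Suc m) * (pi / 2) = (t + real m * (pi / 2)) + pi / 2" by (simp add: algebra_simps)
      then show ?thesis by (simp only: cos_add[of "t + real m * (pi / 2)"]) simp
    qed
    then show ?thesis by (auto intro!: derivative_eq_intros)
  qed
  show "Ck k (\<lambda>x. cos (p x))" using Ck_chain[of ?h p k 0, OF h assms] by simp
  have "cos (t + 3 * (pi / 2)) = sin t" for t
    using cos_add[of "t + pi" "pi / 2"] by (simp add: algebra_simps)
  then show "Ck k (\<lambda>x. sin (p x))" using Ck_chain[of ?h p k 3, OF h assms] by simp
qed

lemma partial_deriv_sin_cos:
  assumes "p differentiable (at x)"
  shows "partial_deriv i (\<lambda>x. cos (p x)) x = - sin (p x) * partial_deriv i p x"
    "partial_deriv i (\<lambda>x. sin (p x)) x = cos (p x) * partial_deriv i p x"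
proof -
  have p: "(p has_derivative frechet_derivative p (at x)) (at x)" using assms by (simp add: frechet_derivative_works)
  show "partial_deriv i (\<lambda>x. cos (p x)) x = - sin (p x) * partial_deriv i p x"
    using partial_deriv_eq[OF DERIV_compose_FDERIV[OF DERIV_cos p]] by (simp add: partial_deriv_def mult.commute)
  show "partial_deriv i (\<lambda>x. sin (p x)) x = cos (p x) * partial_deriv i p x"
    using partial_deriv_eq[OF DERIV_compose_FDERIV[OF DERIV_sin p]] by (simp add: partial_deriv_def mult.commute)
qed

text \<open>The weak product rule is available for real multipliers, so the phase factor is split
  into its cosine and sine parts.\<close>

lemma has_weak_partial_gauge:
  fixes u :: "('n::finite) wavefun"
  assumes u: "has_weak_partial i u g" and p: "\<And>k. Ck k p"
  shows "has_weak_partial i (\<lambda>x. cis (- p x) * u x) (\<lambda>x. cis (- p x) * (g x - \<i> * of_real (partial_deriv i p x) * u x))"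
proof -
  have d: "p differentiable (at x)" for x using p[of "Suc 0"] by simp
  have c: "cis (- t) = of_real (cos t) + (- \<i>) * of_real (sin t)" for t by (simp add: complex_eq_iff)
  note ca = has_weak_partial_mult_smooth[OF u sin_cos_Ck(1)[OF p]]
  note sa = has_weak_partial_mult_smooth[OF u sin_cos_Ck(2)[OF p]]
  note r = has_weak_partial_add[OF ca has_weak_partial_cmult[OF sa, of "- \<i>"]]
  have e1: "of_real (cos (p x)) * u x + - \<i> * (of_real (sin (p x)) * u x) = cis (- p x) * u x" for x
    unfolding c by (simp add: algebra_simps)
  have e2: "of_real (cos (p x)) * g x + of_real (partial_deriv i (\<lambda>x. cos (p x)) x) * u x
      + - \<i> * (of_real (sin (p x)) * g x + of_real (partial_deriv i (\<lambda>x. sin (p x)) x) * u x)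
      = cis (- p x) * (g x - \<i> * of_real (partial_deriv i p x) * u x)" for x
    unfolding c partial_deriv_sin_cos[OF d] by (simp add: algebra_simps)
  show ?thesis using r unfolding e1 e2 .
qed

text \<open>The gauged function has the same modulus as \<open>u\<close>, and ||a| - |b|| <= |a -
  b|, so translates of |u| differ no more than translates of the gauged function, whose weak
  derivative has the modulus of the covariant one. The translation bound then produces a derivative
  of |u|, without any formula for it. Only the direction \<open>i\<close> occurs, so
  \<open>p\<close> has to match a single component of a vector potential.\<close>

theorem diamagnetic:
  fixes u :: "('n::finite) wavefun"
  assumes u: "u \<in> L2" "has_weak_partial i u g" and p: "\<And>k. Ck k p"
    and G: "(\<lambda>x. g x - \<i> * of_real (partial_deriv i p x) * u x) \<in> L2"
  obtains k where "k \<in> L2" "has_weak_partial i (\<lambda>x. of_real (cmod (u x))) k"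
    "L2_sq k \<le> L2_sq (\<lambda>x. g x - \<i> * of_real (partial_deriv i p x) * u x)"
proof -
  let ?G = "\<lambda>x. g x - \<i> * of_real (partial_deriv i p x) * u x"
  let ?c = "\<lambda>x. cis (- p x)"
  have "continuous_on UNIV p" using p[of 0] by simp
  then have "continuous_on UNIV ?c" unfolding cis_conv_exp by (intro continuous_intros)
  then have cm: "?c \<in> borel_measurable borel" by (rule borel_measurable_continuous_onI)
  have U: "(\<lambda>x. ?c x * u x) \<in> L2" "(\<lambda>x. ?c x * ?G x) \<in> L2"
    by (rule L2_mult_bounded(1)[OF _ cm, of _ 1]; simp add: u G)+
  have GG: "L2_sq (\<lambda>x. ?c x * ?G x) = L2_sq ?G" by (simp add: L2_sq_def norm_mult)
  have "L2_sq (\<lambda>x. of_real (cmod (u (x + t *\<^sub>R axis i 1))) - of_real (cmod (u x))) \<le> t\<^sup>2 * L2_sq ?G" for t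
  proof -
    have D: "(\<lambda>x. ?c (x + t *\<^sub>R axis i 1) * u (x + t *\<^sub>R axis i 1) - ?c x * u x) \<in> L2"
      by (intro L2_diff L2_translate[OF U(1)] U)
    have "L2_sq (\<lambda>x. of_real (cmod (u (x + t *\<^sub>R axis i 1))) - of_real (cmod (u x)))
        \<le> L2_sq (\<lambda>x. ?c (x + t *\<^sub>R axis i 1) * u (x + t *\<^sub>R axis i 1) - ?c x * u x)"
      unfolding L2_sq_def
    proof (rule integral_mono)
      show "integrable lborel (\<lambda>x. (cmod (of_real (cmod (u (x + t *\<^sub>R axis i 1))) - of_real (cmod (u x))))\<^sup>2)"
        by (intro L2_integrable L2_diff L2_cmod L2_translate u)
      show "(cmod (of_real (cmod (u (x + t *\<^sub>R axis i 1))) - of_real (cmod (u x))))\<^sup>2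
          \<le> (cmod (?c (x + t *\<^sub>R axis i 1) * u (x + t *\<^sub>R axis i 1) - ?c x * u x))\<^sup>2" for x
        using norm_triangle_ineq3[of "?c (x + t *\<^sub>R axis i 1) * u (x + t *\<^sub>R axis i 1)" "?c x * u x"]
        by (intro power_mono) (simp_all add: norm_mult flip: of_real_diff)
    qed (rule L2_integrable[OF D])
    also have "\<dots> \<le> t\<^sup>2 * L2_sq (\<lambda>x. ?c x * ?G x)"
      by (rule weak_partial_translate_bound[OF has_weak_partial_gauge[OF u(2) p] U])
    finally show ?thesis unfolding GG .
  qed
  from weak_partial_of_translation_bound[OF L2_cmod[OF u(1)] this] that show ?thesis by blast
qed

lemma H1_translation_bounded:
  fixes u :: "('n::finite) wavefun"
  assumes w: "\<And>i. has_weak_partial i u (g i)" and u: "u \<in> L2" and g: "\<And>i. g i \<in> L2"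
    and A: "real CARD('n) * (\<Sum>i\<in>UNIV. L2_sq (g i)) \<le> A"
  shows "translation_bounded A u"
  unfolding translation_bounded_def
proof (intro conjI allI impI u)
  fix r :: real and z :: "'n point" assume r: "0 \<le> r" "\<forall>i. \<bar>z $ i\<bar> \<le> r"
  have "sqrt (L2_sq (\<lambda>x. u (x + z) - u x)) \<le> (\<Sum>i\<in>UNIV. \<bar>z $ i\<bar> * sqrt (L2_sq (g i)))"
    by (rule H1_translate_bound[OF w u g])
  also have "\<dots> \<le> (\<Sum>i\<in>UNIV. r * sqrt (L2_sq (g i)))"
    using r by (intro sum_mono mult_right_mono) auto
  finally have "(sqrt (L2_sq (\<lambda>x. u (x + z) - u x)))\<^sup>2 \<le> (\<Sum>i\<in>UNIV. r * sqrt (L2_sq (g i)))\<^sup>2"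
    by (rule power_mono) simp
  also have "\<dots> = r\<^sup>2 * (\<Sum>i\<in>UNIV. sqrt (L2_sq (g i)))\<^sup>2"
    by (simp add: sum_distrib_left[symmetric] power_mult_distrib)
  also have "(\<Sum>i\<in>UNIV. sqrt (L2_sq (g i)))\<^sup>2 \<le> real CARD('n) * (\<Sum>i\<in>UNIV. (sqrt (L2_sq (g i)))\<^sup>2)"
    using sum_squared_le_sum_of_squares[of "\<lambda>i. sqrt (L2_sq (g i))" UNIV] by (simp add: mult.commute)
  also have "\<dots> \<le> A" using A by simp
  finally show "L2_sq (\<lambda>x. u (x + z) - u x) \<le> r\<^sup>2 * A" by (simp add: mult_left_mono)
qed

text \<open>Clearing the denominator extends the inequality to functions vanishing almost
  everywhere, which the infimum excludes. For the others the fourth power must be known to be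
  integrable, as otherwise its Bochner integral would be 0; this is supplied by the L4
  embedding.\<close>

lemma C\<^sub>b_inequality:
  fixes f :: "2 wavefun"
  assumes f: "f \<in> L2" and w: "\<And>i. has_weak_partial i f (g i)" and g: "\<And>i. g i \<in> L2"
  shows "C\<^sub>b * (LINT x|lborel. cmod (f x) ^ 4) \<le> (\<Sum>i\<in>UNIV. L2_sq (g i)) * L2_sq f"
proof (cases "AE x in lborel. f x = 0")
  case True
  then have "(LINT x|lborel. cmod (f x) ^ 4) = 0"
    by (intro integral_eq_zero_AE) (auto elim: eventually_mono)
  then show ?thesis by (simp add: sum_nonneg)
next
  case False
  note [measurable] = L2_measurable[OF f]
  have H: "f \<in> H1" and ae: "AE x in lborel. \<forall>i. weak_partial i f x = g i x"
    using H1I[OF f g w] by auto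
  have tb: "translation_bounded (real CARD(2) * (\<Sum>i\<in>UNIV. L2_sq (g i))) f"
    by (rule H1_translation_bounded[OF w f g order_refl])
  have i4: "integrable lborel (\<lambda>x. cmod (f x) ^ 4)" by (rule L4_embedding(1)[OF tb]) simp
  have pos: "(LINT x|lborel. cmod (f x) ^ 4) > 0"
  proof -
    have "(LINT x|lborel. cmod (f x) ^ 4) \<noteq> 0"
    proof
      assume "(LINT x|lborel. cmod (f x) ^ 4) = 0"
      then have "AE x in lborel. cmod (f x) ^ 4 = 0" by (subst (asm) integral_nonneg_eq_0_iff_AE[OF i4]) auto
      with False show False by simp
    qed
    then show ?thesis by (simp add: less_le)
  qed
  have gs: "(LINT x|lborel. grad_sq f x) = (\<Sum>i\<in>UNIV. L2_sq (g i))"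
  proof -
    have "(LINT x|lborel. grad_sq f x) = (LINT x|lborel. (\<Sum>i\<in>UNIV. (cmod (g i x))\<^sup>2))"
    proof (rule integral_cong_AE)
      note [measurable] = L2_measurable[OF H1_weak_partial(2)[OF H]] L2_measurable[OF g]
      show "grad_sq f \<in> borel_measurable lborel" unfolding grad_sq_def[abs_def] by measurable
      show "(\<lambda>x. \<Sum>i\<in>UNIV. (cmod (g i x))\<^sup>2) \<in> borel_measurable lborel" by measurable
      show "AE x in lborel. grad_sq f x = (\<Sum>i\<in>UNIV. (cmod (g i x))\<^sup>2)"
        using ae by eventually_elim (simp add: grad_sq_def)
    qed
    also have "\<dots> = (\<Sum>i\<in>UNIV. L2_sq (g i))" unfolding L2_sq_def
      by (rule Bochner_Integration.integral_sum) (rule L2_integrable[OF g])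
    finally show ?thesis .
  qed
  have "C\<^sub>b \<le> (LINT x|lborel. grad_sq f x) * (LINT x|lborel. (cmod (f x))\<^sup>2) / (LINT x|lborel. (cmod (f x))^4)"
    unfolding C\<^sub>b_def
  proof (rule cINF_lower)
    show "bdd_below ((\<lambda>f. (LINT x|lborel. grad_sq f x) * (LINT x|lborel. (cmod (f x))\<^sup>2) / (LINT x|lborel. (cmod (f x))^4)) `
        {f \<in> H1 :: 2 wavefun set. \<not> (AE x in lborel. f x = 0)})"
      by (rule bdd_belowI[of _ 0])
        (auto intro!: divide_nonneg_nonneg mult_nonneg_nonneg integral_nonneg_AE simp: grad_sq_def sum_nonneg)
    show "f \<in> {f \<in> H1. \<not> (AE x in lborel. f x = 0)}" using H False by simp
  qed
  then show ?thesis using pos by (simp add: gs L2_sq_def pos_le_divide_eq)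
qed

subsection \<open>Pointwise estimates for the energy density\<close>

definition vector_potential :: "real \<Rightarrow> 'n \<Rightarrow> ('n::{finite,numeral}) point \<Rightarrow> real" where
  "vector_potential \<Omega> i x = (if i = 1 then - \<Omega> * x $ 2 else if i = 2 then \<Omega> * x $ 1 else 0)"

lemma abs_vector_potential_le: "\<bar>vector_potential \<Omega> i x\<bar> \<le> \<bar>\<Omega>\<bar> * norm x"
  by (auto simp: vector_potential_def abs_mult component_le_norm_cart intro!: mult_left_mono)

text \<open>The function -\<Omega> x y serves the first direction, \<Omega> x y the second and 0 any
  other. The opposite signs reflect that the whole field is not a gradient for nonzero
  \<Omega>.\<close>

lemma vector_potential_gauge:
  fixes i :: "'n::{finite,numeral}"
  assumes "(1::'n) \<noteq> 2"
  obtains p :: "'n point \<Rightarrow> real" where "\<And>k. Ck k p" "\<And>x. partial_deriv i p x = vector_potential \<Omega> i x"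
proof -
  have C: "Ck k (\<lambda>x::'n point. a * (x $ 1 * x $ 2))" for a k
    by (intro Ck_mult Ck_const Ck_coord)
  have D: "partial_deriv i (\<lambda>x::'n point. a * (x $ 1 * x $ 2)) x
      = a * (x $ 1 * axis i 1 $ 2 + axis i 1 $ 1 * x $ 2)" for a x
  proof (rule partial_deriv_eq)
    show "((\<lambda>x::'n point. a * (x $ 1 * x $ 2)) has_derivative (\<lambda>h. a * (x $ 1 * h $ 2 + h $ 1 * x $ 2))) (at x)"
      by (auto intro!: derivative_eq_intros bounded_linear_imp_has_derivative)
  qed
  consider "i = 1" | "i = 2" "i \<noteq> 1" | "i \<noteq> 1" "i \<noteq> 2" by blast
  then show ?thesis
  proof cases
    case 1
    show ?thesis by (rule that[OF C, of "- \<Omega>"]) (use 1 assms D[of "- \<Omega>"] in \<open>simp add: axis_def vector_potential_def\<close>)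
  next
    case 2
    show ?thesis by (rule that[OF C, of "\<Omega>"]) (use 2 assms D[of \<Omega>] in \<open>simp add: axis_def vector_potential_def\<close>)
  next
    case 3
    show ?thesis by (rule that[OF C, of "0"]) (use 3 assms D[of 0] in \<open>simp add: vector_potential_def\<close>)
  qed
qed

text \<open>
  Pointwise, the components of a spinor are \<open>\<phi> 1\<close>, \<open>\<phi> 2\<close>, \<open>\<phi> 3\<close> (for $\phi_1$, $\phi_0$, $\phi_{-1}$),
  and \<open>p j i\<close> is the derivative of component \<open>j\<close> in direction \<open>i\<close>.
\<close>

definition magnetic_sq :: "real \<Rightarrow> (3 \<Rightarrow> complex) \<Rightarrow> (3 \<Rightarrow> 'n \<Rightarrow> complex) \<Rightarrow> ('n::{finite,numeral}) point \<Rightarrow> real" where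
  "magnetic_sq \<Omega> \<phi> p x = (\<Sum>j\<in>UNIV. \<Sum>i\<in>UNIV. (cmod (p j i - \<i> * of_real (vector_potential \<Omega> i x) * \<phi> j))\<^sup>2)"

definition mass :: "(3 \<Rightarrow> complex) \<Rightarrow> real" where
  "mass \<phi> = (\<Sum>j\<in>UNIV. (cmod (\<phi> j))\<^sup>2)"

definition spin_orbit_form :: "(3 \<Rightarrow> complex) \<Rightarrow> (3 \<Rightarrow> 'n \<Rightarrow> complex) \<Rightarrow> 'n::{finite,numeral} itself \<Rightarrow> complex" where
  "spin_orbit_form \<phi> p _ = cnj (\<phi> 1) * (\<i> * p 2 1 + p 2 2)
     + cnj (\<phi> 2) * ((\<i> * p 3 1 + p 3 2) + (\<i> * p 1 1 - p 1 2)) + cnj (\<phi> 3) * (\<i> * p 2 1 - p 2 2)"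

text \<open>Part of the energy density quadratic in the spinor, after completing the square. On
  states of mass one the shift \<open>K\<close> only adds a constant to the energy; it is chosen
  large enough to absorb the spin-orbit term.\<close>

definition quadratic_density ::
  "('n point \<Rightarrow> real) \<Rightarrow> real \<Rightarrow> real \<Rightarrow> real \<Rightarrow> (3 \<Rightarrow> complex) \<Rightarrow> (3 \<Rightarrow> 'n \<Rightarrow> complex) \<Rightarrow> ('n::{finite,numeral}) point \<Rightarrow> real" where
  "quadratic_density V \<Omega> \<gamma> K \<phi> p x = 1/2 * magnetic_sq \<Omega> \<phi> p x
     + (V x - \<Omega>\<^sup>2 / 2 * ((x $ 1)\<^sup>2 + (x $ 2)\<^sup>2) + K) * mass \<phi> - \<gamma> * Re (spin_orbit_form \<phi> p TYPE('n))"

text \<open>The spin density at a point depends only on the values there, so \<open>spin_sq\<close>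
  is evaluated on constant spinors over a one-dimensional space. This makes the interaction a
  function of three complex numbers.\<close>

definition interaction :: "real \<Rightarrow> real \<Rightarrow> (3 \<Rightarrow> complex) \<Rightarrow> real" where
  "interaction c\<^sub>0 c\<^sub>1 \<phi> = c\<^sub>0 / 2 * (mass \<phi>)\<^sup>2 + c\<^sub>1 / 2 * spin_sq (\<lambda>_. \<phi> 1, \<lambda>_. \<phi> 2, \<lambda>_. \<phi> 3) (0 :: 1 point)"

section \<open>Completing the square, the spin identity and coercivity\<close>

lemma mass_nonneg: "0 \<le> mass \<phi>" by (simp add: mass_def sum_nonneg)

lemma magnetic_sq_nonneg: "0 \<le> magnetic_sq \<Omega> \<phi> p x" by (simp add: magnetic_sq_def sum_nonneg)

lemma cmod_le_mass: "(cmod (\<phi> j))\<^sup>2 \<le> mass \<phi>"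
  unfolding mass_def by (rule member_le_sum) auto

lemma sum_pair_delta:
  assumes "(1::'n::{finite,numeral}) \<noteq> 2" "\<And>i. i \<noteq> 1 \<Longrightarrow> i \<noteq> 2 \<Longrightarrow> f i = 0"
  shows "(\<Sum>i\<in>(UNIV::'n set). f i) = f 1 + (f 2 :: real)"
proof -
  have "(\<Sum>i\<in>(UNIV::'n set). f i) = (\<Sum>i\<in>{1,2}. f i)"
    by (rule sum.mono_neutral_right) (use assms in auto)
  then show ?thesis using assms(1) by simp
qed

text \<open>The cross term of |p - iAf|^2 is the real part of the rotation term, and the term |A|^2
  |f|^2 is compensated by the centrifugal potential. The identity is pointwise, but only for real
  parts.\<close>

lemma magnetic_square_expand:
  fixes p :: "'n::{finite,numeral} \<Rightarrow> complex" and x :: "'n point"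
  assumes "(1::'n) \<noteq> 2"
  shows "1/2 * (\<Sum>i\<in>UNIV. (cmod (p i - \<i> * of_real (vector_potential \<Omega> i x) * f))\<^sup>2)
     + (v - \<Omega>\<^sup>2 / 2 * ((x $ 1)\<^sup>2 + (x $ 2)\<^sup>2)) * (cmod f)\<^sup>2
   = Re (of_real (1/2 * (\<Sum>i\<in>UNIV. (cmod (p i))\<^sup>2) + v * (cmod f)\<^sup>2)
      - of_real \<Omega> * cnj f * (- \<i> * (of_real (x $ 1) * p 2 - of_real (x $ 2) * p 1)))"
proof -
  let ?A = "\<lambda>i. vector_potential \<Omega> i x"
  let ?d = "\<lambda>i. (?A i)\<^sup>2 * (cmod f)\<^sup>2 - 2 * ?A i * Re (cnj (p i) * (\<i> * f))"
  have sq: "(cmod (p i - \<i> * of_real (?A i) * f))\<^sup>2 = (cmod (p i))\<^sup>2 + ?d i" for i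
    unfolding cmod_power2 by (simp add: power2_eq_square algebra_simps)
  have "(\<Sum>i\<in>UNIV. ?d i) = ?d 1 + ?d 2"
    by (rule sum_pair_delta[OF assms]) (simp add: vector_potential_def)
  then show ?thesis
    unfolding sq sum.distrib using assms[symmetric]
    by (simp add: vector_potential_def cmod_power2 power2_eq_square algebra_simps)
qed

lemma energy_density_eq:
  fixes x :: "'n::{finite,numeral} point" and \<Phi> :: "3 \<Rightarrow> 'n wavefun"
  assumes "(1::'n) \<noteq> 2"
  shows "Re (energy_density V c\<^sub>0 c\<^sub>1 \<Omega> \<gamma> (\<Phi> 1, \<Phi> 2, \<Phi> 3) x)
    = quadratic_density V \<Omega> \<gamma> 0 (\<lambda>j. \<Phi> j x) (\<lambda>j i. weak_partial i (\<Phi> j) x) x + interaction c\<^sub>0 c\<^sub>1 (\<lambda>j. \<Phi> j x)"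
proof -
  have single: "Re (single_energy_density V \<Omega> (\<Phi> j) x)
     = 1/2 * (\<Sum>i\<in>UNIV. (cmod (weak_partial i (\<Phi> j) x - \<i> * of_real (vector_potential \<Omega> i x) * \<Phi> j x))\<^sup>2)
     + (V x - \<Omega>\<^sup>2 / 2 * ((x $ 1)\<^sup>2 + (x $ 2)\<^sup>2)) * (cmod (\<Phi> j x))\<^sup>2" for j
    unfolding magnetic_square_expand[OF assms] single_energy_density_def angular_momentum_def grad_sq_def ..
  have spin: "spin_sq (\<Phi> 1, \<Phi> 2, \<Phi> 3) x = spin_sq (\<lambda>_. \<Phi> 1 x, \<lambda>_. \<Phi> 2 x, \<lambda>_. \<Phi> 3 x) (0 :: 1 point)"
    by (simp add: spin_sq_def)
  have so: "spin_orbit (\<Phi> 1, \<Phi> 2, \<Phi> 3) x = spin_orbit_form (\<lambda>j. \<Phi> j x) (\<lambda>j i. weak_partial i (\<Phi> j) x) TYPE('n)"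
    by (simp add: spin_orbit_form_def L\<^sub>0_def L\<^sub>1_def)
  show ?thesis
    unfolding energy_density.simps spin so
    by (simp add: single quadratic_density_def magnetic_sq_def interaction_def mass_def sum_3 algebra_simps)
qed

text \<open>The difference of rho^2 and |F|^2 is the squared modulus of the singlet pair amplitude
  phi_0^2 - 2 phi_1 phi_{-1}. Hence 0 <= |F|^2 <= rho^2.\<close>

lemma spin_sq_identity:
  "spin_sq (\<lambda>_. a, \<lambda>_. b, \<lambda>_. c) x + (cmod (b\<^sup>2 - 2 * a * c))\<^sup>2 = ((cmod a)\<^sup>2 + (cmod b)\<^sup>2 + (cmod c)\<^sup>2)\<^sup>2"
proof -
  have s: "(cmod (1 / of_real (sqrt 2) * X))\<^sup>2 = (cmod X)\<^sup>2 / 2" "(cmod (\<i> / of_real (sqrt 2) * X))\<^sup>2 = (cmod X)\<^sup>2 / 2" for X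
    by (simp_all add: norm_mult norm_divide power_mult_distrib power_divide)
  show ?thesis
    unfolding spin_sq_def F\<^sub>x.simps F\<^sub>y.simps F\<^sub>z.simps s cmod_power2
    by (simp add: power2_eq_square field_simps)
qed

lemma mass_3: "mass \<phi> = (cmod (\<phi> 1))\<^sup>2 + (cmod (\<phi> 2))\<^sup>2 + (cmod (\<phi> 3))\<^sup>2"
  by (simp add: mass_def sum_3)

text \<open>With m = rho^2 and S = |F|^2, the sum \<open>c\<^sub>0\<close> m +
  \<open>c\<^sub>1\<close> S equals \<open>c\<^sub>0\<close> (m - S) +
  (\<open>c\<^sub>0 + c\<^sub>1\<close>) S, where both weights are nonnegative. The lower bound
  therefore depends only on \<open>c\<^sub>0\<close> and
  \<open>c\<^sub>0 + c\<^sub>1\<close>.\<close>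

lemma interaction_bounds:
  shows "\<bar>interaction c\<^sub>0 c\<^sub>1 \<phi>\<bar> \<le> (\<bar>c\<^sub>0\<bar> + \<bar>c\<^sub>1\<bar>) * (mass \<phi>)\<^sup>2"
    and "\<lbrakk>- \<beta> \<le> c\<^sub>0; - \<beta> \<le> c\<^sub>0 + c\<^sub>1\<rbrakk> \<Longrightarrow> - (\<beta> / 2) * (mass \<phi>)\<^sup>2 \<le> interaction c\<^sub>0 c\<^sub>1 \<phi>"
proof -
  define S where "S = spin_sq (\<lambda>_. \<phi> 1, \<lambda>_. \<phi> 2, \<lambda>_. \<phi> 3) (0 :: 1 point)"
  define m where "m = (mass \<phi>)\<^sup>2"
  have S: "0 \<le> S" "S \<le> m"
    using spin_sq_identity[of "\<phi> 1" "\<phi> 2" "\<phi> 3" "0 :: 1 point"] zero_le_power2[of "cmod ((\<phi> 2)\<^sup>2 - 2 * \<phi> 1 * \<phi> 3)"]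
    unfolding S_def m_def mass_3 by (simp add: spin_sq_def, linarith)
  have I: "interaction c\<^sub>0 c\<^sub>1 \<phi> = c\<^sub>0 / 2 * m + c\<^sub>1 / 2 * S"
    by (simp add: interaction_def S_def m_def)
  have m: "0 \<le> m" using S by simp
  have "\<bar>c\<^sub>0 / 2 * m\<bar> = \<bar>c\<^sub>0\<bar> * m / 2" "\<bar>c\<^sub>1 / 2 * S\<bar> = \<bar>c\<^sub>1\<bar> * S / 2"
    using S m by (simp_all add: abs_mult)
  moreover have "0 \<le> \<bar>c\<^sub>0\<bar> * m" "0 \<le> \<bar>c\<^sub>1\<bar> * m" by (intro mult_nonneg_nonneg abs_ge_zero m)+
  moreover have "\<bar>c\<^sub>1\<bar> * S \<le> \<bar>c\<^sub>1\<bar> * m" by (intro mult_left_mono S abs_ge_zero)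
  ultimately have "\<bar>c\<^sub>0 / 2 * m\<bar> \<le> \<bar>c\<^sub>0\<bar> * m" "\<bar>c\<^sub>1 / 2 * S\<bar> \<le> \<bar>c\<^sub>1\<bar> * m"
    by linarith+
  then show "\<bar>interaction c\<^sub>0 c\<^sub>1 \<phi>\<bar> \<le> (\<bar>c\<^sub>0\<bar> + \<bar>c\<^sub>1\<bar>) * (mass \<phi>)\<^sup>2"
    unfolding I m_def[symmetric] distrib_right by linarith
  assume b: "- \<beta> \<le> c\<^sub>0" "- \<beta> \<le> c\<^sub>0 + c\<^sub>1"
  have "0 \<le> (c\<^sub>0 + \<beta>) * (m - S) + (c\<^sub>0 + c\<^sub>1 + \<beta>) * S"
    by (rule add_nonneg_nonneg[OF mult_nonneg_nonneg mult_nonneg_nonneg]) (use b S in linarith)+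
  then show "- (\<beta> / 2) * (mass \<phi>)\<^sup>2 \<le> interaction c\<^sub>0 c\<^sub>1 \<phi>"
    unfolding I m_def[symmetric] by (simp add: algebra_simps)
qed

lemma mass_sq_le: "(mass \<phi>)\<^sup>2 \<le> 3 * (\<Sum>j\<in>UNIV. cmod (\<phi> j) ^ 4)"
proof -
  have "(mass \<phi>)\<^sup>2 \<le> (\<Sum>j\<in>UNIV. ((cmod (\<phi> j))\<^sup>2)\<^sup>2) * real (card (UNIV :: 3 set))"
    unfolding mass_def by (rule sum_squared_le_sum_of_squares)
  then show ?thesis by (simp flip: power_mult add: mult.commute)
qed

text \<open>Every term, including the spin-orbit term, is a real quadratic form in the values and
  derivatives jointly, so the identity can be verified term by term.\<close>

lemma quadratic_density_parallelogram:
  fixes x :: "'n::{finite,numeral} point"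
  shows "4 * quadratic_density V \<Omega> \<gamma> K (\<lambda>j. (\<phi> j + \<psi> j) / 2) (\<lambda>j i. (p j i + q j i) / 2) x
      + quadratic_density V \<Omega> \<gamma> K (\<lambda>j. \<phi> j - \<psi> j) (\<lambda>j i. p j i - q j i) x
    = 2 * quadratic_density V \<Omega> \<gamma> K \<phi> p x + 2 * quadratic_density V \<Omega> \<gamma> K \<psi> q x"
proof -
  have m: "4 * mass (\<lambda>j. (\<phi> j + \<psi> j) / 2) + mass (\<lambda>j. \<phi> j - \<psi> j) = 2 * mass \<phi> + 2 * mass \<psi>"
    unfolding mass_def by (simp only: sum_distrib_left sum.distrib[symmetric] cmod_parallelogram)
  have s: "(p j i + q j i) / 2 - \<i> * of_real (vector_potential \<Omega> i x) * ((\<phi> j + \<psi> j) / 2)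
      = ((p j i - \<i> * of_real (vector_potential \<Omega> i x) * \<phi> j) + (q j i - \<i> * of_real (vector_potential \<Omega> i x) * \<psi> j)) / 2"
    "p j i - q j i - \<i> * of_real (vector_potential \<Omega> i x) * (\<phi> j - \<psi> j)
      = (p j i - \<i> * of_real (vector_potential \<Omega> i x) * \<phi> j) - (q j i - \<i> * of_real (vector_potential \<Omega> i x) * \<psi> j)" for i j
    by (simp_all add: field_simps)
  have g: "4 * magnetic_sq \<Omega> (\<lambda>j. (\<phi> j + \<psi> j) / 2) (\<lambda>j i. (p j i + q j i) / 2) x
      + magnetic_sq \<Omega> (\<lambda>j. \<phi> j - \<psi> j) (\<lambda>j i. p j i - q j i) x = 2 * magnetic_sq \<Omega> \<phi> p x + 2 * magnetic_sq \<Omega> \<psi> q x"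
    unfolding magnetic_sq_def s by (simp only: sum_distrib_left sum.distrib[symmetric] cmod_parallelogram)
  have o: "4 * spin_orbit_form (\<lambda>j. (\<phi> j + \<psi> j) / 2) (\<lambda>j i. (p j i + q j i) / 2) TYPE('n)
      + spin_orbit_form (\<lambda>j. \<phi> j - \<psi> j) (\<lambda>j i. p j i - q j i) TYPE('n)
      = 2 * spin_orbit_form \<phi> p TYPE('n) + 2 * spin_orbit_form \<psi> q TYPE('n)"
    unfolding spin_orbit_form_def by (simp add: field_simps)
  have o': "4 * Re (spin_orbit_form (\<lambda>j. (\<phi> j + \<psi> j) / 2) (\<lambda>j i. (p j i + q j i) / 2) TYPE('n))
      + Re (spin_orbit_form (\<lambda>j. \<phi> j - \<psi> j) (\<lambda>j i. p j i - q j i) TYPE('n))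
      = 2 * Re (spin_orbit_form \<phi> p TYPE('n)) + 2 * Re (spin_orbit_form \<psi> q TYPE('n))"
    using arg_cong[OF o, of Re] by simp
  have alg: "4 * (1/2 * a + w * b - \<gamma> * c) + (1/2 * a' + w * b' - \<gamma> * c')
      = 1/2 * (4 * a + a') + w * (4 * b + b') - \<gamma> * (4 * c + c')" for a a' b b' c c' w :: real
    by (simp add: algebra_simps)
  have alg2: "1/2 * (2 * a + 2 * a') + w * (2 * b + 2 * b') - \<gamma> * (2 * c + 2 * c')
      = 2 * (1/2 * a + w * b - \<gamma> * c) + 2 * (1/2 * a' + w * b' - \<gamma> * c')" for a a' b b' c c' w :: real
    by (simp add: algebra_simps)
  show ?thesis unfolding quadratic_density_def alg m g o' alg2 ..
qed

lemma gradient_le_magnetic: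
  fixes x :: "'n::{finite,numeral} point"
  shows "(cmod (p j i))\<^sup>2 \<le> 2 * (cmod (p j i - \<i> * of_real (vector_potential \<Omega> i x) * \<phi> j))\<^sup>2 + 2 * \<Omega>\<^sup>2 * (norm x)\<^sup>2 * (cmod (\<phi> j))\<^sup>2"
proof -
  let ?a = "vector_potential \<Omega> i x"
  have "(cmod (p j i))\<^sup>2 \<le> 2 * (cmod (p j i - \<i> * of_real ?a * \<phi> j))\<^sup>2 + 2 * (cmod (\<i> * of_real ?a * \<phi> j))\<^sup>2"
    using cmod_add_sq_le[of "p j i - \<i> * of_real ?a * \<phi> j" "\<i> * of_real ?a * \<phi> j"] by simp
  moreover have "\<bar>?a\<bar>\<^sup>2 \<le> (\<bar>\<Omega>\<bar> * norm x)\<^sup>2" by (intro power_mono abs_vector_potential_le) simp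
  then have "(cmod (\<i> * of_real ?a * \<phi> j))\<^sup>2 \<le> \<Omega>\<^sup>2 * (norm x)\<^sup>2 * (cmod (\<phi> j))\<^sup>2"
    by (simp add: norm_mult power_mult_distrib mult_right_mono)
  ultimately show ?thesis by linarith
qed

lemma gradient_sum_le_magnetic:
  fixes x :: "'n::{finite,numeral} point"
  shows "(\<Sum>j\<in>UNIV. \<Sum>i\<in>UNIV. (cmod (p j i))\<^sup>2) \<le> 2 * magnetic_sq \<Omega> \<phi> p x + 2 * real CARD('n) * \<Omega>\<^sup>2 * (norm x)\<^sup>2 * mass \<phi>"
proof -
  have "(\<Sum>j\<in>UNIV. \<Sum>i\<in>UNIV. (cmod (p j i))\<^sup>2)
    \<le> (\<Sum>j\<in>UNIV. \<Sum>i\<in>UNIV. 2 * (cmod (p j i - \<i> * of_real (vector_potential \<Omega> i x) * \<phi> j))\<^sup>2 + 2 * \<Omega>\<^sup>2 * (norm x)\<^sup>2 * (cmod (\<phi> j))\<^sup>2)"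
    by (intro sum_mono gradient_le_magnetic)
  also have "\<dots> = 2 * magnetic_sq \<Omega> \<phi> p x + 2 * real CARD('n) * \<Omega>\<^sup>2 * (norm x)\<^sup>2 * mass \<phi>"
    by (simp add: sum.distrib magnetic_sq_def mass_def sum_distrib_left mult_ac)
  finally show ?thesis .
qed

text \<open>The form is at most T U, with T summing the moduli of the values and U those of the
  first two derivatives. Young's inequality gives \<epsilon> U^2 + T^2/(4 \<epsilon>); here U^2 is
  at most 6 times the squared gradient, itself at most twice the magnetic part plus a moment term,
  whence 12, and T^2 <= 3 \<open>mass\<close> gives 3/4 <= 1.\<close>

lemma spin_orbit_form_le:
  fixes x :: "'n::{finite,numeral} point"
  assumes "(1::'n) \<noteq> 2" "\<epsilon> > 0"
  shows "\<bar>Re (spin_orbit_form \<phi> p TYPE('n))\<bar>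
    \<le> 12 * \<epsilon> * magnetic_sq \<Omega> \<phi> p x + 12 * \<epsilon> * real CARD('n) * \<Omega>\<^sup>2 * (norm x)\<^sup>2 * mass \<phi> + 1 / \<epsilon> * mass \<phi>"
proof -
  let ?n = "\<lambda>j. cmod (\<phi> j)" and ?a = "\<lambda>j i. cmod (p j i)"
  define T where "T = (\<Sum>j\<in>UNIV. ?n j)"
  define U where "U = (\<Sum>j\<in>UNIV. ?a j 1 + ?a j 2)"
  have T2: "T\<^sup>2 \<le> 3 * mass \<phi>"
    using sum_squared_le_sum_of_squares[of ?n "UNIV :: 3 set"] by (simp add: T_def mass_def mult.commute)
  have U2: "U\<^sup>2 \<le> 6 * (\<Sum>j\<in>UNIV. \<Sum>i\<in>UNIV. (?a j i)\<^sup>2)"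
  proof -
    have "U\<^sup>2 \<le> (\<Sum>j\<in>UNIV. (?a j 1 + ?a j 2)\<^sup>2) * real (card (UNIV :: 3 set))"
      unfolding U_def by (rule sum_squared_le_sum_of_squares)
    also have "(\<Sum>j\<in>UNIV. (?a j 1 + ?a j 2)\<^sup>2) \<le> (\<Sum>j\<in>UNIV. 2 * (\<Sum>i\<in>UNIV. (?a j i)\<^sup>2))"
    proof (rule sum_mono)
      fix j
      have "(?a j 1)\<^sup>2 + (?a j 2)\<^sup>2 = (\<Sum>i\<in>{1,2}. (?a j i)\<^sup>2)" using assms(1) by simp
      also have "\<dots> \<le> (\<Sum>i\<in>UNIV. (?a j i)\<^sup>2)" by (rule sum_mono2) auto
      finally show "(?a j 1 + ?a j 2)\<^sup>2 \<le> 2 * (\<Sum>i\<in>UNIV. (?a j i)\<^sup>2)"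
        using sum_squares_bound[of "?a j 1" "?a j 2"] by (simp add: power2_sum)
    qed
    finally show ?thesis by (simp add: sum_distrib_left mult.commute)
  qed
  have "\<bar>Re (spin_orbit_form \<phi> p TYPE('n))\<bar> \<le> cmod (spin_orbit_form \<phi> p TYPE('n))" by (rule abs_Re_le_cmod)
  also have "\<dots> \<le> ?n 1 * (?a 2 1 + ?a 2 2) + ?n 2 * ((?a 3 1 + ?a 3 2) + (?a 1 1 + ?a 1 2)) + ?n 3 * (?a 2 1 + ?a 2 2)"
  proof -
    have l: "cmod (\<i> * u + v) \<le> cmod u + cmod v" "cmod (\<i> * u - v) \<le> cmod u + cmod v" for u v
      using norm_triangle_ineq[of "\<i> * u" v] norm_triangle_ineq4[of "\<i> * u" v] by (simp_all add: norm_mult)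
    show ?thesis unfolding spin_orbit_form_def
      by (intro norm_triangle_mono norm_mult_ineq[THEN order_trans] mult_mono l) (auto intro: l)
  qed
  also have "\<dots> \<le> T * U"
    unfolding T_def U_def sum_3 by (simp add: algebra_simps)
  also have "T * U \<le> \<epsilon> * U\<^sup>2 + 1 / (4 * \<epsilon>) * T\<^sup>2"
  proof -
    have "0 \<le> (2 * \<epsilon> * U - T)\<^sup>2 / (4 * \<epsilon>)" using assms(2) by simp
    also have "\<dots> = \<epsilon> * U\<^sup>2 - T * U + 1 / (4 * \<epsilon>) * T\<^sup>2"
      using assms(2) by (simp add: power2_eq_square field_simps)
    finally show ?thesis by simp
  qed
  also have "\<epsilon> * U\<^sup>2 \<le> \<epsilon> * (6 * (2 * magnetic_sq \<Omega> \<phi> p x + 2 * real CARD('n) * \<Omega>\<^sup>2 * (norm x)\<^sup>2 * mass \<phi>))"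
    using order_trans[OF U2 mult_left_mono[OF gradient_sum_le_magnetic[of p \<Omega> \<phi> x], of 6]] assms(2)
    by (intro mult_left_mono) auto
  also have "1 / (4 * \<epsilon>) * T\<^sup>2 \<le> 1 / (4 * \<epsilon>) * (3 * mass \<phi>)"
    using assms(2) T2 by (intro mult_left_mono) auto
  also have "1 / (4 * \<epsilon>) * (3 * mass \<phi>) \<le> 1 / \<epsilon> * mass \<phi>"
    using assms(2) mass_nonneg[of \<phi>] by (simp add: field_simps)
  finally show ?thesis by (simp add: algebra_simps)
qed

lemma quadratic_density_coercive:
  fixes V :: "'n::{finite,numeral} point \<Rightarrow> real"
  assumes "(1::'n) \<noteq> 2" "\<delta> > 0" and V: "\<And>x. c * (norm x)\<^sup>2 \<le> V x - \<Omega>\<^sup>2 / 2 * ((x $ 1)\<^sup>2 + (x $ 2)\<^sup>2)"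
  obtains K where "\<And>\<phi> p x. (1/2 - \<delta>) * magnetic_sq \<Omega> \<phi> p x + (c - \<delta>) * ((norm x)\<^sup>2 * mass \<phi>) \<le> quadratic_density V \<Omega> \<gamma> K \<phi> p x"
proof -
  \<comment> \<open>Small enough that the magnetic and the moment error, each multiplied by
    |\<gamma>|, stay below \<delta>. The added ones keep the denominator positive and let one choice
    serve both errors.\<close>
  define \<epsilon> where "\<epsilon> = \<delta> / (12 * (\<bar>\<gamma>\<bar> + 1) * (1 + real CARD('n) * \<Omega>\<^sup>2))"
  have den: "12 * (\<bar>\<gamma>\<bar> + 1) * (1 + real CARD('n) * \<Omega>\<^sup>2) > 0"
    by (intro mult_pos_pos add_pos_nonneg add_nonneg_pos) auto
  have e: "\<epsilon> > 0" unfolding \<epsilon>_def using assms(2) den by (intro divide_pos_pos)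
  have e1: "12 * (\<bar>\<gamma>\<bar> + 1) * (1 + real CARD('n) * \<Omega>\<^sup>2) * \<epsilon> = \<delta>"
    using den unfolding \<epsilon>_def by (metis less_irrefl nonzero_mult_div_cancel_left times_divide_eq_right)
  have pos: "0 \<le> \<bar>\<gamma>\<bar> * \<epsilon>" "0 \<le> \<epsilon>" "0 \<le> real CARD('n) * \<Omega>\<^sup>2" "0 \<le> \<bar>\<gamma>\<bar> * \<epsilon> * (real CARD('n) * \<Omega>\<^sup>2)" "0 \<le> \<epsilon> * (real CARD('n) * \<Omega>\<^sup>2)"
    using e by auto
  have e2: "\<bar>\<gamma>\<bar> * (12 * \<epsilon>) \<le> \<delta>" "\<bar>\<gamma>\<bar> * (12 * \<epsilon> * real CARD('n) * \<Omega>\<^sup>2) \<le> \<delta>"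
    using pos unfolding e1[symmetric] by (simp_all add: algebra_simps)
  show ?thesis
  proof (rule that[of "\<bar>\<gamma>\<bar> * (1 / \<epsilon>)"])
    fix \<phi> :: "3 \<Rightarrow> complex" and p :: "3 \<Rightarrow> 'n \<Rightarrow> complex" and x :: "'n point"
    let ?G = "magnetic_sq \<Omega> \<phi> p x" and ?r = "(norm x)\<^sup>2 * mass \<phi>"
    have nn: "0 \<le> ?G" "0 \<le> ?r" "0 \<le> mass \<phi>" using mass_nonneg magnetic_sq_nonneg by auto
    have "\<gamma> * Re (spin_orbit_form \<phi> p TYPE('n)) \<le> \<bar>\<gamma>\<bar> * \<bar>Re (spin_orbit_form \<phi> p TYPE('n))\<bar>"
      by (metis abs_ge_self abs_mult)
    also have "\<dots> \<le> \<bar>\<gamma>\<bar> * (12 * \<epsilon> * ?G + 12 * \<epsilon> * real CARD('n) * \<Omega>\<^sup>2 * (norm x)\<^sup>2 * mass \<phi> + 1 / \<epsilon> * mass \<phi>)"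
      by (intro mult_left_mono spin_orbit_form_le assms(1) e) simp
    also have "\<dots> = \<bar>\<gamma>\<bar> * (12 * \<epsilon>) * ?G + \<bar>\<gamma>\<bar> * (12 * \<epsilon> * real CARD('n) * \<Omega>\<^sup>2) * ?r + \<bar>\<gamma>\<bar> * (1 / \<epsilon>) * mass \<phi>"
      by (simp add: algebra_simps)
    also have "\<dots> \<le> \<delta> * ?G + \<delta> * ?r + \<bar>\<gamma>\<bar> * (1 / \<epsilon>) * mass \<phi>"
      by (intro add_mono mult_right_mono e2 nn order_refl)
    finally have so: "\<gamma> * Re (spin_orbit_form \<phi> p TYPE('n)) \<le> \<delta> * ?G + \<delta> * ?r + \<bar>\<gamma>\<bar> * (1 / \<epsilon>) * mass \<phi>" .
    have "c * ?r \<le> (V x - \<Omega>\<^sup>2 / 2 * ((x $ 1)\<^sup>2 + (x $ 2)\<^sup>2)) * mass \<phi>"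
      using mult_right_mono[OF V nn(3), of x] by (simp add: mult.assoc)
    with so show "(1/2 - \<delta>) * ?G + (c - \<delta>) * ?r \<le> quadratic_density V \<Omega> \<gamma> (\<bar>\<gamma>\<bar> * (1 / \<epsilon>)) \<phi> p x"
      unfolding quadratic_density_def distrib_right left_diff_distrib by linarith
  qed
qed

subsection \<open>Sobolev spinors\<close>

lemma L2_cnj: assumes "f \<in> L2" shows "(\<lambda>x. cnj (f x)) \<in> L2"
proof -
  have [measurable]: "cnj \<in> borel_measurable borel"
    by (intro borel_measurable_continuous_onI continuous_intros)
  note [measurable] = L2_measurable[OF assms]
  show ?thesis using assms by (simp add: L2_def)
qed

lemma L2_weight:
  fixes f :: "('n::finite) wavefun"
  assumes f: "f \<in> L2" and w: "integrable lborel (\<lambda>x. (norm x)\<^sup>2 * (cmod (f x))\<^sup>2)"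
    and a: "a \<in> borel_measurable borel" "\<And>x. \<bar>a x\<bar> \<le> B * norm x"
  shows "(\<lambda>x. of_real (a x) * f x) \<in> L2"
proof (rule L2_bound(1))
  note [measurable] = L2_measurable[OF f] a(1)
  show "(\<lambda>x. of_real (a x) * f x) \<in> borel_measurable borel" by measurable
  show "integrable lborel (\<lambda>x. B\<^sup>2 * ((norm x)\<^sup>2 * (cmod (f x))\<^sup>2))" using w by simp
  fix x
  have "\<bar>a x\<bar>\<^sup>2 \<le> (B * norm x)\<^sup>2" by (intro power_mono a) simp
  then show "(cmod (of_real (a x) * f x))\<^sup>2 \<le> B\<^sup>2 * ((norm x)\<^sup>2 * (cmod (f x))\<^sup>2)"
    by (simp add: norm_mult power_mult_distrib mult_right_mono flip: mult.assoc)
qed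

text \<open>
  Carrying representatives of the weak derivatives along keeps the choice made by \<^const>\<open>weak_partial\<close>,
  which is not linear, out of the convexity arguments.
\<close>

type_synonym 'n jet = "(3 \<Rightarrow> 'n wavefun) \<times> (3 \<Rightarrow> 'n \<Rightarrow> 'n wavefun)"

abbreviation val :: "'n jet \<Rightarrow> 'n point \<Rightarrow> 3 \<Rightarrow> complex" where "val z x \<equiv> (\<lambda>j. fst z j x)"

abbreviation der :: "'n jet \<Rightarrow> 'n point \<Rightarrow> 3 \<Rightarrow> 'n \<Rightarrow> complex" where "der z x \<equiv> (\<lambda>j i. snd z j i x)"

text \<open>The weight is |x|^2 instead of the potential, so the notion is independent of the trap;
  for the traps considered \<open>weight_iff\<close> shows that the two integrability conditions
  agree.\<close>

definition sobolev_jet :: "('n::finite) jet \<Rightarrow> bool" where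
  "sobolev_jet z \<longleftrightarrow> (\<forall>j. fst z j \<in> L2 \<and> (\<forall>i. snd z j i \<in> L2 \<and> has_weak_partial i (fst z j) (snd z j i)) \<and>
     integrable lborel (\<lambda>x. (norm x)\<^sup>2 * (cmod (fst z j x))\<^sup>2))"

definition jet_midpoint :: "('n::finite) jet \<Rightarrow> 'n jet \<Rightarrow> 'n jet" where
  "jet_midpoint z w = (\<lambda>j x. (fst z j x + fst w j x) / 2, \<lambda>j i x. (snd z j i x + snd w j i x) / 2)"

definition jet_diff :: "('n::finite) jet \<Rightarrow> 'n jet \<Rightarrow> 'n jet" where
  "jet_diff z w = (\<lambda>j x. fst z j x - fst w j x, \<lambda>j i x. snd z j i x - snd w j i x)"

definition total_mass :: "('n::finite) jet \<Rightarrow> real" where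
  "total_mass z = (LINT x|lborel. mass (val z x))"

definition weighted_mass :: "('n::finite) jet \<Rightarrow> real" where
  "weighted_mass z = (LINT x|lborel. (norm x)\<^sup>2 * mass (val z x))"

definition magnetic_energy :: "real \<Rightarrow> ('n::{finite,numeral}) jet \<Rightarrow> real" where
  "magnetic_energy \<Omega> z = (LINT x|lborel. magnetic_sq \<Omega> (val z x) (der z x) x)"

definition interaction_energy :: "real \<Rightarrow> real \<Rightarrow> ('n::finite) jet \<Rightarrow> real" where
  "interaction_energy c\<^sub>0 c\<^sub>1 z = (LINT x|lborel. interaction c\<^sub>0 c\<^sub>1 (val z x))"

section \<open>Linear combinations and integrability of jets\<close>

lemma sobolev_jetD:
  assumes "sobolev_jet z"
  shows "fst z j \<in> L2" "snd z j i \<in> L2" "has_weak_partial i (fst z j) (snd z j i)"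
    "integrable lborel (\<lambda>x. (norm x)\<^sup>2 * (cmod (fst z j x))\<^sup>2)"
  using assms by (auto simp: sobolev_jet_def)

lemma weighted_add:
  fixes f g :: "('n::finite) wavefun"
  assumes "f \<in> L2" "g \<in> L2" "integrable lborel (\<lambda>x. (norm x)\<^sup>2 * (cmod (f x))\<^sup>2)"
    "integrable lborel (\<lambda>x. (norm x)\<^sup>2 * (cmod (g x))\<^sup>2)"
  shows "integrable lborel (\<lambda>x. (norm x)\<^sup>2 * (cmod (f x + g x))\<^sup>2)"
proof (rule Bochner_Integration.integrable_bound)
  have [measurable]: "f \<in> borel_measurable borel" "g \<in> borel_measurable borel"
    using assms(1,2) by (auto dest: L2_measurable)
  show "(\<lambda>x. (norm x)\<^sup>2 * (cmod (f x + g x))\<^sup>2) \<in> borel_measurable lborel" by measurable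
  show "integrable lborel (\<lambda>x. 2 * ((norm x)\<^sup>2 * (cmod (f x))\<^sup>2) + 2 * ((norm x)\<^sup>2 * (cmod (g x))\<^sup>2))"
    using assms by simp
  have "(norm x)\<^sup>2 * (cmod (f x + g x))\<^sup>2 \<le> 2 * ((norm x)\<^sup>2 * (cmod (f x))\<^sup>2) + 2 * ((norm x)\<^sup>2 * (cmod (g x))\<^sup>2)" for x
    using mult_left_mono[OF cmod_add_sq_le[of "f x" "g x"], of "(norm x)\<^sup>2"] by (simp add: algebra_simps)
  then show "AE x in lborel. norm ((norm x)\<^sup>2 * (cmod (f x + g x))\<^sup>2)
      \<le> norm (2 * ((norm x)\<^sup>2 * (cmod (f x))\<^sup>2) + 2 * ((norm x)\<^sup>2 * (cmod (g x))\<^sup>2))"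
    by (intro AE_I2) (auto intro: order_trans[OF _ abs_ge_self])
qed

lemma sobolev_jet_combination:
  assumes z: "sobolev_jet z" and w: "sobolev_jet w"
  shows "sobolev_jet (\<lambda>j x. a * fst z j x + b * fst w j x, \<lambda>j i x. a * snd z j i x + b * snd w j i x)"
proof -
  note zD = sobolev_jetD[OF z] note wD = sobolev_jetD[OF w]
  have "integrable lborel (\<lambda>x. (norm x)\<^sup>2 * (cmod (a * fst z j x + b * fst w j x))\<^sup>2)" for j
  proof (rule weighted_add[OF L2_cmult[OF zD(1)] L2_cmult[OF wD(1)]])
    show "integrable lborel (\<lambda>x. (norm x)\<^sup>2 * (cmod (a * fst z j x))\<^sup>2)"
      using integrable_mult_right[OF zD(4)[of j], of "(cmod a)\<^sup>2"] by (simp add: norm_mult power_mult_distrib mult_ac)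
    show "integrable lborel (\<lambda>x. (norm x)\<^sup>2 * (cmod (b * fst w j x))\<^sup>2)"
      using integrable_mult_right[OF wD(4)[of j], of "(cmod b)\<^sup>2"] by (simp add: norm_mult power_mult_distrib mult_ac)
  qed
  then show ?thesis
    unfolding sobolev_jet_def
    by (auto intro!: L2_add(1) L2_cmult has_weak_partial_add has_weak_partial_cmult zD wD)
qed

lemma sobolev_jet_midpoint: "sobolev_jet z \<Longrightarrow> sobolev_jet w \<Longrightarrow> sobolev_jet (jet_midpoint z w)"
  using sobolev_jet_combination[of z w "1/2" "1/2"] by (simp add: jet_midpoint_def add_divide_distrib)

lemma sobolev_jet_diff: "sobolev_jet z \<Longrightarrow> sobolev_jet w \<Longrightarrow> sobolev_jet (jet_diff z w)"
  using sobolev_jet_combination[of z w "1" "-1"] by (simp add: jet_diff_def)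

lemma sobolev_jet_integrable:
  fixes z :: "('n::{finite,numeral}) jet"
  assumes z: "sobolev_jet z"
  shows "integrable lborel (\<lambda>x. mass (val z x))"
    and "integrable lborel (\<lambda>x. (norm x)\<^sup>2 * mass (val z x))"
    and "(\<lambda>x. snd z j i x - \<i> * of_real (vector_potential \<Omega> i x) * fst z j x) \<in> L2"
    and "integrable lborel (\<lambda>x. magnetic_sq \<Omega> (val z x) (der z x) x)"
    and "integrable lborel (\<lambda>x. spin_orbit_form (val z x) (der z x) TYPE('n))"
proof -
  note zD = sobolev_jetD[OF z]
  show "integrable lborel (\<lambda>x. mass (val z x))"
    unfolding mass_def by (intro Bochner_Integration.integrable_sum L2_integrable zD)
  show "integrable lborel (\<lambda>x. (norm x)\<^sup>2 * mass (val z x))"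
    unfolding mass_def sum_distrib_left by (intro Bochner_Integration.integrable_sum zD)
  have vm: "vector_potential \<Omega> i \<in> borel_measurable borel" for i :: 'n
    unfolding vector_potential_def[abs_def] by (cases "i = 1"; cases "i = 2") simp_all
  have m: "(\<lambda>x. snd z j i x - \<i> * (of_real (vector_potential \<Omega> i x) * fst z j x)) \<in> L2" for i j
    by (intro L2_diff(1) zD L2_cmult L2_weight[OF zD(1) zD(4) vm abs_vector_potential_le])
  then show "(\<lambda>x. snd z j i x - \<i> * of_real (vector_potential \<Omega> i x) * fst z j x) \<in> L2"
    by (simp add: mult.assoc)
  show "integrable lborel (\<lambda>x. magnetic_sq \<Omega> (val z x) (der z x) x)"
    unfolding magnetic_sq_def mult.assoc by (intro Bochner_Integration.integrable_sum L2_integrable m)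
  show "integrable lborel (\<lambda>x. spin_orbit_form (val z x) (der z x) TYPE('n))"
    unfolding spin_orbit_form_def
    by (intro Bochner_Integration.integrable_add L2_mult_integrable(2) L2_cnj L2_add(1) L2_diff(1) L2_cmult zD)
qed

lemma magnetic_energy_eq:
  assumes "sobolev_jet z"
  shows "magnetic_energy \<Omega> z = (\<Sum>j\<in>UNIV. \<Sum>i\<in>UNIV. L2_sq (\<lambda>x. snd z j i x - \<i> * of_real (vector_potential \<Omega> i x) * fst z j x))"
  unfolding magnetic_energy_def magnetic_sq_def L2_sq_def
  using L2_integrable[OF sobolev_jet_integrable(3)[OF assms]]
  by (simp add: Bochner_Integration.integral_sum Bochner_Integration.integrable_sum)

lemma total_mass_eq: "sobolev_jet z \<Longrightarrow> total_mass z = (\<Sum>j\<in>UNIV. L2_sq (fst z j))"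
  unfolding total_mass_def mass_def L2_sq_def
  by (rule Bochner_Integration.integral_sum) (rule L2_integrable[OF sobolev_jetD(1)])

lemma nonneg_energies:
  "0 \<le> total_mass z" "0 \<le> weighted_mass z" "0 \<le> magnetic_energy \<Omega> w"
  by (auto simp: total_mass_def weighted_mass_def magnetic_energy_def mass_nonneg magnetic_sq_nonneg
      intro!: integral_nonneg_AE)

text \<open>The vector potential grows linearly, so recovering the plain gradient from the magnetic
  one costs a second moment. This is why both are controlled together throughout.\<close>

lemma gradient_energy_le:
  fixes z :: "('n::{finite,numeral}) jet"
  assumes z: "sobolev_jet z"
  shows "(\<Sum>j\<in>UNIV. \<Sum>i\<in>UNIV. L2_sq (snd z j i)) \<le> 2 * magnetic_energy \<Omega> z + 2 * real CARD('n) * \<Omega>\<^sup>2 * weighted_mass z"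
proof -
  note i = sobolev_jet_integrable[OF z]
  have g: "integrable lborel (\<lambda>x. \<Sum>j\<in>UNIV. \<Sum>i\<in>UNIV. (cmod (snd z j i x))\<^sup>2)"
    by (intro Bochner_Integration.integrable_sum L2_integrable sobolev_jetD[OF z])
  have "(\<Sum>j\<in>UNIV. \<Sum>i\<in>UNIV. L2_sq (snd z j i)) = (LINT x|lborel. (\<Sum>j\<in>UNIV. \<Sum>i\<in>UNIV. (cmod (snd z j i x))\<^sup>2))"
    unfolding L2_sq_def using L2_integrable[OF sobolev_jetD(2)[OF z]]
    by (simp add: Bochner_Integration.integral_sum Bochner_Integration.integrable_sum)
  also have "\<dots> \<le> (LINT x|lborel. 2 * magnetic_sq \<Omega> (val z x) (der z x) x + 2 * real CARD('n) * \<Omega>\<^sup>2 * ((norm x)\<^sup>2 * mass (val z x)))"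
  proof (rule integral_mono[OF g])
    show "integrable lborel (\<lambda>x. 2 * magnetic_sq \<Omega> (val z x) (der z x) x + 2 * real CARD('n) * \<Omega>\<^sup>2 * ((norm x)\<^sup>2 * mass (val z x)))"
      using i by simp
    show "(\<Sum>j\<in>UNIV. \<Sum>i\<in>UNIV. (cmod (snd z j i x))\<^sup>2) \<le> 2 * magnetic_sq \<Omega> (val z x) (der z x) x + 2 * real CARD('n) * \<Omega>\<^sup>2 * ((norm x)\<^sup>2 * mass (val z x))" for x
      using gradient_sum_le_magnetic[of "der z x" \<Omega> "val z x" x] by (simp add: mult.assoc)
  qed
  also have "\<dots> = 2 * magnetic_energy \<Omega> z + 2 * real CARD('n) * \<Omega>\<^sup>2 * weighted_mass z"
    using i by (simp add: magnetic_energy_def weighted_mass_def)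
  finally show ?thesis .
qed

lemma L2_sq_le_gradient_energy:
  fixes z :: "('n::finite) jet"
  shows "L2_sq (snd z j i) \<le> (\<Sum>j\<in>UNIV. \<Sum>i\<in>UNIV. L2_sq (snd z j i))"
proof -
  have "L2_sq (snd z j i) \<le> (\<Sum>i\<in>UNIV. L2_sq (snd z j i))" by (rule member_le_sum) auto
  also have "\<dots> \<le> (\<Sum>j\<in>UNIV. \<Sum>i\<in>UNIV. L2_sq (snd z j i))"
    by (rule member_le_sum[of j UNIV "\<lambda>j. \<Sum>i\<in>UNIV. L2_sq (snd z j i)"]) (auto intro: sum_nonneg)
  finally show ?thesis .
qed

lemma sobolev_jet_translation_bounded:
  fixes z :: "('n::{finite,numeral}) jet"
  assumes z: "sobolev_jet z"
  shows "translation_bounded (real CARD('n) * (2 * magnetic_energy \<Omega> z + 2 * real CARD('n) * \<Omega>\<^sup>2 * weighted_mass z)) (fst z j)"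
proof (rule H1_translation_bounded[OF sobolev_jetD(3)[OF z] sobolev_jetD(1)[OF z] sobolev_jetD(2)[OF z]])
  have "(\<Sum>i\<in>UNIV. L2_sq (snd z j i)) \<le> (\<Sum>j\<in>UNIV. \<Sum>i\<in>UNIV. L2_sq (snd z j i))"
    by (rule member_le_sum[of j UNIV "\<lambda>j. \<Sum>i\<in>UNIV. L2_sq (snd z j i)"]) (auto intro: sum_nonneg)
  also note gradient_energy_le[OF z, of \<Omega>]
  finally show "real CARD('n) * (\<Sum>i\<in>UNIV. L2_sq (snd z j i))
      \<le> real CARD('n) * (2 * magnetic_energy \<Omega> z + 2 * real CARD('n) * \<Omega>\<^sup>2 * weighted_mass z)"
    by (intro mult_left_mono) auto
qed

lemma sobolev_jet_L4:
  fixes z :: "('n::{finite,numeral}) jet"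
  assumes z: "sobolev_jet z" and d: "CARD('n) \<le> 3"
  shows "integrable lborel (\<lambda>x. cmod (fst z j x) ^ 4)"
  by (rule L4_embedding(1)[OF sobolev_jet_translation_bounded[OF z, of 0] d])

lemma continuous_interaction:
  assumes "\<And>j. ((\<lambda>n. \<phi> n j) \<longlongrightarrow> \<psi> j) F"
  shows "((\<lambda>n. interaction c\<^sub>0 c\<^sub>1 (\<phi> n)) \<longlongrightarrow> interaction c\<^sub>0 c\<^sub>1 \<psi>) F"
  unfolding interaction_def mass_def spin_sq_def F\<^sub>x.simps F\<^sub>y.simps F\<^sub>z.simps
  by (intro tendsto_intros assms)

lemma sobolev_jet_interaction:
  fixes z :: "('n::{finite,numeral}) jet"
  assumes z: "sobolev_jet z" and d: "CARD('n) \<le> 3"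
  shows "integrable lborel (\<lambda>x. interaction c\<^sub>0 c\<^sub>1 (val z x))" "integrable lborel (\<lambda>x. (mass (val z x))\<^sup>2)"
proof -
  note [measurable] = L2_measurable[OF sobolev_jetD(1)[OF z]]
  have [measurable]: "cnj \<in> borel_measurable borel"
    by (intro borel_measurable_continuous_onI continuous_intros)
  have mm: "(\<lambda>x. mass (val z x)) \<in> borel_measurable borel" unfolding mass_def by measurable
  have m4: "integrable lborel (\<lambda>x. 3 * (\<Sum>j\<in>UNIV. cmod (fst z j x) ^ 4))"
    using sobolev_jet_L4[OF z d] by (intro integrable_mult_right Bochner_Integration.integrable_sum)
  show m2: "integrable lborel (\<lambda>x. (mass (val z x))\<^sup>2)"
    by (rule Bochner_Integration.integrable_bound[OF m4])
      (use mm mass_sq_le in \<open>auto intro: order_trans[OF _ abs_ge_self]\<close>)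
  have im: "(\<lambda>x. interaction c\<^sub>0 c\<^sub>1 (val z x)) \<in> borel_measurable borel"
    unfolding interaction_def mass_def spin_sq_def F\<^sub>x.simps F\<^sub>y.simps F\<^sub>z.simps by measurable
  show "integrable lborel (\<lambda>x. interaction c\<^sub>0 c\<^sub>1 (val z x))"
    by (rule Bochner_Integration.integrable_bound[OF integrable_mult_right[OF m2, of "\<bar>c\<^sub>0\<bar> + \<bar>c\<^sub>1\<bar>"]])
      (use im interaction_bounds(1) in \<open>auto intro: order_trans[OF _ abs_ge_self]\<close>)
qed

text \<open>\<open>c\<close> is the confinement left after subtracting the centrifugal potential.
  \<open>C\<close> makes the potential comparable to |x|^2 from above, so that its weight and the
  second moment define the same space. The index type needs only distinct 1 and 2 and at most three
  elements, which covers both dimensions at once.\<close>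

locale trap =
  fixes V :: "('n::{finite,numeral}) point \<Rightarrow> real" and \<Omega> \<gamma> c\<^sub>0 c\<^sub>1 c C :: real
  assumes one_neq_two: "(1::'n) \<noteq> 2" and dim: "CARD('n) \<le> 3"
    and V_measurable: "V \<in> borel_measurable borel"
    and c_pos: "c > 0" and V_lower: "\<And>x. c * (norm x)\<^sup>2 \<le> V x - \<Omega>\<^sup>2 / 2 * ((x $ 1)\<^sup>2 + (x $ 2)\<^sup>2)"
    and V_upper: "\<And>x. V x \<le> C * (norm x)\<^sup>2"
begin

definition Q :: "real \<Rightarrow> 'n jet \<Rightarrow> real" where
  "Q K z = (LINT x|lborel. quadratic_density V \<Omega> \<gamma> K (val z x) (der z x) x)"

section \<open>The energy as a quadratic form plus an interaction\<close>

lemma V_nonneg: "c * (norm x)\<^sup>2 \<le> V x" "0 \<le> V x"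
proof -
  have "0 \<le> \<Omega>\<^sup>2 / 2 * ((x $ 1)\<^sup>2 + (x $ 2)\<^sup>2)" by (intro mult_nonneg_nonneg) auto
  then show "c * (norm x)\<^sup>2 \<le> V x" using V_lower[of x] by linarith
  moreover have "0 \<le> c * (norm x)\<^sup>2" using c_pos by simp
  ultimately show "0 \<le> V x" by linarith
qed

lemma weight_iff:
  assumes "f \<in> L2"
  shows "integrable lborel (\<lambda>x. V x * (cmod (f x))\<^sup>2) \<longleftrightarrow> integrable lborel (\<lambda>x. (norm x)\<^sup>2 * (cmod (f x))\<^sup>2)"
proof
  note [measurable] = L2_measurable[OF assms] V_measurable
  assume i: "integrable lborel (\<lambda>x. V x * (cmod (f x))\<^sup>2)"
  show "integrable lborel (\<lambda>x. (norm x)\<^sup>2 * (cmod (f x))\<^sup>2)"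
  proof (rule Bochner_Integration.integrable_bound[OF integrable_mult_right[OF i, of "1 / c"]])
    show "AE x in lborel. norm ((norm x)\<^sup>2 * (cmod (f x))\<^sup>2) \<le> norm (1 / c * (V x * (cmod (f x))\<^sup>2))"
    proof (intro AE_I2)
      fix x
      have "(norm x)\<^sup>2 \<le> 1 / c * V x" using V_nonneg(1)[of x] c_pos by (simp add: field_simps)
      from mult_right_mono[OF this, of "(cmod (f x))\<^sup>2"]
      show "norm ((norm x)\<^sup>2 * (cmod (f x))\<^sup>2) \<le> norm (1 / c * (V x * (cmod (f x))\<^sup>2))"
        using V_nonneg(2)[of x] c_pos by (simp add: abs_mult)
    qed
  qed measurable
next
  note [measurable] = L2_measurable[OF assms] V_measurable
  assume i: "integrable lborel (\<lambda>x. (norm x)\<^sup>2 * (cmod (f x))\<^sup>2)"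
  show "integrable lborel (\<lambda>x. V x * (cmod (f x))\<^sup>2)"
  proof (rule Bochner_Integration.integrable_bound[OF integrable_mult_right[OF i, of C]])
    show "AE x in lborel. norm (V x * (cmod (f x))\<^sup>2) \<le> norm (C * ((norm x)\<^sup>2 * (cmod (f x))\<^sup>2))"
    proof (intro AE_I2)
      fix x
      have "norm (V x * (cmod (f x))\<^sup>2) = V x * (cmod (f x))\<^sup>2" using V_nonneg(2)[of x] by simp
      also have "\<dots> \<le> C * (norm x)\<^sup>2 * (cmod (f x))\<^sup>2" by (intro mult_right_mono V_upper) simp
      finally show "norm (V x * (cmod (f x))\<^sup>2) \<le> norm (C * ((norm x)\<^sup>2 * (cmod (f x))\<^sup>2))"
        by (simp add: mult.assoc)
    qed
  qed measurable
qed

lemma quadratic_density_integrable: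
  assumes z: "sobolev_jet z"
  shows "integrable lborel (\<lambda>x. quadratic_density V \<Omega> \<gamma> K (val z x) (der z x) x)"
proof -
  note i = sobolev_jet_integrable[OF z]
  note [measurable] = V_measurable borel_measurable_integrable[OF i(1)]
  have "integrable lborel (\<lambda>x. (V x - \<Omega>\<^sup>2 / 2 * ((x $ 1)\<^sup>2 + (x $ 2)\<^sup>2)) * mass (val z x))"
  proof (rule Bochner_Integration.integrable_bound[OF integrable_mult_right[OF i(2), of C]])
    show "AE x in lborel. norm ((V x - \<Omega>\<^sup>2 / 2 * ((x $ 1)\<^sup>2 + (x $ 2)\<^sup>2)) * mass (val z x)) \<le> norm (C * ((norm x)\<^sup>2 * mass (val z x)))"
    proof (intro AE_I2)
      fix x
      let ?W = "V x - \<Omega>\<^sup>2 / 2 * ((x $ 1)\<^sup>2 + (x $ 2)\<^sup>2)"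
      have "0 \<le> \<Omega>\<^sup>2 / 2 * ((x $ 1)\<^sup>2 + (x $ 2)\<^sup>2)" by (intro mult_nonneg_nonneg) auto
      then have u: "?W \<le> C * (norm x)\<^sup>2" using V_upper[of x] by linarith
      have "0 \<le> c * (norm x)\<^sup>2" using c_pos by simp
      then have l: "0 \<le> ?W" using V_lower[of x] by linarith
      have "norm (?W * mass (val z x)) = ?W * mass (val z x)" using l mass_nonneg[of "val z x"] by simp
      also have "\<dots> \<le> C * (norm x)\<^sup>2 * mass (val z x)" by (intro mult_right_mono u mass_nonneg)
      finally show "norm (?W * mass (val z x)) \<le> norm (C * ((norm x)\<^sup>2 * mass (val z x)))"
        by (simp add: mult.assoc)
    qed
  qed measurable
  then have "integrable lborel (\<lambda>x. (V x - \<Omega>\<^sup>2 / 2 * ((x $ 1)\<^sup>2 + (x $ 2)\<^sup>2) + K) * mass (val z x))"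
    unfolding distrib_right by (intro Bochner_Integration.integrable_add integrable_mult_right i)
  then show ?thesis
    unfolding quadratic_density_def
    by (intro Bochner_Integration.integrable_add Bochner_Integration.integrable_diff integrable_mult_right i integrable_Re)
qed

lemma Q_shift: "sobolev_jet z \<Longrightarrow> Q K z = Q 0 z + K * total_mass z"
proof -
  assume z: "sobolev_jet z"
  have "quadratic_density V \<Omega> \<gamma> K \<phi> p x = quadratic_density V \<Omega> \<gamma> 0 \<phi> p x + K * mass \<phi>" for \<phi> p x
    by (simp add: quadratic_density_def algebra_simps)
  then show ?thesis unfolding Q_def total_mass_def
    using quadratic_density_integrable[OF z, of 0] sobolev_jet_integrable(1)[OF z] by simp
qed

lemma Q_parallelogram:
  assumes z: "sobolev_jet z" and w: "sobolev_jet w"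
  shows "4 * Q K (jet_midpoint z w) + Q K (jet_diff z w) = 2 * Q K z + 2 * Q K w"
proof -
  note i = quadratic_density_integrable[OF z, of K] quadratic_density_integrable[OF w, of K]
    quadratic_density_integrable[OF sobolev_jet_midpoint[OF z w], of K]
    quadratic_density_integrable[OF sobolev_jet_diff[OF z w], of K]
  have "4 * Q K (jet_midpoint z w) + Q K (jet_diff z w) =
      (LINT x|lborel. 4 * quadratic_density V \<Omega> \<gamma> K (val (jet_midpoint z w) x) (der (jet_midpoint z w) x) x
        + quadratic_density V \<Omega> \<gamma> K (val (jet_diff z w) x) (der (jet_diff z w) x) x)"
    unfolding Q_def using i(3,4) by simp
  also have "\<dots> = (LINT x|lborel. 2 * quadratic_density V \<Omega> \<gamma> K (val z x) (der z x) x + 2 * quadratic_density V \<Omega> \<gamma> K (val w x) (der w x) x)"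
    unfolding jet_midpoint_def jet_diff_def fst_conv snd_conv quadratic_density_parallelogram ..
  also have "\<dots> = 2 * Q K z + 2 * Q K w" unfolding Q_def using i(1,2) by simp
  finally show ?thesis .
qed

lemma Q_coercive:
  assumes z: "sobolev_jet z"
    and K: "\<And>\<phi> p x. a * magnetic_sq \<Omega> \<phi> p x + b * ((norm x)\<^sup>2 * mass \<phi>) \<le> quadratic_density V \<Omega> \<gamma> K \<phi> p x"
  shows "a * magnetic_energy \<Omega> z + b * weighted_mass z \<le> Q K z"
proof -
  note i = sobolev_jet_integrable[OF z]
  have "a * magnetic_energy \<Omega> z + b * weighted_mass z
    = (LINT x|lborel. a * magnetic_sq \<Omega> (val z x) (der z x) x + b * ((norm x)\<^sup>2 * mass (val z x)))"
    unfolding magnetic_energy_def weighted_mass_def using i by simp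
  also have "\<dots> \<le> Q K z" unfolding Q_def
    by (rule integral_mono[OF _ quadratic_density_integrable[OF z] K]) (use i in simp)
  finally show ?thesis .
qed

text \<open>A Bochner integral of a nonintegrable function is 0, so the complex density has to be
  integrable before \<open>Re\<close> may pass under the integral. The rotation term is a product of
  x_i phi and a derivative; the second moment puts the former in L2.\<close>

lemma energy_density_integrable:
  assumes z: "sobolev_jet z" and wp: "\<And>j i. snd z j i = weak_partial i (fst z j)"
  shows "integrable lborel (energy_density V c\<^sub>0 c\<^sub>1 \<Omega> \<gamma> (fst z 1, fst z 2, fst z 3))"
proof -
  note zD = sobolev_jetD[OF z]
  have single: "integrable lborel (single_energy_density V \<Omega> (fst z j))" for j
  proof -
    have x: "(\<lambda>x. of_real (x $ i) * fst z j x) \<in> L2" for i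
      by (rule L2_weight[OF zD(1) zD(4), of _ 1]) (auto simp: component_le_norm_cart)
    have a: "integrable lborel (\<lambda>x. cnj (fst z j x) * angular_momentum (fst z j) x)"
    proof -
      have "integrable lborel (\<lambda>x. - \<i> * ((cnj (of_real (x $ 1) * fst z j x)) * snd z j 2 x - (cnj (of_real (x $ 2) * fst z j x)) * snd z j 1 x))"
        by (intro integrable_mult_right Bochner_Integration.integrable_diff L2_mult_integrable(2) L2_cnj x zD)
      then show ?thesis
        by (simp add: angular_momentum_def wp[symmetric] algebra_simps)
    qed
    have g: "integrable lborel (\<lambda>x. 1/2 * grad_sq (fst z j) x + V x * (cmod (fst z j x))\<^sup>2)"
      unfolding grad_sq_def wp[symmetric]
      by (intro Bochner_Integration.integrable_add integrable_mult_right Bochner_Integration.integrable_sum L2_integrable zD)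
        (use weight_iff[OF zD(1)] zD(4) in blast)
    have "integrable lborel (\<lambda>x. of_real (1/2 * grad_sq (fst z j) x + V x * (cmod (fst z j x))\<^sup>2)
        - of_real \<Omega> * (cnj (fst z j x) * angular_momentum (fst z j) x) :: complex)"
      by (intro Bochner_Integration.integrable_diff integrable_mult_right a integrable_of_real g)
    then show ?thesis by (simp add: single_energy_density_def[abs_def] mult.assoc)
  qed
  have so: "integrable lborel (spin_orbit (fst z 1, fst z 2, fst z 3))"
    using sobolev_jet_integrable(5)[OF z]
    by (simp add: spin_orbit_form_def L\<^sub>0_def L\<^sub>1_def wp[symmetric] cong: Bochner_Integration.integrable_cong)
  have int: "interaction c\<^sub>0 c\<^sub>1 (val z x)
      = c\<^sub>0 / 2 * (density (fst z 1, fst z 2, fst z 3) x)\<^sup>2 + c\<^sub>1 / 2 * spin_sq (fst z 1, fst z 2, fst z 3) x" for x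
    by (simp add: interaction_def mass_3 spin_sq_def)
  have "integrable lborel (\<lambda>x. energy_density V c\<^sub>0 c\<^sub>1 \<Omega> \<gamma> (fst z 1, fst z 2, fst z 3) x)"
    unfolding energy_density.simps int[symmetric]
    by (intro Bochner_Integration.integrable_diff Bochner_Integration.integrable_add integrable_mult_right
        single so integrable_of_real sobolev_jet_interaction[OF z dim])
  then show ?thesis .
qed

text \<open>\<open>energy\<close> uses the derivatives selected by \<open>weak_partial\<close>,
  while a jet carries any representatives. They agree almost everywhere, so the integrals
  coincide.\<close>

lemma energy_eq:
  assumes z: "sobolev_jet z"
  shows "energy V c\<^sub>0 c\<^sub>1 \<Omega> \<gamma> (fst z 1, fst z 2, fst z 3) = Q 0 z + interaction_energy c\<^sub>0 c\<^sub>1 z"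
proof -
  note zD = sobolev_jetD[OF z]
  define w where "w = (fst z, \<lambda>j i. weak_partial i (fst z j))"
  have H: "fst z j \<in> H1" "AE x in lborel. \<forall>i. weak_partial i (fst z j) x = snd z j i x" for j
    using H1I[OF zD(1) zD(2) zD(3)] by auto
  have w: "sobolev_jet w" "fst w = fst z"
    using H1_weak_partial[OF H(1)] zD by (auto simp: w_def sobolev_jet_def)
  have "energy V c\<^sub>0 c\<^sub>1 \<Omega> \<gamma> (fst z 1, fst z 2, fst z 3) = (LINT x|lborel. Re (energy_density V c\<^sub>0 c\<^sub>1 \<Omega> \<gamma> (fst z 1, fst z 2, fst z 3) x))"
    unfolding energy_def using energy_density_integrable[OF w(1)]
    by (subst integral_Re) (auto simp: w_def)
  also have "\<dots> = (LINT x|lborel. quadratic_density V \<Omega> \<gamma> 0 (val w x) (der w x) x + interaction c\<^sub>0 c\<^sub>1 (val w x))"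
    unfolding energy_density_eq[OF one_neq_two] by (simp add: w_def)
  also have "\<dots> = Q 0 w + interaction_energy c\<^sub>0 c\<^sub>1 w"
    unfolding Q_def interaction_energy_def
    by (rule Bochner_Integration.integral_add[OF quadratic_density_integrable[OF w(1)] sobolev_jet_interaction(1)[OF w(1) dim]])
  also have "Q 0 w = Q 0 z"
    unfolding Q_def
  proof (rule integral_cong_AE)
    show "(\<lambda>x. quadratic_density V \<Omega> \<gamma> 0 (val w x) (der w x) x) \<in> borel_measurable lborel"
      "(\<lambda>x. quadratic_density V \<Omega> \<gamma> 0 (val z x) (der z x) x) \<in> borel_measurable lborel"
      using quadratic_density_integrable[OF z] quadratic_density_integrable[OF w(1)] by (auto dest: borel_measurable_integrable)
    have "AE x in lborel. \<forall>j\<in>UNIV. \<forall>i. weak_partial i (fst z j) x = snd z j i x"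
      by (rule AE_finite_allI) (use H in auto)
    then show "AE x in lborel. quadratic_density V \<Omega> \<gamma> 0 (val w x) (der w x) x = quadratic_density V \<Omega> \<gamma> 0 (val z x) (der z x) x"
      by eventually_elim (simp add: w_def)
  qed
  also have "interaction_energy c\<^sub>0 c\<^sub>1 w = interaction_energy c\<^sub>0 c\<^sub>1 z" by (simp add: interaction_energy_def w(2))
  finally show ?thesis .
qed

lemma admissible_of_jet:
  assumes z: "sobolev_jet z" and m: "total_mass z = 1"
  shows "(fst z 1, fst z 2, fst z 3) \<in> admissible V"
proof -
  note zD = sobolev_jetD[OF z]
  have "fst z j \<in> H1 \<inter> L2_weighted V" for j
    using H1I[OF zD(1) zD(2) zD(3)] zD(4) weight_iff[OF zD(1)] by (auto simp: L2_weighted_def)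
  then show ?thesis using m by (simp add: admissible_def total_mass_def mass_3)
qed

lemma jet_of_admissible:
  assumes "\<Psi> \<in> admissible V"
  obtains z where "sobolev_jet z" "total_mass z = 1" "\<Psi> = (fst z 1, fst z 2, fst z 3)"
proof -
  obtain f g h where \<Psi>: "\<Psi> = (f, g, h)" by (cases \<Psi>)
  define F where "F j = (if j = 1 then f else if j = 2 then g else h)" for j :: 3
  have F: "F 1 = f" "F 2 = g" "F 3 = h" by (simp_all add: F_def)
  have H: "F j \<in> H1" "F j \<in> L2_weighted V" for j
    using assms by (auto simp: \<Psi> F_def admissible_def)
  define z where "z = (F, \<lambda>j i. weak_partial i (F j))"
  have "sobolev_jet z"
    using H1_weak_partial[OF H(1)] H1_L2[OF H(1)] weight_iff[OF H1_L2[OF H(1)]] H(2)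
    by (auto simp: z_def sobolev_jet_def L2_weighted_def)
  moreover have "total_mass z = 1"
    using assms by (simp add: z_def total_mass_def mass_3 F \<Psi> admissible_def)
  ultimately show ?thesis using that[of z] by (simp add: z_def F \<Psi>)
qed

end

subsection \<open>Existence of minimisers\<close>

lemma translation_bounded_mono: "translation_bounded A u \<Longrightarrow> A \<le> B \<Longrightarrow> translation_bounded B u"
  unfolding translation_bounded_def by (meson mult_left_mono order_trans zero_le_power2)

text \<open>The level \<open>K\<close> is fixed first, to make the tail term of the embedding small
  for all \<open>n\<close>; afterwards the remaining term tends to 0 with the L2 norm.\<close>

lemma L4_tendsto_zero:
  fixes f :: "nat \<Rightarrow> ('n::finite) wavefun"
  assumes f: "\<And>n. translation_bounded A (f n)" and d: "CARD('n) \<le> 3" and z: "(\<lambda>n. L2_sq (f n)) \<longlonglongrightarrow> 0"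
  shows "(\<lambda>n. LINT x|lborel. cmod (f n x) ^ 4) \<longlonglongrightarrow> 0"
proof (rule LIMSEQ_I)
  fix e :: real assume "e > 0"
  have "(\<lambda>K. 32000000 * A\<^sup>2 * (1 / 2) ^ K) \<longlonglongrightarrow> 32000000 * A\<^sup>2 * 0"
    by (intro tendsto_intros LIMSEQ_power_zero) simp
  then have "\<forall>\<^sub>F K in sequentially. 32000000 * A\<^sup>2 * (1 / 2) ^ K < e / 2"
    by (rule order_tendstoD(2)) (use \<open>e > 0\<close> in simp)
  then obtain K where K: "32000000 * A\<^sup>2 * (1 / 2) ^ K < e / 2"
    using eventually_happens'[OF sequentially_bot] by blast
  have "(\<lambda>n. 8 * (8 ^ K * L2_sq (f n) * (2 * L2_sq (f n) + 16 * A))) \<longlonglongrightarrow> 8 * (8 ^ K * 0 * (2 * 0 + 16 * A))"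
    by (intro tendsto_intros z)
  then have "\<forall>\<^sub>F n in sequentially. 8 * (8 ^ K * L2_sq (f n) * (2 * L2_sq (f n) + 16 * A)) < e / 2"
    by (rule order_tendstoD(2)) (use \<open>e > 0\<close> in simp)
  then obtain N where N: "\<And>n. n \<ge> N \<Longrightarrow> 8 * (8 ^ K * L2_sq (f n) * (2 * L2_sq (f n) + 16 * A)) < e / 2"
    by (auto simp: eventually_sequentially)
  have "norm ((LINT x|lborel. cmod (f n x) ^ 4) - 0) < e" if "n \<ge> N" for n
  proof -
    have "0 \<le> (LINT x|lborel. cmod (f n x) ^ 4)" by simp
    then show ?thesis using L4_embedding(2)[OF f d, of n K] N[OF that] K
      by (simp only: diff_zero real_norm_def abs_of_nonneg)
  qed
  then show "\<exists>no. \<forall>n\<ge>no. norm ((LINT x|lborel. cmod (f n x) ^ 4) - 0) < e" by blast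
qed

lemma L2_subseq_AE_finite:
  fixes h :: "nat \<Rightarrow> 'j \<Rightarrow> ('n::finite) wavefun"
  assumes "finite J" and "\<And>n j. j \<in> J \<Longrightarrow> h n j \<in> L2" "\<And>j. j \<in> J \<Longrightarrow> f j \<in> L2"
    and "\<And>j. j \<in> J \<Longrightarrow> (\<lambda>n. L2_sq (\<lambda>x. h n j x - f j x)) \<longlonglongrightarrow> 0"
  shows "\<exists>r::nat\<Rightarrow>nat. strict_mono r \<and> (\<forall>j\<in>J. AE x in lborel. (\<lambda>k. h (r k) j x) \<longlonglongrightarrow> f j x)"
  using assms
proof (induction J rule: finite_induct)
  case empty
  show ?case by (intro exI[of _ id]) (simp add: strict_mono_def)
next
  case (insert j J)
  then obtain r :: "nat \<Rightarrow> nat" where r: "strict_mono r" "\<forall>j\<in>J. AE x in lborel. (\<lambda>k. h (r k) j x) \<longlonglongrightarrow> f j x"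
    by auto
  have "(\<lambda>n. L2_sq (\<lambda>x. h (r n) j x - f j x)) \<longlonglongrightarrow> 0"
    using LIMSEQ_subseq_LIMSEQ[OF insert.prems(3)[of j] r(1)] by (simp add: o_def)
  then obtain s where s: "strict_mono s" "AE x in lborel. (\<lambda>k. h (r (s k)) j x) \<longlonglongrightarrow> f j x"
    using L2_subseq_AE[of "\<lambda>n. h (r n) j" "f j"] insert.prems(1)[of j] insert.prems(2)[of j] by auto
  have "AE x in lborel. (\<lambda>k. h (r (s k)) i x) \<longlonglongrightarrow> f i x" if "i \<in> J" for i
  proof -
    have "AE x in lborel. (\<lambda>k. h (r k) i x) \<longlonglongrightarrow> f i x" using r(2) that by blast
    then show ?thesis
    proof eventually_elim
      case (elim x)
      from LIMSEQ_subseq_LIMSEQ[OF elim s(1)] show ?case by (simp add: o_def)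
    qed
  qed
  with s(2) have "\<forall>i\<in>insert j J. AE x in lborel. (\<lambda>k. h ((r \<circ> s) k) i x) \<longlonglongrightarrow> f i x" by simp
  with strict_mono_o[OF r(1) s(1)] show ?case by (intro exI[of _ "r \<circ> s"] conjI)
qed

lemma Rellich_finite:
  fixes u :: "nat \<Rightarrow> 'j \<Rightarrow> ('n::finite) wavefun"
  assumes "finite J" and u: "\<And>n j. translation_bounded A (u n j)" and B: "\<And>n j. L2_sq (u n j) \<le> B"
    and V: "\<And>n j. integrable lborel (\<lambda>x. (norm x)\<^sup>2 * (cmod (u n j x))\<^sup>2)"
      "\<And>n j. (LINT x|lborel. (norm x)\<^sup>2 * (cmod (u n j x))\<^sup>2) \<le> C"
  shows "\<exists>r::nat\<Rightarrow>nat. strict_mono r \<and> (\<forall>j\<in>J. \<exists>f\<in>L2. (\<lambda>n. L2_sq (\<lambda>x. u (r n) j x - f x)) \<longlonglongrightarrow> 0)"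
  using \<open>finite J\<close>
proof (induction J rule: finite_induct)
  case empty
  show ?case by (intro exI[of _ id]) (simp add: strict_mono_def)
next
  case (insert j J)
  then obtain r :: "nat \<Rightarrow> nat" where r: "strict_mono r" "\<forall>j\<in>J. \<exists>f\<in>L2. (\<lambda>n. L2_sq (\<lambda>x. u (r n) j x - f x)) \<longlonglongrightarrow> 0"
    by auto
  obtain s f where s: "strict_mono s" "f \<in> L2" "(\<lambda>n. L2_sq (\<lambda>x. u (r (s n)) j x - f x)) \<longlonglongrightarrow> 0"
    by (rule Rellich_compactness[of A "\<lambda>n. u (r n) j" B C]) (use u B V in auto)
  have "\<exists>f\<in>L2. (\<lambda>n. L2_sq (\<lambda>x. u (r (s n)) i x - f x)) \<longlonglongrightarrow> 0" if "i \<in> J" for i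
  proof -
    from r(2) that have "\<exists>f\<in>L2. (\<lambda>n. L2_sq (\<lambda>x. u (r n) i x - f x)) \<longlonglongrightarrow> 0" by (rule bspec)
    then obtain f where f: "f \<in> L2" "(\<lambda>n. L2_sq (\<lambda>x. u (r n) i x - f x)) \<longlonglongrightarrow> 0" by (rule bexE)
    have "(\<lambda>n. L2_sq (\<lambda>x. u (r (s n)) i x - f x)) \<longlonglongrightarrow> 0"
      using LIMSEQ_subseq_LIMSEQ[OF f(2) s(1)] unfolding o_def .
    then show ?thesis using f(1) by (rule_tac bexI[of _ f])
  qed
  then have "\<forall>i\<in>insert j J. \<exists>f\<in>L2. (\<lambda>n. L2_sq (\<lambda>x. u ((r \<circ> s) n) i x - f x)) \<longlonglongrightarrow> 0"
    using s(2,3) by (auto intro!: bexI[of _ f])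
  with strict_mono_o[OF r(1) s(1)] show ?case by (intro exI[of _ "r \<circ> s"] conjI)
qed

lemma L2_midpoint_dist:
  assumes "f \<in> L2" "g \<in> L2" "k \<in> L2"
  shows "L2_sq (\<lambda>x. (f x + g x) / 2 - k x) \<le> (L2_sq (\<lambda>x. f x - k x) + L2_sq (\<lambda>x. g x - k x)) / 2"
proof -
  have eq: "(\<lambda>x. (f x + g x) / 2 - k x) = (\<lambda>x. ((f x - k x) + (g x - k x)) / 2)"
    by (rule ext) (simp add: add_divide_distrib diff_divide_distrib)
  have alg: "a \<le> (p + q) / 2" if "4 * a + e = 2 * p + 2 * q" "0 \<le> e" for a e p q :: real
    using that by simp
  show ?thesis
    unfolding eq
    by (rule alg[OF L2_sq_parallelogram[OF L2_diff(1)[OF assms(1,3)] L2_diff(1)[OF assms(2,3)]] L2_sq_nonneg])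
qed

context trap
begin

text \<open>\<theta> is the fraction of the magnetic energy that an attractive interaction may
  consume. A minimising sequence \<open>y\<close> converges in L2 to some \<Phi>. Let
  \<open>d n\<close> be the infimum of \<open>Q K\<close> over \<open>\<C> n\<close>, with limit D;
  near-minimisers converge to a jet Z over \<Phi> with Q K Z <= D. Since \<open>y n\<close> lies in
  \<open>\<C> n\<close>, its quadratic part is at least \<open>d n\<close>, which leaves at most m +
  K - D for the limiting interaction. Adding the two bounds gives J Z <= m.\<close>

theorem ground_state_exists:
  assumes ne: "admissible V \<noteq> {}" and \<theta>: "0 \<le> \<theta>" "\<theta> < 1"
    and I: "\<And>z :: 'n jet. sobolev_jet z \<Longrightarrow> total_mass z = 1 \<Longrightarrow> - (\<theta> / 2) * magnetic_energy \<Omega> z \<le> interaction_energy c\<^sub>0 c\<^sub>1 z"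
  shows "\<exists>\<Phi>. ground_state V c\<^sub>0 c\<^sub>1 \<Omega> \<gamma> \<Phi>"
proof -
  \<comment> \<open>Of the factor 1/2 of the magnetic energy, \<theta>/2 may go to the interaction
    and \<delta> to the spin-orbit term, and at least \<delta> must remain; this needs \<delta> <=
    (1 - \<theta>)/4. The second argument does the same for the trap.\<close>
  define \<delta> where "\<delta> = min ((1 - \<theta>) / 4) (c / 2)"
  have \<delta>: "\<delta> > 0" "1/2 - \<delta> - \<theta> / 2 \<ge> \<delta>" "c - \<delta> \<ge> \<delta>"
    using \<theta> c_pos by (auto simp: \<delta>_def min_def field_simps)
  obtain K where K: "\<And>\<phi> p x. (1/2 - \<delta>) * magnetic_sq \<Omega> \<phi> p x + (c - \<delta>) * ((norm x)\<^sup>2 * mass \<phi>) \<le> quadratic_density V \<Omega> \<gamma> K \<phi> p x"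
    using quadratic_density_coercive[OF one_neq_two \<delta>(1) V_lower] by blast
  let ?mag = "magnetic_energy \<Omega>" and ?wt = weighted_mass and ?I = "interaction_energy c\<^sub>0 c\<^sub>1"
  note nn = nonneg_energies
  have QK: "\<delta> * (?mag z + ?wt z) + \<theta> / 2 * ?mag z \<le> Q K z" if "sobolev_jet z" for z
  proof -
    have "\<delta> * ?mag z + \<delta> * ?wt z \<le> (1/2 - \<delta> - \<theta> / 2) * ?mag z + (c - \<delta>) * ?wt z"
      using \<delta> by (intro add_mono mult_right_mono nn) auto
    also have "\<dots> = (1/2 - \<delta>) * ?mag z + (c - \<delta>) * ?wt z - \<theta> / 2 * ?mag z" by (simp add: algebra_simps)
    finally show ?thesis using Q_coercive[OF that K] by (simp add: algebra_simps)
  qed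
  have QK': "\<delta> * (?mag z + ?wt z) \<le> Q K z" if "sobolev_jet z" for z
  proof -
    have "0 \<le> \<theta> / 2 * ?mag z" using \<theta> by (intro mult_nonneg_nonneg nn) auto
    with QK[OF that] show ?thesis by linarith
  qed
  have Q_nonneg: "0 \<le> Q K z" if "sobolev_jet z" for z
  proof -
    have "0 \<le> \<delta> * (?mag z + ?wt z)" using \<delta> by (intro mult_nonneg_nonneg add_nonneg_nonneg nn) auto
    with QK'[OF that] show ?thesis by linarith
  qed
  define X where "X = {z::'n jet. sobolev_jet z \<and> total_mass z = 1}"
  define J where "J z = Q 0 z + ?I z" for z
  have JK: "J z + K = Q K z + ?I z" if "z \<in> X" for z
    using that Q_shift[of z K] by (simp add: X_def J_def)
  have low: "\<delta> * (?mag z + ?wt z) \<le> J z + K" if "z \<in> X" for z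
    using QK[of z] I[of z] JK[OF that] that by (simp add: X_def)
  define m where "m = Inf (J ` X)"
  have bdd: "bdd_below (J ` X)"
  proof (rule bdd_belowI2)
    fix z assume "z \<in> X"
    moreover have "0 \<le> \<delta> * (?mag z + ?wt z)" using \<delta> by (intro mult_nonneg_nonneg add_nonneg_nonneg nn) auto
    ultimately show "- K \<le> J z" using low[of z] by linarith
  qed
  have Xne: "J ` X \<noteq> {}"
  proof -
    obtain \<Psi> where "\<Psi> \<in> admissible V" using ne by blast
    then obtain z where "sobolev_jet z" "total_mass z = 1" "\<Psi> = (fst z 1, fst z 2, fst z 3)"
      by (rule jet_of_admissible)
    then have "z \<in> X" by (simp add: X_def)
    then show ?thesis by blast
  qed
  have "\<exists>z\<in>X. J z \<le> m + 1 / Suc n" for n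
  proof -
    have "Inf (J ` X) < m + 1 / Suc n" by (simp add: m_def)
    then obtain y where "y \<in> J ` X" "y < m + 1 / Suc n" using cInf_lessD[OF Xne] by blast
    then show ?thesis by (auto intro: less_imp_le)
  qed
  then obtain z where z: "\<And>n. z n \<in> X" "\<And>n. J (z n) \<le> m + 1 / Suc n" by metis
  have zs: "sobolev_jet (z n)" "total_mass (z n) = 1" for n using z(1) by (auto simp: X_def)
  define B where "B = (m + 1 + K) / \<delta>"
  have zB: "?mag (z n) + ?wt (z n) \<le> B" for n
  proof -
    have "1 / real (Suc n) \<le> 1" by simp
    then have "\<delta> * (?mag (z n) + ?wt (z n)) \<le> m + 1 + K" using low[OF z(1)[of n]] z(2)[of n] by linarith
    then show ?thesis using \<delta>(1) by (simp add: B_def field_simps)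
  qed
  have zB1: "?mag (z n) \<le> B" "?wt (z n) \<le> B" for n
    using zB[of n] nn(2)[of "z n"] nn(3)[of \<Omega> "z n"] by linarith+
  define A where "A = real CARD('n) * (2 * B + 2 * real CARD('n) * \<Omega>\<^sup>2 * B)"
  have tbA: "translation_bounded A (fst (z n) j)" for n j
  proof (rule translation_bounded_mono[OF sobolev_jet_translation_bounded[OF zs(1), where \<Omega>=\<Omega>]])
    show "real CARD('n) * (2 * ?mag (z n) + 2 * real CARD('n) * \<Omega>\<^sup>2 * ?wt (z n)) \<le> A"
      unfolding A_def using zB1 by (intro mult_left_mono add_mono) auto
  qed
  have "\<exists>r::nat\<Rightarrow>nat. strict_mono r \<and> (\<forall>j\<in>UNIV. \<exists>f\<in>L2. (\<lambda>n. L2_sq (\<lambda>x. fst (z (r n)) j x - f x)) \<longlonglongrightarrow> 0)"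
  proof (rule Rellich_finite[where J=UNIV and A=A and B=1 and C=B and u="\<lambda>n. fst (z n)", OF _ tbA])
    show "L2_sq (fst (z n) j) \<le> 1" for n j
    proof -
      have "L2_sq (fst (z n) j) \<le> (\<Sum>j\<in>UNIV. L2_sq (fst (z n) j))" by (rule member_le_sum) auto
      then show ?thesis using total_mass_eq[OF zs(1), of n] zs(2)[of n] by simp
    qed
    show "integrable lborel (\<lambda>x. (norm x)\<^sup>2 * (cmod (fst (z n) j x))\<^sup>2)" for n j
      by (rule sobolev_jetD(4)[OF zs(1)])
    show "(LINT x|lborel. (norm x)\<^sup>2 * (cmod (fst (z n) j x))\<^sup>2) \<le> B" for n j
    proof -
      have "(LINT x|lborel. (norm x)\<^sup>2 * (cmod (fst (z n) j x))\<^sup>2) \<le> ?wt (z n)"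
        unfolding weighted_mass_def
        by (intro integral_mono sobolev_jetD(4)[OF zs(1)] sobolev_jet_integrable(2)[OF zs(1)] mult_left_mono cmod_le_mass) simp
      with zB1(2)[of n] show ?thesis by linarith
    qed
  qed simp
  then obtain r where r: "strict_mono r" "\<forall>j\<in>UNIV. \<exists>f\<in>L2. (\<lambda>n. L2_sq (\<lambda>x. fst (z (r n)) j x - f x)) \<longlonglongrightarrow> 0"
    by (elim exE conjE)
  have "\<forall>j. \<exists>f. f \<in> L2 \<and> (\<lambda>n. L2_sq (\<lambda>x. fst (z (r n)) j x - f x)) \<longlonglongrightarrow> 0"
  proof
    fix j
    from r(2) UNIV_I have "\<exists>f\<in>L2. (\<lambda>n. L2_sq (\<lambda>x. fst (z (r n)) j x - f x)) \<longlonglongrightarrow> 0" by (rule bspec)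
    then show "\<exists>f. f \<in> L2 \<and> (\<lambda>n. L2_sq (\<lambda>x. fst (z (r n)) j x - f x)) \<longlonglongrightarrow> 0" unfolding Bex_def .
  qed
  then have "\<exists>\<Phi>. \<forall>j. \<Phi> j \<in> L2 \<and> (\<lambda>n. L2_sq (\<lambda>x. fst (z (r n)) j x - \<Phi> j x)) \<longlonglongrightarrow> 0" by (rule choice)
  then obtain \<Phi> where "\<forall>j. \<Phi> j \<in> L2 \<and> (\<lambda>n. L2_sq (\<lambda>x. fst (z (r n)) j x - \<Phi> j x)) \<longlonglongrightarrow> 0" by (elim exE)
  then have \<Phi>: "\<And>j. \<Phi> j \<in> L2" "\<And>j. (\<lambda>n. L2_sq (\<lambda>x. fst (z (r n)) j x - \<Phi> j x)) \<longlonglongrightarrow> 0"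
    by simp_all
  define y where "y n = z (r n)" for n
  have y: "y n \<in> X" "sobolev_jet (y n)" "total_mass (y n) = 1" for n using z(1) zs by (auto simp: y_def)
  have yJ: "(\<lambda>n. J (y n)) \<longlonglongrightarrow> m"
  proof (rule tendsto_sandwich[OF _ _ tendsto_const])
    show "\<forall>\<^sub>F n in sequentially. m \<le> J (y n)"
      unfolding m_def using y(1) by (intro always_eventually allI cInf_lower bdd) auto
    show "\<forall>\<^sub>F n in sequentially. J (y n) \<le> m + 1 / Suc (r n)"
      using z(2) by (intro always_eventually allI) (simp add: y_def)
    have "(\<lambda>n. 1 / real (Suc (r n))) \<longlonglongrightarrow> 0"
      using LIMSEQ_subseq_LIMSEQ[OF LIMSEQ_inverse_real_of_nat r(1)] by (simp add: o_def inverse_eq_divide)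
    from tendsto_add[OF tendsto_const this, of m] show "(\<lambda>n. m + 1 / real (Suc (r n))) \<longlonglongrightarrow> m" by simp
  qed
  define dist\<^sub>j where "dist\<^sub>j w j = L2_sq (\<lambda>x. fst w j x - \<Phi> j x)" for w :: "'n jet" and j
  have y\<Phi>: "(\<lambda>n. dist\<^sub>j (y n) j) \<longlonglongrightarrow> 0" for j unfolding dist\<^sub>j_def y_def by (rule \<Phi>(2))
  \<comment> \<open>Midpoint-closed sets that contain \<open>y n\<close> and shrink to the jets over \<open>\<Phi>\<close>.\<close>
  define \<C> where "\<C> n = {w. sobolev_jet w \<and> (\<forall>j \<epsilon>. (\<forall>k\<ge>n. dist\<^sub>j (y k) j \<le> \<epsilon>) \<longrightarrow> dist\<^sub>j w j \<le> \<epsilon>)}" for n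
  have \<C>s: "sobolev_jet w" if "w \<in> \<C> n" for w n using that by (simp add: \<C>_def)
  have y\<C>: "y n \<in> \<C> n" for n using y(2) by (auto simp: \<C>_def)
  obtain h d D where h: "\<And>n. h n \<in> \<C> n" "\<And>n. Q K (h n) \<le> d n + 1 / Suc n" "\<And>n w. w \<in> \<C> n \<Longrightarrow> d n \<le> Q K w"
    and d: "d \<longlonglongrightarrow> D" and Cauchy: "\<And>e. e > 0 \<Longrightarrow> \<exists>N. \<forall>m\<ge>N. \<forall>n\<ge>N. Q K (jet_diff (h m) (h n)) \<le> e"
  proof (rule parallelogram_minimizers_Cauchy[of \<C> jet_midpoint "Q K" "\<lambda>v w. Q K (jet_diff v w)" "m + 1 + K + \<theta> / 2 * B"])
    show "\<C> n \<subseteq> \<C> m" if "m \<le> n" for m n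
      using that unfolding \<C>_def by (auto dest: order_trans)
    show "jet_midpoint v w \<in> \<C> n" if vw: "v \<in> \<C> n" "w \<in> \<C> n" for n v w
    proof -
      note s = \<C>s[OF vw(1)] \<C>s[OF vw(2)]
      have "dist\<^sub>j (jet_midpoint v w) j \<le> \<epsilon>" if e: "\<forall>k\<ge>n. dist\<^sub>j (y k) j \<le> \<epsilon>" for j \<epsilon>
      proof -
        have "dist\<^sub>j (jet_midpoint v w) j \<le> (dist\<^sub>j v j + dist\<^sub>j w j) / 2"
          using L2_midpoint_dist[OF sobolev_jetD(1)[OF s(1)] sobolev_jetD(1)[OF s(2)] \<Phi>(1)]
          by (simp add: dist\<^sub>j_def jet_midpoint_def)
        moreover have "dist\<^sub>j v j \<le> \<epsilon>" "dist\<^sub>j w j \<le> \<epsilon>" using vw e unfolding \<C>_def by blast+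
        ultimately show ?thesis by simp
      qed
      then show ?thesis using sobolev_jet_midpoint[OF s] by (simp add: \<C>_def)
    qed
    show "0 \<le> Q K w" if "w \<in> \<C> 0" for w by (rule Q_nonneg[OF \<C>s[OF that]])
    show "4 * Q K (jet_midpoint v w) + Q K (jet_diff v w) = 2 * Q K v + 2 * Q K w"
      if "v \<in> \<C> 0" "w \<in> \<C> 0" for v w
      by (rule Q_parallelogram[OF \<C>s[OF that(1)] \<C>s[OF that(2)]])
    \<comment> \<open>The competitor is \<open>y n\<close>: its quadratic part is J + K minus the
      interaction, J is at most m + 1, and minus the interaction is at most \<theta>/2 times the
      magnetic energy, hence at most \<theta>/2 B.\<close>
    show "\<exists>w\<in>\<C> n. Q K w \<le> m + 1 + K + \<theta> / 2 * B" for n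
    proof (intro bexI[OF _ y\<C>])
      have "\<theta> / 2 * ?mag (y n) \<le> \<theta> / 2 * B" using \<theta> zB1 by (intro mult_left_mono) (auto simp: y_def)
      moreover have "1 / real (Suc (r n)) \<le> 1" by simp
      ultimately show "Q K (y n) \<le> m + 1 + K + \<theta> / 2 * B"
        using JK[OF y(1)[of n]] I[OF y(2,3), of n] z(2)[of "r n", folded y_def] by linarith
    qed
  qed (rule that)
  have hs: "sobolev_jet (h n)" for n using h(1) \<C>s by blast
  have h\<Phi>: "(\<lambda>n. L2_sq (\<lambda>x. fst (h n) j x - \<Phi> j x)) \<longlonglongrightarrow> 0" for j
  proof (rule LIMSEQ_I)
    fix e :: real assume "e > 0"
    then obtain N where N: "\<And>k. k \<ge> N \<Longrightarrow> dist\<^sub>j (y k) j < e / 2"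
      using order_tendstoD(2)[OF y\<Phi>, of "e / 2" j] by (auto simp: eventually_sequentially)
    have "norm (L2_sq (\<lambda>x. fst (h n) j x - \<Phi> j x) - 0) < e" if "n \<ge> N" for n
    proof -
      have "\<forall>k\<ge>n. dist\<^sub>j (y k) j \<le> e / 2" using N that by (meson less_imp_le order_trans)
      then have "dist\<^sub>j (h n) j \<le> e / 2" using h(1)[of n] unfolding \<C>_def by blast
      then show ?thesis using \<open>e > 0\<close> by (simp add: dist\<^sub>j_def)
    qed
    then show "\<exists>no. \<forall>n\<ge>no. norm (L2_sq (\<lambda>x. fst (h n) j x - \<Phi> j x) - 0) < e" by blast
  qed
  have "\<exists>R. R \<in> L2 \<and> (\<lambda>n. L2_sq (\<lambda>x. snd (h n) j i x - R x)) \<longlonglongrightarrow> 0" for j i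
  proof -
    \<comment> \<open>Combines the passage from plain to magnetic gradient with coercivity, so that
      being Cauchy for \<open>Q K\<close> implies being Cauchy in L2 for each derivative.\<close>
    define M where "M = (2 + 2 * real CARD('n) * \<Omega>\<^sup>2) / \<delta>"
    have M: "M > 0" using \<delta>(1) unfolding M_def by (intro divide_pos_pos add_pos_nonneg) auto
    have le: "L2_sq (\<lambda>x. snd (h a) j i x - snd (h b) j i x) \<le> M * Q K (jet_diff (h a) (h b))" for a b
    proof -
      let ?w = "jet_diff (h a) (h b)"
      have s: "sobolev_jet ?w" by (intro sobolev_jet_diff hs)
      have "L2_sq (\<lambda>x. snd (h a) j i x - snd (h b) j i x) = L2_sq (snd ?w j i)" by (simp add: jet_diff_def)
      also have "\<dots> \<le> 2 * ?mag ?w + 2 * real CARD('n) * \<Omega>\<^sup>2 * ?wt ?w"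
        by (rule order_trans[OF L2_sq_le_gradient_energy gradient_energy_le[OF s]])
      also have "\<dots> \<le> (2 + 2 * real CARD('n) * \<Omega>\<^sup>2) * (?mag ?w + ?wt ?w)"
      proof -
        have "0 \<le> 2 * ?wt ?w" "0 \<le> 2 * real CARD('n) * \<Omega>\<^sup>2 * ?mag ?w"
          using nn(2)[of ?w] nn(3)[of \<Omega> ?w] by auto
        moreover have "(2 + p) * (a + b) = 2 * a + p * b + (2 * b + p * a)" for p a b :: real by (simp add: algebra_simps)
        ultimately show ?thesis by simp
      qed
      also have "\<dots> = M * (\<delta> * (?mag ?w + ?wt ?w))" using \<delta>(1) by (simp add: M_def)
      also have "\<dots> \<le> M * Q K ?w" using QK'[OF s] M by (intro mult_left_mono) auto
      finally show ?thesis .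
    qed
    have "\<exists>N. \<forall>a\<ge>N. \<forall>b\<ge>N. L2_sq (\<lambda>x. snd (h a) j i x - snd (h b) j i x) \<le> e" if "e > 0" for e
    proof -
      obtain N where N: "\<And>a b. a \<ge> N \<Longrightarrow> b \<ge> N \<Longrightarrow> Q K (jet_diff (h a) (h b)) \<le> e / M"
        using Cauchy[of "e / M"] M \<open>e > 0\<close> by (metis divide_pos_pos)
      have "L2_sq (\<lambda>x. snd (h a) j i x - snd (h b) j i x) \<le> e" if "a \<ge> N" "b \<ge> N" for a b
      proof -
        have "M * Q K (jet_diff (h a) (h b)) \<le> M * (e / M)" using N[OF that] M by (intro mult_left_mono) auto
        with le[of a b] M show ?thesis by simp
      qed
      then show ?thesis by blast
    qed
    from L2_complete[OF sobolev_jetD(2)[OF hs] this] obtain R where "R \<in> L2" "(\<lambda>n. L2_sq (\<lambda>x. snd (h n) j i x - R x)) \<longlonglongrightarrow> 0" .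
    then show ?thesis by (intro exI[of _ R] conjI)
  qed
  then have "\<forall>j. \<forall>i. \<exists>R. R \<in> L2 \<and> (\<lambda>n. L2_sq (\<lambda>x. snd (h n) j i x - R x)) \<longlonglongrightarrow> 0" by (intro allI)
  then have "\<exists>R. \<forall>j i. R j i \<in> L2 \<and> (\<lambda>n. L2_sq (\<lambda>x. snd (h n) j i x - R j i x)) \<longlonglongrightarrow> 0"
    unfolding choice_iff .
  then obtain R where "\<forall>j i. R j i \<in> L2 \<and> (\<lambda>n. L2_sq (\<lambda>x. snd (h n) j i x - R j i x)) \<longlonglongrightarrow> 0" by (elim exE)
  then have R: "\<And>j i. R j i \<in> L2" "\<And>j i. (\<lambda>n. L2_sq (\<lambda>x. snd (h n) j i x - R j i x)) \<longlonglongrightarrow> 0"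
    by simp_all
  define Z where "Z = (\<Phi>, R)"
  have wp: "has_weak_partial i (\<Phi> j) (R j i)" for i j
    by (rule has_weak_partial_limit[OF sobolev_jetD(3)[OF hs] sobolev_jetD(1)[OF hs] \<Phi>(1) h\<Phi> sobolev_jetD(2)[OF hs] R])
  obtain s where s: "strict_mono s" "\<And>j. AE x in lborel. (\<lambda>k. fst (h (s k)) j x) \<longlonglongrightarrow> \<Phi> j x"
    "\<And>j i. AE x in lborel. (\<lambda>k. snd (h (s k)) j i x) \<longlonglongrightarrow> R j i x"
  proof -
    \<comment> \<open>Values and derivatives are indexed together, \<open>None\<close> standing for
      the value and \<open>Some i\<close> for the derivative in direction \<open>i\<close>, so that
      one subsequence serves all of them.\<close>
    define H where "H n = (\<lambda>(j, i). case i of None \<Rightarrow> fst (h n) j | Some i \<Rightarrow> snd (h n) j i)" for n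
    define L where "L = (\<lambda>(j, i). case i of None \<Rightarrow> \<Phi> j | Some i \<Rightarrow> R j i)"
    have "\<exists>s::nat\<Rightarrow>nat. strict_mono s \<and> (\<forall>p\<in>UNIV. AE x in lborel. (\<lambda>k. H (s k) p x) \<longlonglongrightarrow> L p x)"
      by (rule L2_subseq_AE_finite)
        (use sobolev_jetD(1,2)[OF hs] \<Phi>(1) R h\<Phi> in \<open>auto simp: H_def L_def split: option.splits\<close>)
    then obtain s where s: "strict_mono s" "\<forall>p\<in>UNIV. AE x in lborel. (\<lambda>k. H (s k) p x) \<longlonglongrightarrow> L p x" by (elim exE conjE)
    show ?thesis
    proof (rule that[OF s(1)])
      show "AE x in lborel. (\<lambda>k. fst (h (s k)) j x) \<longlonglongrightarrow> \<Phi> j x" for j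
        using bspec[OF s(2), of "(j, None)"] by (simp add: H_def L_def)
      show "AE x in lborel. (\<lambda>k. snd (h (s k)) j i x) \<longlonglongrightarrow> R j i x" for j i
        using bspec[OF s(2), of "(j, Some i)"] by (simp add: H_def L_def)
    qed
  qed
  have lim: "AE x in lborel. (\<forall>j\<in>UNIV. (\<lambda>k. fst (h (s k)) j x) \<longlonglongrightarrow> \<Phi> j x) \<and> (\<forall>j\<in>UNIV. \<forall>i\<in>UNIV. (\<lambda>k. snd (h (s k)) j i x) \<longlonglongrightarrow> R j i x)"
    by (intro AE_conjI AE_finite_allI s) auto
  have ds: "(\<lambda>k. d (s k) + 1 / real (Suc (s k))) \<longlonglongrightarrow> D"
    using tendsto_add[OF LIMSEQ_subseq_LIMSEQ[OF d s(1)] LIMSEQ_subseq_LIMSEQ[OF LIMSEQ_inverse_real_of_nat s(1)]]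
    by (simp add: o_def inverse_eq_divide)
  note [measurable] = L2_measurable[OF \<Phi>(1)]
  \<comment> \<open>The convergence to \<Phi> is in unweighted L2 and says nothing about second
    moments. Coercivity bounds those of \<open>h\<close> by \<delta>^-1 times \<open>Q K\<close>,
    and Fatou's lemma passes the bound to \<Phi>.\<close>
  have wint: "integrable lborel (\<lambda>x. (norm x)\<^sup>2 * mass (\<lambda>j. \<Phi> j x))"
  proof (rule Fatou_bound(1)[of lborel "\<lambda>k x. (norm x)\<^sup>2 * mass (val (h (s k)) x)"
        _ "\<lambda>k. (d (s k) + 1 / real (Suc (s k))) / \<delta>" "D / \<delta>"])
    show "integrable lborel (\<lambda>x. (norm x)\<^sup>2 * mass (val (h (s k)) x))" for k
      by (rule sobolev_jet_integrable(2)[OF hs])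
    show "AE x in lborel. 0 \<le> (norm x)\<^sup>2 * mass (val (h (s k)) x)" for k by (simp add: mass_nonneg)
    show "AE x in lborel. (\<lambda>k. (norm x)\<^sup>2 * mass (val (h (s k)) x)) \<longlonglongrightarrow> (norm x)\<^sup>2 * mass (\<lambda>j. \<Phi> j x)"
      using lim by eventually_elim (auto simp: mass_def intro!: tendsto_intros)
    show "(\<lambda>x. (norm x)\<^sup>2 * mass (\<lambda>j. \<Phi> j x)) \<in> borel_measurable lborel"
      unfolding mass_def by measurable
    show "(LINT x|lborel. (norm x)\<^sup>2 * mass (val (h (s k)) x)) \<le> (d (s k) + 1 / real (Suc (s k))) / \<delta>" for k
    proof -
      have "\<delta> * ?wt (h (s k)) \<le> \<delta> * (?mag (h (s k)) + ?wt (h (s k)))"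
        using \<delta>(1) nn(3)[of \<Omega> "h (s k)"] by (intro mult_left_mono) linarith+
      then have "\<delta> * ?wt (h (s k)) \<le> d (s k) + 1 / real (Suc (s k))"
        using QK'[OF hs, of "s k"] h(2)[of "s k"] by linarith
      then show ?thesis using \<delta>(1) unfolding weighted_mass_def by (simp add: pos_le_divide_eq mult.commute)
    qed
    show "(\<lambda>k. (d (s k) + 1 / real (Suc (s k))) / \<delta>) \<longlonglongrightarrow> D / \<delta>"
      using \<delta>(1) by (intro tendsto_divide ds tendsto_const) simp
  qed
  have Zs: "sobolev_jet Z"
  proof -
    have "integrable lborel (\<lambda>x. (norm x)\<^sup>2 * (cmod (\<Phi> j x))\<^sup>2)" for j
    proof (rule Bochner_Integration.integrable_bound[OF wint])
      have "norm ((norm x)\<^sup>2 * (cmod (\<Phi> j x))\<^sup>2) \<le> norm ((norm x)\<^sup>2 * mass (\<lambda>j. \<Phi> j x))" for x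
        using mult_left_mono[OF cmod_le_mass[of "\<lambda>j. \<Phi> j x" j], of "(norm x)\<^sup>2"] mass_nonneg[of "\<lambda>j. \<Phi> j x"]
        by (simp add: abs_mult)
      then show "AE x in lborel. norm ((norm x)\<^sup>2 * (cmod (\<Phi> j x))\<^sup>2) \<le> norm ((norm x)\<^sup>2 * mass (\<lambda>j. \<Phi> j x))" by simp
    qed measurable
    then show ?thesis using \<Phi>(1) R(1) wp by (simp add: Z_def sobolev_jet_def)
  qed
  have QZ: "Q K Z \<le> D"
    unfolding Q_def
  proof (rule Fatou_bound(2)[of lborel "\<lambda>k x. quadratic_density V \<Omega> \<gamma> K (val (h (s k)) x) (der (h (s k)) x) x"
        _ "\<lambda>k. d (s k) + 1 / real (Suc (s k))"])
    show "integrable lborel (\<lambda>x. quadratic_density V \<Omega> \<gamma> K (val (h (s k)) x) (der (h (s k)) x) x)" for k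
      by (rule quadratic_density_integrable[OF hs])
    show "AE x in lborel. 0 \<le> quadratic_density V \<Omega> \<gamma> K (val (h (s k)) x) (der (h (s k)) x) x" for k
    proof (intro AE_I2)
      fix x
      have "0 \<le> (1/2 - \<delta>) * magnetic_sq \<Omega> (val (h (s k)) x) (der (h (s k)) x) x + (c - \<delta>) * ((norm x)\<^sup>2 * mass (val (h (s k)) x))"
        using \<delta> \<theta> by (intro add_nonneg_nonneg mult_nonneg_nonneg mass_nonneg magnetic_sq_nonneg) auto
      with K show "0 \<le> quadratic_density V \<Omega> \<gamma> K (val (h (s k)) x) (der (h (s k)) x) x" by (rule order_trans[rotated])
    qed
    show "AE x in lborel. (\<lambda>k. quadratic_density V \<Omega> \<gamma> K (val (h (s k)) x) (der (h (s k)) x) x)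
        \<longlonglongrightarrow> quadratic_density V \<Omega> \<gamma> K (val Z x) (der Z x) x"
      using lim by eventually_elim
        (auto simp: quadratic_density_def magnetic_sq_def mass_def spin_orbit_form_def Z_def intro!: tendsto_intros)
    show "(\<lambda>x. quadratic_density V \<Omega> \<gamma> K (val Z x) (der Z x) x) \<in> borel_measurable lborel"
      by (rule borel_measurable_integrable[OF quadratic_density_integrable[OF Zs]])
    show "(LINT x|lborel. quadratic_density V \<Omega> \<gamma> K (val (h (s k)) x) (der (h (s k)) x) x) \<le> d (s k) + 1 / real (Suc (s k))" for k
      using h(2)[of "s k"] by (simp add: Q_def)
  qed (rule ds)
  have Zm: "total_mass Z = 1"
  proof -
    have "(\<lambda>n. \<Sum>j\<in>UNIV. L2_sq (fst (y n) j)) \<longlonglongrightarrow> (\<Sum>j\<in>UNIV. L2_sq (\<Phi> j))"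
      by (intro tendsto_sum L2_sq_tendsto sobolev_jetD(1)[OF y(2)] \<Phi>(1) y\<Phi>[unfolded dist\<^sub>j_def])
    then have "(\<lambda>n. 1) \<longlonglongrightarrow> total_mass Z"
      using y(3) total_mass_eq[OF y(2)] total_mass_eq[OF Zs] by (simp add: Z_def)
    then show ?thesis by (simp add: LIMSEQ_const_iff)
  qed
  have ZX: "Z \<in> X" using Zs Zm by (simp add: X_def)
  have IZ: "?I Z \<le> m + K - D"
  proof -
    obtain t where t: "strict_mono t" "\<And>j. AE x in lborel. (\<lambda>k. fst (y (t k)) j x) \<longlonglongrightarrow> \<Phi> j x"
    proof -
      have "\<exists>t::nat\<Rightarrow>nat. strict_mono t \<and> (\<forall>j\<in>UNIV. AE x in lborel. (\<lambda>k. fst (y (t k)) j x) \<longlonglongrightarrow> \<Phi> j x)"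
        by (rule L2_subseq_AE_finite[where h="\<lambda>n. fst (y n)"])
          (use sobolev_jetD(1)[OF y(2)] \<Phi>(1) y\<Phi> in \<open>auto simp: dist\<^sub>j_def\<close>)
      then obtain t :: "nat \<Rightarrow> nat" where t: "strict_mono t" "\<forall>j\<in>UNIV. AE x in lborel. (\<lambda>k. fst (y (t k)) j x) \<longlonglongrightarrow> \<Phi> j x"
        by (elim exE conjE)
      show ?thesis by (rule that[OF t(1) bspec[OF t(2) UNIV_I]])
    qed
    have lim': "AE x in lborel. \<forall>j\<in>UNIV. (\<lambda>k. fst (y (t k)) j x) \<longlonglongrightarrow> \<Phi> j x"
      by (intro AE_finite_allI t) auto
    define M where "M = 3 * (\<bar>c\<^sub>0\<bar> + \<bar>c\<^sub>1\<bar>)"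
    have M: "0 \<le> M" by (simp add: M_def)
    define S where "S \<phi> = (\<Sum>j\<in>UNIV. cmod (\<phi> j) ^ 4)" for \<phi> :: "3 \<Rightarrow> complex"
    have inter: "\<bar>interaction c\<^sub>0 c\<^sub>1 \<phi>\<bar> \<le> M * S \<phi>" for \<phi>
      using order_trans[OF interaction_bounds(1) mult_left_mono[OF mass_sq_le[of \<phi>], of "\<bar>c\<^sub>0\<bar> + \<bar>c\<^sub>1\<bar>"]]
      by (simp add: M_def S_def algebra_simps)
    have S8: "S \<phi> \<le> 8 * (S \<psi> + S (\<lambda>j. \<phi> j - \<psi> j))" for \<phi> \<psi>
    proof -
      have "S \<phi> \<le> (\<Sum>j\<in>UNIV. 8 * cmod (\<psi> j) ^ 4 + 8 * cmod (\<phi> j - \<psi> j) ^ 4)"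
        unfolding S_def
      proof (rule sum_mono)
        fix j
        have "cmod (\<phi> j) ^ 4 \<le> (cmod (\<psi> j) + cmod (\<phi> j - \<psi> j)) ^ 4"
          using norm_triangle_ineq[of "\<psi> j" "\<phi> j - \<psi> j"] by (intro power_mono) auto
        from this power4_add_le8 show "cmod (\<phi> j) ^ 4 \<le> 8 * cmod (\<psi> j) ^ 4 + 8 * cmod (\<phi> j - \<psi> j) ^ 4"
          by (rule order_trans)
      qed
      also have "\<dots> = 8 * (S \<psi> + S (\<lambda>j. \<phi> j - \<psi> j))"
        by (simp add: S_def sum.distrib sum_distrib_left)
      finally show ?thesis .
    qed
    let ?e = "\<lambda>n j. LINT x|lborel. cmod (fst (y n) j x - \<Phi> j x) ^ 4"
    have i4: "integrable lborel (\<lambda>x. cmod (\<Phi> j x) ^ 4)" for j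
      using sobolev_jet_L4[OF Zs dim] by (simp add: Z_def)
    have e4: "integrable lborel (\<lambda>x. cmod (fst (y n) j x - \<Phi> j x) ^ 4)" for n j
      using sobolev_jet_L4[OF sobolev_jet_diff[OF y(2) Zs] dim, of n j] by (simp add: jet_diff_def Z_def)
    have e0: "(\<lambda>n. ?e n j) \<longlonglongrightarrow> 0" for j
    proof (rule L4_tendsto_zero[OF translation_bounded_diff dim])
      show "translation_bounded A (fst (y n) j)" for n unfolding y_def by (rule tbA)
      show "translation_bounded (real CARD('n) * (2 * ?mag Z + 2 * real CARD('n) * \<Omega>\<^sup>2 * ?wt Z)) (\<Phi> j)"
        using sobolev_jet_translation_bounded[OF Zs, of \<Omega> j] by (simp add: Z_def)
      show "(\<lambda>n. L2_sq (\<lambda>x. fst (y n) j x - \<Phi> j x)) \<longlonglongrightarrow> 0" using y\<Phi> by (simp add: dist\<^sub>j_def)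
    qed
    have iS: "integrable lborel (\<lambda>x. S (\<lambda>j. \<Phi> j x))" "(LINT x|lborel. S (\<lambda>j. \<Phi> j x)) = (\<Sum>j\<in>UNIV. LINT x|lborel. cmod (\<Phi> j x) ^ 4)"
      unfolding S_def using i4 by (auto intro: Bochner_Integration.integral_sum)
    have eS: "integrable lborel (\<lambda>x. S (\<lambda>j. fst (y n) j x - \<Phi> j x))" "(LINT x|lborel. S (\<lambda>j. fst (y n) j x - \<Phi> j x)) = (\<Sum>j\<in>UNIV. ?e n j)" for n
      unfolding S_def using e4 by (auto intro: Bochner_Integration.integral_sum)
    let ?N = "LINT x|lborel. S (\<lambda>j. \<Phi> j x)"
    \<comment> \<open>The first summand makes \<open>u k\<close> nonnegative, and its integral converges by \<open>L\<^sup>4\<close> convergence, so Fatou's lemma applies.\<close>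
    define u where "u k x = 8 * M * (S (\<lambda>j. \<Phi> j x) + S (\<lambda>j. fst (y (t k)) j x - \<Phi> j x)) + interaction c\<^sub>0 c\<^sub>1 (val (y (t k)) x)" for k x
    have iy: "integrable lborel (\<lambda>x. interaction c\<^sub>0 c\<^sub>1 (val (y n) x))" for n
      by (rule sobolev_jet_interaction(1)[OF y(2) dim])
    have iZ: "integrable lborel (\<lambda>x. interaction c\<^sub>0 c\<^sub>1 (\<lambda>j. \<Phi> j x))"
      using sobolev_jet_interaction(1)[OF Zs dim] by (simp add: Z_def)
    have vi: "integrable lborel (\<lambda>x. 8 * M * (S (\<lambda>j. \<Phi> j x) + 0) + interaction c\<^sub>0 c\<^sub>1 (\<lambda>j. \<Phi> j x))"
      using iS iZ by simp
    have "(LINT x|lborel. 8 * M * (S (\<lambda>j. \<Phi> j x) + 0) + interaction c\<^sub>0 c\<^sub>1 (\<lambda>j. \<Phi> j x)) \<le> 8 * M * (?N + (\<Sum>j\<in>(UNIV::3 set). 0)) + (m + K - D)"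
    proof (rule Fatou_bound(2)[of lborel u])
      show "integrable lborel (u k)" for k
        unfolding u_def[abs_def] using iS eS iy by simp
      show "AE x in lborel. 0 \<le> u k x" for k
      proof (intro AE_I2)
        fix x
        have "\<bar>interaction c\<^sub>0 c\<^sub>1 (val (y (t k)) x)\<bar> \<le> M * (8 * (S (\<lambda>j. \<Phi> j x) + S (\<lambda>j. fst (y (t k)) j x - \<Phi> j x)))"
          using inter[of "val (y (t k)) x"] mult_left_mono[OF S8[of "val (y (t k)) x" "\<lambda>j. \<Phi> j x"] M] by linarith
        then show "0 \<le> u k x" unfolding u_def by (simp add: mult_ac)
      qed
      show "AE x in lborel. (\<lambda>k. u k x) \<longlonglongrightarrow> 8 * M * (S (\<lambda>j. \<Phi> j x) + 0) + interaction c\<^sub>0 c\<^sub>1 (\<lambda>j. \<Phi> j x)"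
        using lim'
      proof eventually_elim
        case (elim x)
        have "(\<lambda>k. S (\<lambda>j. fst (y (t k)) j x - \<Phi> j x)) \<longlonglongrightarrow> S (\<lambda>j. \<Phi> j x - \<Phi> j x)"
          unfolding S_def using elim by (intro tendsto_intros) auto
        then have "(\<lambda>k. S (\<lambda>j. fst (y (t k)) j x - \<Phi> j x)) \<longlonglongrightarrow> 0" by (simp add: S_def)
        then show ?case unfolding u_def
          by (intro tendsto_add tendsto_mult tendsto_const continuous_interaction) (use elim in auto)
      qed
      show "(\<lambda>x. 8 * M * (S (\<lambda>j. \<Phi> j x) + 0) + interaction c\<^sub>0 c\<^sub>1 (\<lambda>j. \<Phi> j x)) \<in> borel_measurable lborel"
        by (rule borel_measurable_integrable[OF vi])
      show "(LINT x|lborel. u k x) \<le> 8 * M * (?N + (\<Sum>j\<in>UNIV. ?e (t k) j)) + (J (y (t k)) + K - d (t k))" for k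
      proof -
        have "(LINT x|lborel. u k x) = 8 * M * (?N + (\<Sum>j\<in>UNIV. ?e (t k) j)) + ?I (y (t k))"
          unfolding u_def interaction_energy_def using iS eS iy by simp
        \<comment> \<open>\<open>y (t k)\<close> itself competes for the infimum
          \<open>d (t k)\<close>.\<close>
        moreover have "?I (y (t k)) \<le> J (y (t k)) + K - d (t k)"
          using JK[OF y(1), of "t k"] h(3)[OF y\<C>, of "t k"] by linarith
        ultimately show ?thesis by linarith
      qed
      show "(\<lambda>k. 8 * M * (?N + (\<Sum>j\<in>UNIV. ?e (t k) j)) + (J (y (t k)) + K - d (t k))) \<longlonglongrightarrow> 8 * M * (?N + (\<Sum>j\<in>(UNIV::3 set). 0)) + (m + K - D)"
        by (intro tendsto_intros LIMSEQ_subseq_LIMSEQ[OF e0 t(1), unfolded o_def]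
            LIMSEQ_subseq_LIMSEQ[OF yJ t(1), unfolded o_def] LIMSEQ_subseq_LIMSEQ[OF d t(1), unfolded o_def])
    qed
    then have "8 * M * ?N + ?I Z \<le> 8 * M * ?N + (m + K - D)"
      using iS iZ by (simp add: interaction_energy_def Z_def)
    then show ?thesis by simp
  qed
  have JZ: "J Z \<le> m" using JK[OF ZX] QZ IZ by linarith
  have "ground_state V c\<^sub>0 c\<^sub>1 \<Omega> \<gamma> (fst Z 1, fst Z 2, fst Z 3)"
    unfolding ground_state_def
  proof (intro conjI ballI admissible_of_jet Zs Zm)
    fix \<Psi> assume "\<Psi> \<in> admissible V"
    then obtain w where w: "sobolev_jet w" "total_mass w = 1" "\<Psi> = (fst w 1, fst w 2, fst w 3)"
      by (rule jet_of_admissible)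
    have "m \<le> J w" unfolding m_def using w by (intro cInf_lower bdd) (auto simp: X_def)
    with JZ show "energy V c\<^sub>0 c\<^sub>1 \<Omega> \<gamma> (fst Z 1, fst Z 2, fst Z 3) \<le> energy V c\<^sub>0 c\<^sub>1 \<Omega> \<gamma> \<Psi>"
      by (simp add: w(3) energy_eq[OF Zs] energy_eq[OF w(1)] J_def)
  qed
  then show ?thesis by blast
qed

end

subsection \<open>Harmonic traps\<close>

text \<open>The tent is the trial function showing that the admissible set is nonempty. Being
  Lipschitz with compact support, it receives its weak derivatives from the translation bound, with
  no explicit gradient.\<close>

lemma tent_L2:
  "(\<lambda>x::('n::finite) point. complex_of_real (max 0 (1 - norm x))) \<in> L2"
  "integrable lborel (\<lambda>x::'n point. (norm x)\<^sup>2 * (cmod (complex_of_real (max 0 (1 - norm x))))\<^sup>2)"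
  "L2_sq (\<lambda>x::'n point. complex_of_real (max 0 (1 - norm x))) > 0"
proof -
  let ?v = "\<lambda>x::'n point. complex_of_real (max 0 (1 - norm x))"
  have b: "integrable lborel (indicator (cball 0 1) :: 'n point \<Rightarrow> real)"
    using emeasure_compact_finite[OF compact_cball, of "0 :: 'n point" 1]
    by (intro integrable_real_indicator) (auto simp: less_top)
  have vb: "(cmod (?v x))\<^sup>2 \<le> indicator (cball 0 1) x" for x
  proof (cases "x \<in> cball 0 1")
    case True
    then have "(max 0 (1 - norm x))\<^sup>2 \<le> 1\<^sup>2" by (intro power_mono) auto
    then show ?thesis using True unfolding norm_of_real power2_abs by simp
  qed (simp add: max_def)
  show v: "?v \<in> L2" by (rule L2_bound(1)[OF _ b vb]) measurable
  show "integrable lborel (\<lambda>x. (norm x)\<^sup>2 * (cmod (?v x))\<^sup>2)"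
  proof (rule Bochner_Integration.integrable_bound[OF b])
    show "AE x in lborel. norm ((norm x)\<^sup>2 * (cmod (?v x))\<^sup>2) \<le> norm (indicator (cball 0 1) x :: real)"
    proof (intro AE_I2)
      fix x :: "'n point"
      show "norm ((norm x)\<^sup>2 * (cmod (?v x))\<^sup>2) \<le> norm (indicator (cball 0 1) x :: real)"
      proof (cases "x \<in> cball 0 1")
        case True
        then have "(norm x)\<^sup>2 \<le> 1" by (simp add: power_le_one)
        moreover have i: "indicator (cball 0 1) x = (1::real)" using True by simp
        moreover have "(cmod (?v x))\<^sup>2 \<le> 1" using vb[of x] unfolding i .
        ultimately have "(norm x)\<^sup>2 * (cmod (?v x))\<^sup>2 \<le> 1" by (intro mult_le_one) auto
        moreover have "norm ((norm x)\<^sup>2 * (cmod (?v x))\<^sup>2) = (norm x)\<^sup>2 * (cmod (?v x))\<^sup>2"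
          unfolding real_norm_def by (rule abs_of_nonneg) simp
        ultimately show ?thesis unfolding i by simp
      qed (simp add: max_def)
    qed
  qed measurable
  have "L2_sq ?v \<noteq> 0"
  proof
    assume "L2_sq ?v = 0"
    then have "AE x in lborel. (cmod (?v x))\<^sup>2 = 0"
      unfolding L2_sq_def by (subst (asm) integral_nonneg_eq_0_iff_AE[OF L2_integrable[OF v]]) auto
    then have "AE x in lborel. x \<notin> ball (0 :: 'n point) 1"
      by eventually_elim (auto simp: max_def split: if_splits)
    then have "emeasure lborel (ball (0 :: 'n point) 1) = 0"
      by (subst (asm) AE_iff_measurable[where N="ball 0 1"]) auto
    moreover have "emeasure lborel (box (0 :: 'n point) (\<chi> i. 1 / (2 * real CARD('n)))) \<le> emeasure lborel (ball (0 :: 'n point) 1)"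
    proof (rule emeasure_mono)
      show "box (0 :: 'n point) (\<chi> i. 1 / (2 * real CARD('n))) \<subseteq> ball 0 1"
      proof
        fix x :: "'n point" assume x: "x \<in> box 0 (\<chi> i. 1 / (2 * real CARD('n)))"
        have "norm x \<le> (\<Sum>i\<in>UNIV. \<bar>x $ i\<bar>)" by (rule norm_le_l1_cart)
        also have "\<dots> \<le> (\<Sum>i\<in>(UNIV::'n set). 1 / (2 * real CARD('n)))"
          using x by (intro sum_mono) (auto simp: mem_box_cart abs_le_iff less_imp_le intro: order_trans[of _ 0])
        also have "\<dots> < 1" by simp
        finally show "x \<in> ball 0 1" by simp
      qed
    qed simp
    moreover have "emeasure lborel (box (0 :: 'n point) (\<chi> i. 1 / (2 * real CARD('n)))) > 0"
      using emeasure_cart_cube(2)[of "1 / (2 * real CARD('n))" "0 :: 'n point"] by simp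
    ultimately show False by simp
  qed
  then show "L2_sq ?v > 0" using L2_sq_nonneg[of ?v] by linarith
qed

text \<open>The tent has Lipschitz constant 1, and an increment can be nonzero only where x or its
  translate lies in the unit ball; hence t^2 times twice the volume of that ball.\<close>

lemma tent_translation:
  "L2_sq (\<lambda>x::('n::finite) point. complex_of_real (max 0 (1 - norm (x + t *\<^sub>R axis i 1))) - complex_of_real (max 0 (1 - norm x)))
     \<le> t\<^sup>2 * (2 * measure lborel (cball (0 :: 'n point) 1))"
proof -
  let ?v = "\<lambda>x::'n point. max 0 (1 - norm x)"
  let ?b = "indicator (cball 0 1) :: 'n point \<Rightarrow> real"
  let ?a = "t *\<^sub>R axis i 1 :: 'n point"
  have b: "integrable lborel ?b" "(LINT x|lborel. ?b x) = measure lborel (cball (0 :: 'n point) 1)"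
    using emeasure_compact_finite[OF compact_cball, of "0 :: 'n point" 1]
    by (auto intro!: integrable_real_indicator simp: less_top)
  have bs: "(\<lambda>x. complex_of_real (?b x)) \<in> L2"
    by (rule L2_bound(1)[OF _ b(1)]) (auto simp: indicator_def)
  have b': "integrable lborel (\<lambda>x. ?b (x + ?a))" "(LINT x|lborel. ?b (x + ?a)) = measure lborel (cball (0 :: 'n point) 1)"
  proof -
    have "(?b y)\<^sup>2 = ?b y" for y by (auto simp: indicator_def)
    then show "integrable lborel (\<lambda>x. ?b (x + ?a))"
      using L2_integrable[OF L2_translate(1)[OF bs, of ?a]] by simp
    show "(LINT x|lborel. ?b (x + ?a)) = measure lborel (cball (0 :: 'n point) 1)"
      using lborel_translate[OF borel_measurable_integrable[OF b(1), simplified], of ?a] b(2) by simp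
  qed
  have "L2_sq (\<lambda>x. complex_of_real (?v (x + ?a)) - complex_of_real (?v x)) \<le> (LINT x|lborel. t\<^sup>2 * (?b x + ?b (x + ?a)))"
  proof (rule L2_bound(2))
    show "integrable lborel (\<lambda>x. t\<^sup>2 * (?b x + ?b (x + ?a)))" using b b' by simp
    show "(cmod (complex_of_real (?v (x + ?a)) - complex_of_real (?v x)))\<^sup>2 \<le> t\<^sup>2 * (?b x + ?b (x + ?a))" for x
    proof (cases "x \<in> cball 0 1 \<or> x + ?a \<in> cball 0 1")
      case True
      have "\<bar>?v (x + ?a) - ?v x\<bar> \<le> \<bar>norm (x + ?a) - norm x\<bar>" by linarith
      also have "\<dots> \<le> norm ?a" using norm_triangle_ineq3[of "x + ?a" x] by simp
      also have "\<dots> = \<bar>t\<bar>" by simp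
      finally have "\<bar>?v (x + ?a) - ?v x\<bar>\<^sup>2 \<le> \<bar>t\<bar>\<^sup>2" by (intro power_mono) auto
      then have "(cmod (complex_of_real (?v (x + ?a)) - complex_of_real (?v x)))\<^sup>2 \<le> t\<^sup>2 * 1"
        by (simp flip: of_real_diff)
      also have "\<dots> \<le> t\<^sup>2 * (?b x + ?b (x + ?a))"
        using True by (intro mult_left_mono) (auto simp: indicator_def)
      finally show ?thesis .
    qed (simp add: max_def)
  qed measurable
  also have "\<dots> = t\<^sup>2 * (2 * measure lborel (cball (0 :: 'n point) 1))"
    using b b' by simp
  finally show ?thesis .
qed

lemma sobolev_jet_normalized_exists:
  obtains z :: "('n::finite) jet" where "sobolev_jet z" "total_mass z = 1"
proof -
  let ?v = "\<lambda>x::'n point. complex_of_real (max 0 (1 - norm x))"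
  have "\<exists>g. g \<in> L2 \<and> has_weak_partial i ?v g" for i
    using weak_partial_of_translation_bound[OF tent_L2(1) tent_translation, of i] by blast
  then obtain g where g: "\<And>i. g i \<in> L2" "\<And>i. has_weak_partial i ?v (g i)" by metis
  define w :: "'n jet" where "w = (\<lambda>_. ?v, \<lambda>_. g)"
  have w: "sobolev_jet w" using g tent_L2(1,2) by (simp add: w_def sobolev_jet_def)
  let ?s = "3 * L2_sq ?v"
  have s: "?s > 0" using tent_L2(3) by simp
  define a where "a = complex_of_real (1 / sqrt ?s)"
  let ?z = "(\<lambda>j x. a * fst w j x + 0 * fst w j x, \<lambda>j i x. a * snd w j i x + 0 * snd w j i x) :: 'n jet"
  have z: "sobolev_jet ?z" by (rule sobolev_jet_combination[OF w w])
  have "total_mass ?z = (\<Sum>j\<in>(UNIV :: 3 set). (cmod a)\<^sup>2 * L2_sq ?v)"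
    unfolding total_mass_eq[OF z] by (simp add: w_def L2_sq_cmult)
  also have "\<dots> = (cmod a)\<^sup>2 * ?s" by simp
  also have "(cmod a)\<^sup>2 = (1 / sqrt ?s)\<^sup>2" unfolding a_def norm_of_real power2_abs ..
  also have "(1 / sqrt ?s)\<^sup>2 = 1 / ?s" using s by (simp add: power_divide)
  also have "1 / ?s * ?s = 1" using s by simp
  finally show ?thesis using that[OF z] by simp
qed

text \<open>The scalar inequality is applied to |u|, which has the same L2 and L4 norms as
  \<open>u\<close> and, direction by direction, no more gradient energy than the magnetic gradient
  of \<open>u\<close>. The constant is unchanged.\<close>

lemma magnetic_Gagliardo_Nirenberg:
  fixes u :: "2 wavefun"
  assumes u: "u \<in> L2" and g: "\<And>i. has_weak_partial i u (g i)"
    and G: "\<And>i. (\<lambda>x. g i x - \<i> * of_real (vector_potential \<Omega> i x) * u x) \<in> L2"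
  shows "C\<^sub>b * (LINT x|lborel. cmod (u x) ^ 4)
    \<le> (\<Sum>i\<in>UNIV. L2_sq (\<lambda>x. g i x - \<i> * of_real (vector_potential \<Omega> i x) * u x)) * L2_sq u"
proof -
  have "\<exists>k. k \<in> L2 \<and> has_weak_partial i (\<lambda>x. of_real (cmod (u x))) k \<and>
      L2_sq k \<le> L2_sq (\<lambda>x. g i x - \<i> * of_real (vector_potential \<Omega> i x) * u x)" for i
  proof -
    obtain p :: "2 point \<Rightarrow> real" where p: "\<And>k. Ck k p" "\<And>x. partial_deriv i p x = vector_potential \<Omega> i x"
      by (rule vector_potential_gauge[of i \<Omega>]) auto
    from diamagnetic[OF u g p(1), of i, unfolded p(2), OF G] show ?thesis by blast
  qed
  then have "\<exists>k. \<forall>i. k i \<in> L2 \<and> has_weak_partial i (\<lambda>x. of_real (cmod (u x))) (k i) \<and>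
      L2_sq (k i) \<le> L2_sq (\<lambda>x. g i x - \<i> * of_real (vector_potential \<Omega> i x) * u x)" by (intro choice allI)
  then obtain k where "\<forall>i. k i \<in> L2 \<and> has_weak_partial i (\<lambda>x. of_real (cmod (u x))) (k i) \<and>
      L2_sq (k i) \<le> L2_sq (\<lambda>x. g i x - \<i> * of_real (vector_potential \<Omega> i x) * u x)" ..
  then have k: "\<And>i. k i \<in> L2" "\<And>i. has_weak_partial i (\<lambda>x. of_real (cmod (u x))) (k i)"
      "\<And>i. L2_sq (k i) \<le> L2_sq (\<lambda>x. g i x - \<i> * of_real (vector_potential \<Omega> i x) * u x)" by simp_all
  have "C\<^sub>b * (LINT x|lborel. cmod (of_real (cmod (u x)) :: complex) ^ 4) \<le> (\<Sum>i\<in>UNIV. L2_sq (k i)) * L2_sq (\<lambda>x. of_real (cmod (u x)))"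
    by (rule C\<^sub>b_inequality[OF L2_cmod[OF u] k(2) k(1)])
  also have "L2_sq (\<lambda>x. of_real (cmod (u x))) = L2_sq u" by (simp add: L2_sq_def)
  also have "(\<Sum>i\<in>UNIV. L2_sq (k i)) * L2_sq u \<le> (\<Sum>i\<in>UNIV. L2_sq (\<lambda>x. g i x - \<i> * of_real (vector_potential \<Omega> i x) * u x)) * L2_sq u"
    by (intro mult_right_mono sum_mono k) simp
  finally show ?thesis by simp
qed

text \<open>Nothing is lost in passing to three components. Cauchy-Schwarz bounds the L2 norm of rho
  by the sum of the squared L4 norms of the components; each is at most sqrt(M_j m_j / C_b), where
  M_j and m_j are the magnetic energy and mass of component j, and a second Cauchy-Schwarz in j
  brings the total magnetic energy and the total mass 1 back.\<close>

lemma spinor_Gagliardo_Nirenberg: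
  fixes z :: "2 jet"
  assumes z: "sobolev_jet z" and m: "total_mass z = 1" and C: "C\<^sub>b > 0"
  shows "C\<^sub>b * (LINT x|lborel. (mass (val z x))\<^sup>2) \<le> magnetic_energy \<Omega> z"
proof -
  note zD = sobolev_jetD[OF z]
  note [measurable] = L2_measurable[OF zD(1)]
  have i4: "integrable lborel (\<lambda>x. cmod (fst z j x) ^ 4)" for j
    by (rule sobolev_jet_L4[OF z]) simp
  define N where "N j = (LINT x|lborel. cmod (fst z j x) ^ 4)" for j
  define M where "M j = (\<Sum>i\<in>UNIV. L2_sq (\<lambda>x. snd z j i x - \<i> * of_real (vector_potential \<Omega> i x) * fst z j x))" for j
  have N0: "0 \<le> N j" for j by (simp add: N_def)
  have M0: "0 \<le> M j" for j by (simp add: M_def sum_nonneg)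
  have NM: "C\<^sub>b * N j \<le> M j * L2_sq (fst z j)" for j
    unfolding N_def M_def by (rule magnetic_Gagliardo_Nirenberg[OF zD(1) zD(3) sobolev_jet_integrable(3)[OF z]])
  have cross: "integrable lborel (\<lambda>x. (cmod (fst z j x))\<^sup>2 * (cmod (fst z k x))\<^sup>2)"
    "(LINT x|lborel. (cmod (fst z j x))\<^sup>2 * (cmod (fst z k x))\<^sup>2) \<le> sqrt (N j) * sqrt (N k)" for j k
  proof -
    have p: "(a\<^sup>2)\<^sup>2 = a ^ 4" for a :: real by (simp flip: power_mult)
    have ii: "integrable lborel (\<lambda>x. ((cmod (fst z j x))\<^sup>2)\<^sup>2)" for j using i4 by (simp only: p)
    note CS = Cauchy_Schwarz_integral[OF _ _ ii ii]
    show "integrable lborel (\<lambda>x. (cmod (fst z j x))\<^sup>2 * (cmod (fst z k x))\<^sup>2)" by (rule CS(1)) measurable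
    have "(LINT x|lborel. (cmod (fst z j x))\<^sup>2 * (cmod (fst z k x))\<^sup>2)\<^sup>2 \<le> N j * N k"
      unfolding N_def p[symmetric] by (rule CS(3)) measurable
    then show "(LINT x|lborel. (cmod (fst z j x))\<^sup>2 * (cmod (fst z k x))\<^sup>2) \<le> sqrt (N j) * sqrt (N k)"
      unfolding real_sqrt_mult[symmetric] by (rule real_le_rsqrt)
  qed
  have "(LINT x|lborel. (mass (val z x))\<^sup>2) = (LINT x|lborel. (\<Sum>j\<in>UNIV. \<Sum>k\<in>UNIV. (cmod (fst z j x))\<^sup>2 * (cmod (fst z k x))\<^sup>2))"
    by (simp only: mass_def power2_eq_square[of "sum _ _"] sum_product)
  also have "\<dots> = (\<Sum>j\<in>UNIV. \<Sum>k\<in>UNIV. LINT x|lborel. (cmod (fst z j x))\<^sup>2 * (cmod (fst z k x))\<^sup>2)"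
    using cross(1) by (simp add: Bochner_Integration.integral_sum Bochner_Integration.integrable_sum)
  also have "\<dots> \<le> (\<Sum>j\<in>UNIV. \<Sum>k\<in>UNIV. sqrt (N j) * sqrt (N k))"
    by (intro sum_mono cross(2))
  also have "\<dots> = (\<Sum>j\<in>UNIV. sqrt (N j))\<^sup>2"
    by (simp only: power2_eq_square sum_product)
  finally have "C\<^sub>b * (LINT x|lborel. (mass (val z x))\<^sup>2) \<le> C\<^sub>b * (\<Sum>j\<in>UNIV. sqrt (N j))\<^sup>2"
    using C by (intro mult_left_mono) auto
  also have "\<dots> = (\<Sum>j\<in>UNIV. sqrt (C\<^sub>b * N j))\<^sup>2"
    using C by (simp add: real_sqrt_mult sum_distrib_left[symmetric] power_mult_distrib)
  also have "\<dots> \<le> (\<Sum>j\<in>UNIV. sqrt (M j) * sqrt (L2_sq (fst z j)))\<^sup>2"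
  proof (intro power_mono sum_mono sum_nonneg)
    show "sqrt (C\<^sub>b * N j) \<le> sqrt (M j) * sqrt (L2_sq (fst z j))" for j
      unfolding real_sqrt_mult[symmetric] by (rule real_sqrt_le_mono[OF NM])
    show "0 \<le> sqrt (C\<^sub>b * N j)" for j using C N0[of j] by simp
  qed
  also have "\<dots> \<le> (\<Sum>j\<in>UNIV. (sqrt (M j))\<^sup>2) * (\<Sum>j\<in>UNIV. (sqrt (L2_sq (fst z j)))\<^sup>2)"
    by (rule Cauchy_Schwarz_ineq_sum)
  also have "\<dots> = magnetic_energy \<Omega> z * total_mass z"
    using M0 by (simp add: magnetic_energy_eq[OF z] total_mass_eq[OF z] M_def)
  finally show ?thesis using m by simp
qed

section \<open>The harmonic potentials in two and three dimensions\<close>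

lemma norm_sq_2: "(norm (x :: 2 point))\<^sup>2 = (x $ 1)\<^sup>2 + (x $ 2)\<^sup>2"
  unfolding power2_norm_eq_inner inner_vec_def by (simp add: sum_2 power2_eq_square)

lemma norm_sq_3: "(norm (x :: 3 point))\<^sup>2 = (x $ 1)\<^sup>2 + (x $ 2)\<^sup>2 + (x $ 3)\<^sup>2"
  unfolding power2_norm_eq_inner inner_vec_def by (simp add: sum_3 power2_eq_square)

lemma interaction_energy_lower:
  fixes z :: "('n::{finite,numeral}) jet"
  assumes z: "sobolev_jet z" and d: "CARD('n) \<le> 3" and b: "- \<beta> \<le> c\<^sub>0" "- \<beta> \<le> c\<^sub>0 + c\<^sub>1"
  shows "- (\<beta> / 2) * (LINT x|lborel. (mass (val z x))\<^sup>2) \<le> interaction_energy c\<^sub>0 c\<^sub>1 z"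
proof -
  note i = sobolev_jet_interaction[OF z d]
  have "- (\<beta> / 2) * (LINT x|lborel. (mass (val z x))\<^sup>2) = (LINT x|lborel. - (\<beta> / 2) * (mass (val z x))\<^sup>2)"
    by (rule integral_mult_right_zero[symmetric])
  also have "\<dots> \<le> interaction_energy c\<^sub>0 c\<^sub>1 z"
    unfolding interaction_energy_def
    by (intro integral_mono integrable_mult_right i interaction_bounds(2) b)
  finally show ?thesis .
qed

theorem theorem1:
  fixes \<gamma>\<^sub>x \<gamma>\<^sub>y c\<^sub>0 c\<^sub>1 \<Omega> \<gamma> :: real
  assumes "\<gamma>\<^sub>x > 0" and "\<gamma>\<^sub>y > 0" and "\<bar>\<Omega>\<bar> < min \<gamma>\<^sub>x \<gamma>\<^sub>y"
  shows "(c\<^sub>0 > - C\<^sub>b \<and> c\<^sub>0 + c\<^sub>1 > - C\<^sub>b \<longrightarrow>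
            (\<exists>\<Phi>. ground_state (harmonic_2d \<gamma>\<^sub>x \<gamma>\<^sub>y) c\<^sub>0 c\<^sub>1 \<Omega> \<gamma> \<Phi>))
       \<and> (\<forall>\<gamma>\<^sub>z > 0. (c\<^sub>0 \<ge> 0 \<and> c\<^sub>1 \<ge> 0) \<or> (c\<^sub>1 \<le> 0 \<and> c\<^sub>0 + c\<^sub>1 \<ge> 0) \<longrightarrow>
            (\<exists>\<Phi>. ground_state (harmonic_3d \<gamma>\<^sub>x \<gamma>\<^sub>y \<gamma>\<^sub>z) c\<^sub>0 c\<^sub>1 \<Omega> \<gamma> \<Phi>))"
proof -
  \<comment> \<open>The confinement in the weaker of the directions x and y once the centrifugal
    potential is removed; it is positive because |\<Omega>| is below both frequencies.\<close>
  define a where "a = (min (\<gamma>\<^sub>x\<^sup>2) (\<gamma>\<^sub>y\<^sup>2) - \<Omega>\<^sup>2) / 2"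
  have "\<bar>\<Omega>\<bar>\<^sup>2 < \<gamma>\<^sub>x\<^sup>2" "\<bar>\<Omega>\<bar>\<^sup>2 < \<gamma>\<^sub>y\<^sup>2" 
    using assms power_strict_mono[of "\<bar>\<Omega>\<bar>" \<gamma>\<^sub>x 2] power_strict_mono[of "\<bar>\<Omega>\<bar>" \<gamma>\<^sub>y 2] by simp_all
  then have a: "a > 0" "\<Omega>\<^sup>2 / 2 + a \<le> \<gamma>\<^sub>x\<^sup>2 / 2" "\<Omega>\<^sup>2 / 2 + a \<le> \<gamma>\<^sub>y\<^sup>2 / 2" by (auto simp: a_def field_simps)
  have ax: "(\<Omega>\<^sup>2 / 2 + a) * s\<^sup>2 \<le> \<gamma>\<^sub>x\<^sup>2 / 2 * s\<^sup>2" "(\<Omega>\<^sup>2 / 2 + a) * s\<^sup>2 \<le> \<gamma>\<^sub>y\<^sup>2 / 2 * s\<^sup>2" for s :: real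
    by (rule mult_right_mono[OF a(2)], simp, rule mult_right_mono[OF a(3)], simp)
  show ?thesis
  proof (intro conjI allI impI)
    assume c: "c\<^sub>0 > - C\<^sub>b \<and> c\<^sub>0 + c\<^sub>1 > - C\<^sub>b"
    interpret trap "harmonic_2d \<gamma>\<^sub>x \<gamma>\<^sub>y" \<Omega> \<gamma> c\<^sub>0 c\<^sub>1 a "(\<gamma>\<^sub>x\<^sup>2 + \<gamma>\<^sub>y\<^sup>2) / 2"
    proof
      show "harmonic_2d \<gamma>\<^sub>x \<gamma>\<^sub>y \<in> borel_measurable borel" unfolding harmonic_2d_def[abs_def] by measurable
      show "a * (norm x)\<^sup>2 \<le> harmonic_2d \<gamma>\<^sub>x \<gamma>\<^sub>y x - \<Omega>\<^sup>2 / 2 * ((x $ 1)\<^sup>2 + (x $ 2)\<^sup>2)" for x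
        using ax(1)[of "x $ 1"] ax(2)[of "x $ 2"] unfolding norm_sq_2 harmonic_2d_def by (simp add: algebra_simps)
      show "harmonic_2d \<gamma>\<^sub>x \<gamma>\<^sub>y x \<le> (\<gamma>\<^sub>x\<^sup>2 + \<gamma>\<^sub>y\<^sup>2) / 2 * (norm x)\<^sup>2" for x
      proof -
        have "harmonic_2d \<gamma>\<^sub>x \<gamma>\<^sub>y x + (\<gamma>\<^sub>y\<^sup>2 / 2 * (x $ 1)\<^sup>2 + \<gamma>\<^sub>x\<^sup>2 / 2 * (x $ 2)\<^sup>2) = (\<gamma>\<^sub>x\<^sup>2 + \<gamma>\<^sub>y\<^sup>2) / 2 * (norm x)\<^sup>2"
          unfolding norm_sq_2 harmonic_2d_def by (simp add: algebra_simps add_divide_distrib)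
        moreover have "0 \<le> \<gamma>\<^sub>y\<^sup>2 / 2 * (x $ 1)\<^sup>2 + \<gamma>\<^sub>x\<^sup>2 / 2 * (x $ 2)\<^sup>2" by simp
        ultimately show ?thesis by linarith
      qed
    qed (use a in auto)
    obtain z :: "2 jet" where z: "sobolev_jet z" "total_mass z = 1" by (rule sobolev_jet_normalized_exists)
    have ne: "admissible (harmonic_2d \<gamma>\<^sub>x \<gamma>\<^sub>y) \<noteq> {}" using admissible_of_jet[OF z] by blast
    \<comment> \<open>The least nonnegative number with -\<beta> below both \<open>c\<^sub>0\<close>
      and \<open>c\<^sub>0 + c\<^sub>1\<close>. If it is 0, the interaction is nonnegative and
      \<theta> = 0 works. Otherwise 0 < \<beta> < C_b also yields C_b > 0, which makes the ratio
      \<beta>/C_b a legitimate \<theta> below 1.\<close>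
    define \<beta> where "\<beta> = max 0 (max (- c\<^sub>0) (- (c\<^sub>0 + c\<^sub>1)))"
    have \<beta>: "0 \<le> \<beta>" "- \<beta> \<le> c\<^sub>0" "- \<beta> \<le> c\<^sub>0 + c\<^sub>1" "\<beta> = 0 \<or> \<beta> < C\<^sub>b" using c by (auto simp: \<beta>_def)
    note lower = interaction_energy_lower[OF _ dim \<beta>(2,3)]
    show "\<exists>\<Phi>. ground_state (harmonic_2d \<gamma>\<^sub>x \<gamma>\<^sub>y) c\<^sub>0 c\<^sub>1 \<Omega> \<gamma> \<Phi>"
    proof (cases "\<beta> = 0")
      case True
      show ?thesis
        by (rule ground_state_exists[OF ne, of 0]) (use lower True in auto)
    next
      case False
      then have C: "\<beta> < C\<^sub>b" "C\<^sub>b > 0" using \<beta> by auto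
      show ?thesis
      proof (rule ground_state_exists[OF ne, of "\<beta> / C\<^sub>b"])
        show "0 \<le> \<beta> / C\<^sub>b" "\<beta> / C\<^sub>b < 1" using C \<beta> by auto
        fix z :: "2 jet" assume z: "sobolev_jet z" "total_mass z = 1"
        let ?m = "LINT x|lborel. (mass (val z x))\<^sup>2"
        have "\<beta> / C\<^sub>b / 2 * (C\<^sub>b * ?m) \<le> \<beta> / C\<^sub>b / 2 * magnetic_energy \<Omega> z"
          using C \<beta>(1) by (intro mult_left_mono spinor_Gagliardo_Nirenberg z) auto
        then have "\<beta> / 2 * ?m \<le> \<beta> / C\<^sub>b / 2 * magnetic_energy \<Omega> z" using C by simp
        with lower[OF z(1)] show "- (\<beta> / C\<^sub>b / 2) * magnetic_energy \<Omega> z \<le> interaction_energy c\<^sub>0 c\<^sub>1 z" by linarith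
      qed
    qed
  next
    fix \<gamma>\<^sub>z :: real
    assume gz: "\<gamma>\<^sub>z > 0" and c: "(c\<^sub>0 \<ge> 0 \<and> c\<^sub>1 \<ge> 0) \<or> (c\<^sub>1 \<le> 0 \<and> c\<^sub>0 + c\<^sub>1 \<ge> 0)"
    define b where "b = min a (\<gamma>\<^sub>z\<^sup>2 / 2)"
    have b: "b > 0" "b \<le> a" "b \<le> \<gamma>\<^sub>z\<^sup>2 / 2" using a gz by (auto simp: b_def)
    have bx: "b * s\<^sup>2 \<le> a * s\<^sup>2" "b * s\<^sup>2 \<le> \<gamma>\<^sub>z\<^sup>2 / 2 * s\<^sup>2" for s :: real
      by (rule mult_right_mono[OF b(2)], simp, rule mult_right_mono[OF b(3)], simp)
    interpret trap "harmonic_3d \<gamma>\<^sub>x \<gamma>\<^sub>y \<gamma>\<^sub>z" \<Omega> \<gamma> c\<^sub>0 c\<^sub>1 b "(\<gamma>\<^sub>x\<^sup>2 + \<gamma>\<^sub>y\<^sup>2 + \<gamma>\<^sub>z\<^sup>2) / 2"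
    proof
      show "harmonic_3d \<gamma>\<^sub>x \<gamma>\<^sub>y \<gamma>\<^sub>z \<in> borel_measurable borel" unfolding harmonic_3d_def[abs_def] by measurable
      show "b * (norm x)\<^sup>2 \<le> harmonic_3d \<gamma>\<^sub>x \<gamma>\<^sub>y \<gamma>\<^sub>z x - \<Omega>\<^sup>2 / 2 * ((x $ 1)\<^sup>2 + (x $ 2)\<^sup>2)" for x
        using ax(1)[of "x $ 1"] ax(2)[of "x $ 2"] bx(1)[of "x $ 1"] bx(1)[of "x $ 2"] bx(2)[of "x $ 3"]
        unfolding norm_sq_3 harmonic_3d_def by (simp add: algebra_simps)
      show "harmonic_3d \<gamma>\<^sub>x \<gamma>\<^sub>y \<gamma>\<^sub>z x \<le> (\<gamma>\<^sub>x\<^sup>2 + \<gamma>\<^sub>y\<^sup>2 + \<gamma>\<^sub>z\<^sup>2) / 2 * (norm x)\<^sup>2" for x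
      proof -
        let ?r = "(\<gamma>\<^sub>y\<^sup>2 + \<gamma>\<^sub>z\<^sup>2) / 2 * (x $ 1)\<^sup>2 + (\<gamma>\<^sub>x\<^sup>2 + \<gamma>\<^sub>z\<^sup>2) / 2 * (x $ 2)\<^sup>2 + (\<gamma>\<^sub>x\<^sup>2 + \<gamma>\<^sub>y\<^sup>2) / 2 * (x $ 3)\<^sup>2"
        have "harmonic_3d \<gamma>\<^sub>x \<gamma>\<^sub>y \<gamma>\<^sub>z x + ?r = (\<gamma>\<^sub>x\<^sup>2 + \<gamma>\<^sub>y\<^sup>2 + \<gamma>\<^sub>z\<^sup>2) / 2 * (norm x)\<^sup>2"
          unfolding norm_sq_3 harmonic_3d_def by (simp add: algebra_simps add_divide_distrib)
        moreover have "0 \<le> ?r" by simp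
        ultimately show ?thesis by linarith
      qed
    qed (use b in auto)
    obtain z :: "3 jet" where z: "sobolev_jet z" "total_mass z = 1" by (rule sobolev_jet_normalized_exists)
    have ne: "admissible (harmonic_3d \<gamma>\<^sub>x \<gamma>\<^sub>y \<gamma>\<^sub>z) \<noteq> {}" using admissible_of_jet[OF z] by blast
    \<comment> \<open>In the second alternative \<open>c\<^sub>0\<close> >=
      -\<open>c\<^sub>1\<close> >= 0. Both alternatives thus make the interaction nonnegative, and
      \<theta> = 0 suffices.\<close>
    have "- 0 \<le> c\<^sub>0" "- 0 \<le> c\<^sub>0 + c\<^sub>1" using c by auto
    note lower = interaction_energy_lower[OF _ dim this]
    show "\<exists>\<Phi>. ground_state (harmonic_3d \<gamma>\<^sub>x \<gamma>\<^sub>y \<gamma>\<^sub>z) c\<^sub>0 c\<^sub>1 \<Omega> \<gamma> \<Phi>"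
      by (rule ground_state_exists[OF ne, of 0]) (use lower in auto)
  qed
qed

end
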